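(* Let $\alpha>1$ and let $f\in W[|v|^\alpha;L^1(\mathbb{R})]\cap C_b(\mathbb{R})$, i.e., $f\in L^1(\mathbb{R})\cap C_b(\mathbb{R})$ possesses a strong Riesz derivative $D_{\rm s}^{\{\alpha\}}f\in L^1(\mathbb{R})$. Then for each $r\in\mathbb{N}$ and every $h>0$, with $\sigma=2\pi/h$, $$|R_\sigma(f)|\le h^\alpha\,\frac{\zeta(\alpha)}{\pi^\alpha2^{r+\alpha-1}}\,\omega_r\Big(D_{\rm s}^{\{\alpha\}}f;\frac h2;L^1(\mathbb{R})\Big).$$ Furthermore, for every $h>0$, with $\sigma=2\pi/h$, $$|R_\sigma(f)|\le h^\alpha\,\frac{\zeta(\alpha)}{\pi^\alpha2^{\alpha-1}}\,\big\|D_{\rm s}^{\{\alpha\}}f\big\|_{L^1(\mathbb{R})}.$$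
   Context: Fourier transform: $\widehat f(v)=\frac{1}{\sqrt{2\pi}}\int_{\mathbb{R}} f(u)e^{-iuv}\,du$ for $f\in L^1(\mathbb{R})$. $\zeta$ is the Riemann zeta function. $C_b(\mathbb{R})$ is the class of continuous bounded functions $f:\mathbb{R}\to\mathbb{C}$. $W[|v|^\alpha;L^1(\mathbb{R})]$ is the set of $f\in L^1(\mathbb{R})$ for which there is $g\in L^1(\mathbb{R})$ with $|v|^\alpha\widehat f(v)=\widehat g(v)$. Strong Riesz derivative: a function $f\in L^1(\mathbb{R})$ has a strong Riesz derivative of order $\alpha$, $0<\alpha<2j$, $j\in\mathbb{N}$, if there is $g\in L^1(\mathbb{R})$ with $$\lim_{\varepsilon\to0+}\Big\|\frac{1}{C_{\alpha,2j}}\int_\varepsilon^\infty\frac{\overline\Delta_u^{2j}f(\cdot)}{u^{1+\alpha}}\,du-g(\cdot)\Big\|_{L^1(\mathbb{R})}=0,$$ where $\overline\Delta_u^{2j}f(x)=\sum_{k=0}^{2j}(-1)^k\binom{2j}{k}f(x+(j-k)u)$ and $C_{\alpha,2j}=(-1)^j2^{2j-\alpha}\int_0^\infty\frac{\sin^{2j}u}{u^{1+\alpha}}\,du$; then $D_{\rm s}^{\{\alpha\}}f:=g$ (independent of $j$). It is known that $f\in L^1(\mathbb{R})$ has a strong Riesz derivative of order $\alpha$ if and only if $f\in W[|v|^\alpha;L^1(\mathbb{R})]$, and then $\widehat{D_{\rm s}^{\{\alpha\}}f}(v)=|v|^\alpha\widehat f(v)$. Modulus of smoothness of order $r\in\mathbb{N}$: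 for $g\in L^1(\mathbb{R})$ and $\delta>0$, $\omega_r(g;\delta;L^1(\mathbb{R}))=\sup_{|u|\le\delta}\|\Delta_u^r g\|_{L^1(\mathbb{R})}$, where $(\Delta_u^r g)(x)=\sum_{j=0}^r(-1)^{r-j}\binom{r}{j}g(x+ju)$. Let $\mathcal{A}=\{f\in L^1(\mathbb{R})\cap C_b(\mathbb{R}) : f\in \mathrm{BV}(\mathbb{R})\text{ or }\widehat f\in \mathrm{BV}(\mathbb{R})\}$, where $\mathrm{BV}(\mathbb{R})$ is the set of functions of bounded variation over $\mathbb{R}$; functions $f$ as in the claim belong to $\mathcal{A}$. For $f\in\mathcal{A}$, $\sigma>0$ and $h=2\pi/\sigma$, $R_\sigma(f)$ denotes the remainder in the quadrature formula $\int_{-\infty}^\infty f(t)\,dt=h\sum_{k\in\mathbb{Z}}f(hk)+R_\sigma(f)$; by the Poisson summation formula, $R_\sigma(f)=-\sqrt{2\pi}\sum_{k\in\mathbb{Z}\setminus\{0\}}\widehat f(k\sigma)$. *)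

theory Defs
  imports "HOL-Analysis.Analysis"
begin

text \<open>Functions are representatives of their almost-everywhere classes.\<close>

definition L1 :: "(real \<Rightarrow> complex) set" where
  "L1 = {f. integrable lebesgue f}"

text \<open>The Bochner integral of a non-integrable function is 0, so this is the norm only on L1.
  The norm is applied below only to functions that are in L1 whenever \<open>f\<close> and \<open>g\<close> are.\<close>

definition L1_norm :: "(real \<Rightarrow> complex) \<Rightarrow> real" where
  "L1_norm f = (LINT x|lebesgue. norm (f x))"

definition C_b :: "(real \<Rightarrow> complex) set" where
  "C_b = {f. continuous_on UNIV f \<and> bounded (range f)}"

definition fourier :: "(real \<Rightarrow> complex) \<Rightarrow> real \<Rightarrow> complex" where
  "fourier f v =
     complex_of_real (1 / sqrt (2 * pi)) * (LINT u|lebesgue. f u * exp (- \<i> * complex_of_real (u * v)))"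

text \<open>The space \<open>W[|v|\<^sup>\<alpha>; L\<^sup>1(\<real>)]\<close>; note that \<open>0 powr \<alpha> = 0\<close>.\<close>

definition W_space :: "real \<Rightarrow> (real \<Rightarrow> complex) set" where
  "W_space \<alpha> =
     {f \<in> L1. \<exists>g\<in>L1. \<forall>v. complex_of_real (\<bar>v\<bar> powr \<alpha>) * fourier f v = fourier g v}"

definition central_diff :: "nat \<Rightarrow> real \<Rightarrow> (real \<Rightarrow> complex) \<Rightarrow> real \<Rightarrow> complex" where
  "central_diff j u f x =
     (\<Sum>k\<le>2 * j. (-1) ^ k * of_nat ((2 * j) choose k) * f (x + (real j - real k) * u))"

definition riesz_const :: "real \<Rightarrow> nat \<Rightarrow> real" where
  "riesz_const \<alpha> j =
     (-1) ^ j * 2 powr (2 * real j - \<alpha>) *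
     (LINT u:{0<..}|lebesgue. sin u ^ (2 * j) / u powr (1 + \<alpha>))"

text \<open>For \<open>f\<close> in L1 and \<open>\<epsilon> > 0\<close> the integral below exists for almost every \<open>x\<close> and defines a
  function of \<open>x\<close> that is again in L1.\<close>

definition truncated_riesz ::
    "real \<Rightarrow> nat \<Rightarrow> real \<Rightarrow> (real \<Rightarrow> complex) \<Rightarrow> real \<Rightarrow> complex" where
  "truncated_riesz \<alpha> j \<epsilon> f x =
     complex_of_real (1 / riesz_const \<alpha> j) *
     (LINT u:{\<epsilon><..}|lebesgue. central_diff j u f x / complex_of_real (u powr (1 + \<alpha>)))"

text \<open>The limit does not depend on the choice of \<open>j\<close> with \<open>\<alpha> < 2j\<close>.\<close>

definition has_strong_riesz_deriv ::
    "real \<Rightarrow> (real \<Rightarrow> complex) \<Rightarrow> (real \<Rightarrow> complex) \<Rightarrow> bool" where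
  "has_strong_riesz_deriv \<alpha> f g \<longleftrightarrow>
     0 < \<alpha> \<and> f \<in> L1 \<and> g \<in> L1 \<and>
     (\<exists>j::nat. \<alpha> < 2 * real j \<and>
        ((\<lambda>\<epsilon>. L1_norm (\<lambda>x. truncated_riesz \<alpha> j \<epsilon> f x - g x)) \<longlongrightarrow> 0) (at_right 0))"

text \<open>Unique only up to null sets, hence the choice of a representative.\<close>

definition strong_riesz_deriv :: "real \<Rightarrow> (real \<Rightarrow> complex) \<Rightarrow> real \<Rightarrow> complex" where
  "strong_riesz_deriv \<alpha> f = (SOME g. has_strong_riesz_deriv \<alpha> f g)"

definition forward_diff :: "nat \<Rightarrow> real \<Rightarrow> (real \<Rightarrow> complex) \<Rightarrow> real \<Rightarrow> complex" where
  "forward_diff r u g x =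
     (\<Sum>j\<le>r. (-1) ^ (r - j) * of_nat (r choose j) * g (x + real j * u))"

text \<open>For \<open>g\<close> in L1 the supremum is over a set bounded above by \<open>2\<^sup>r\<close> times the norm of \<open>g\<close>.\<close>

definition smoothness_modulus :: "nat \<Rightarrow> (real \<Rightarrow> complex) \<Rightarrow> real \<Rightarrow> real" where
  "smoothness_modulus r g \<delta> = (SUP u\<in>{u. \<bar>u\<bar> \<le> \<delta>}. L1_norm (forward_diff r u g))"

text \<open>The remainder \<open>R\<^sub>\<sigma>(f)\<close> of the quadrature formula with step \<open>h = 2\<pi>/\<sigma>\<close>.\<close>

definition quadrature_remainder :: "real \<Rightarrow> (real \<Rightarrow> complex) \<Rightarrow> complex" where
  "quadrature_remainder \<sigma> f =
     (let h = 2 * pi / \<sigma> in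
        (LINT t|lebesgue. f t) - complex_of_real h * (\<Sum>\<^sub>\<infinity>k::int. f (h * real_of_int k)))"

text \<open>The Riemann zeta function on the real half-line \<open>s > 1\<close>, by its Dirichlet series.\<close>

definition zeta_real :: "real \<Rightarrow> real" where
  "zeta_real s = (\<Sum>n. 1 / real (Suc n) powr s)"

end

theory Submission
  imports Defs "HOL-Probability.Characteristic_Functions"
begin

text \<open>
  By Poisson summation the remainder is minus the sum of \<open>\<surd>(2\<pi>) f\<^sup>\<and>(k\<sigma>)\<close> over \<open>k \<noteq> 0\<close>, and
  \<open>f\<^sup>\<and>(k\<sigma>) = \<bar>k\<sigma>\<bar>\<^sup>-\<^sup>\<alpha> G\<^sup>\<and>(k\<sigma>)\<close> for the strong Riesz derivative \<open>G\<close>. The difference of order \<open>r\<close> and step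
  \<open>u = \<pi> / (k\<sigma>)\<close>, which satisfies \<open>\<bar>u\<bar> \<le> h/2\<close>, multiplies \<open>G\<^sup>\<and>(k\<sigma>)\<close> by \<open>(-2)\<^sup>r\<close>; this is the source
  of the factor \<open>2\<^sup>-\<^sup>r\<close>.

  The truncated Riesz integral acts on the Fourier side as multiplication by \<open>\<bar>v\<bar>\<^sup>\<alpha> m(\<epsilon>v)\<close> with a
  continuous \<open>m\<close>, \<open>m(0) = 1\<close>. Hence every strong Riesz derivative has transform \<open>\<bar>v\<bar>\<^sup>\<alpha> f\<^sup>\<and>(v)\<close>. For
  \<open>2j \<ge> \<alpha> + 2\<close> the transform of \<open>m\<close> is \<open>O(1/(1+y\<^sup>2))\<close>, so the truncated integral is \<open>g\<close> convolved with an
  approximate identity, which gives existence. The same representation at \<open>\<epsilon> = 1\<close>, solved for the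
  central term of the difference, bounds \<open>\<bar>f\<bar>\<close> by an \<open>L\<^sup>1\<close> function convolved with \<open>1/(1+x\<^sup>2)\<close>; so the
  samples \<open>f(hk)\<close> are absolutely summable, and Poisson's formula holds for \<open>f\<close> by Fejer's argument.
\<close>

subsection \<open>Fourier inversion\<close>

text \<open>Two features of the statement shape the proof. The infinite sum in
  \<open>quadrature_remainder\<close> is 0 by convention unless the samples are summable, and a
  function in L1 and \<open>C_b\<close> may have narrow spikes at the lattice points; so summability
  has to be earned from the derivative, and the pointwise majorant serves this purpose. The
  derivative is a \<open>SOME\<close> term: nothing is known of it beyond
  \<open>has_strong_riesz_deriv\<close>, and the \<open>j\<close> hidden there is not under control.
  Hence existence is derived first, from the function supplied by \<open>W_space\<close>, and the
  transform is then computed for an arbitrary admissible \<open>j\<close>. Only this transform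
  enters the estimates, so the choice of representative is harmless. The chosen derivative is merely
  Lebesgue measurable. Integrals of it stay over \<open>lebesgue\<close>; those of the continuous
  \<open>f\<close> are moved to \<open>lborel\<close>, where Fubini is applied.\<close>

lemma borel_measurable_cis [measurable]: "cis \<in> borel_measurable borel"
  by (intro borel_measurable_continuous_onI continuous_intros)

lemma integrable_mult_cis:
  fixes f :: "'a \<Rightarrow> complex"
  assumes "integrable M f" and [measurable]: "\<phi> \<in> borel_measurable M"
  shows "integrable M (\<lambda>u. f u * cis (\<phi> u))"
proof (rule Bochner_Integration.integrable_bound[OF assms(1)])
  show "(\<lambda>u. f u * cis (\<phi> u)) \<in> borel_measurable M"
    using borel_measurable_integrable[OF assms(1)] by measurable
qed (simp add: norm_mult)

text \<open>The exchange of integrals behind the multiplication formula of Fourier analysis: a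
  bounded kernel leaves f(u) g(v) K(u, v) integrable over the plane. It is used with exponentials
  for \<open>K\<close>, so with \<open>B = 1\<close>.\<close>

lemma Fubini_bounded_kernel:
  fixes f g :: "real \<Rightarrow> complex" and K :: "real \<Rightarrow> real \<Rightarrow> complex"
  assumes f: "integrable lborel f" and g: "integrable lborel g"
    and [measurable]: "(\<lambda>(u, v). K u v) \<in> borel_measurable (borel \<Otimes>\<^sub>M borel)"
    and K: "\<And>u v. norm (K u v) \<le> B"
  shows "(LINT u|lborel. f u * (LINT v|lborel. g v * K u v))
       = (LINT v|lborel. g v * (LINT u|lborel. f u * K u v))"
proof -
  have [measurable]: "f \<in> borel_measurable borel" "g \<in> borel_measurable borel"
    using f g by (auto dest: borel_measurable_integrable)
  have B: "0 \<le> B"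
    using order_trans[OF norm_ge_zero K] by blast
  have gK: "integrable lborel (\<lambda>v. g v * K u v)" for u
  proof (rule Bochner_Integration.integrable_bound)
    show "integrable lborel (\<lambda>v. B * norm (g v))"
      using g by simp
    show "(\<lambda>v. g v * K u v) \<in> borel_measurable lborel"
      by measurable
    show "AE v in lborel. norm (g v * K u v) \<le> norm (B * norm (g v))"
      using mult_right_mono[OF K norm_ge_zero] B by (intro AE_I2) (simp add: norm_mult abs_mult mult.commute)
  qed
  have "integrable (lborel \<Otimes>\<^sub>M lborel) (\<lambda>(u, v). f u * (g v * K u v))"
  proof (rule lborel_pair.Fubini_integrable)
    show "(\<lambda>(u, v). f u * (g v * K u v)) \<in> borel_measurable (lborel \<Otimes>\<^sub>M lborel)"
      by measurable
    show "AE x in lborel. integrable lborel (\<lambda>y. case (x, y) of (u, v) \<Rightarrow> f u * (g v * K u v))"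
      using gK by (intro AE_I2) simp
    show "integrable lborel (\<lambda>x. LINT y|lborel. norm (case (x, y) of (u, v) \<Rightarrow> f u * (g v * K u v)))"
    proof (rule Bochner_Integration.integrable_bound)
      show "integrable lborel (\<lambda>u. norm (f u) * (B * (LINT v|lborel. norm (g v))))"
        using f by simp
      show "(\<lambda>x. LINT y|lborel. norm (case (x, y) of (u, v) \<Rightarrow> f u * (g v * K u v))) \<in> borel_measurable lborel"
        by measurable
      have "(LINT v|lborel. norm (g v * K u v)) \<le> (LINT v|lborel. B * norm (g v))" for u
        using integrable_norm[OF gK] g mult_left_mono[OF K norm_ge_zero]
        by (intro integral_mono) (auto simp: norm_mult mult_ac)
      then have "norm (f u) * (LINT v|lborel. norm (g v * K u v)) \<le> norm (f u) * (B * (LINT v|lborel. norm (g v)))" for u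
        by (intro mult_left_mono) auto
      then show "AE u in lborel. norm (LINT y|lborel. norm (case (u, y) of (u, v) \<Rightarrow> f u * (g v * K u v)))
           \<le> norm (norm (f u) * (B * (LINT v|lborel. norm (g v))))"
        using B by (intro AE_I2) (simp add: norm_mult[of "f _"] abs_mult)
    qed
  qed
  from lborel_pair.Fubini_integral[OF this, symmetric]
  have "(LINT u|lborel. LINT v|lborel. f u * (g v * K u v)) = (LINT v|lborel. LINT u|lborel. f u * (g v * K u v))" .
  also have "\<dots> = (LINT v|lborel. LINT u|lborel. g v * (f u * K u v))"
    by (simp add: mult.left_commute)
  finally show ?thesis
    by simp
qed

text \<open>\<open>ft\<close> is \<open>\<surd>(2\<pi>)\<close> times \<open>fourier\<close>.\<close>

definition ft :: "(real \<Rightarrow> complex) \<Rightarrow> real \<Rightarrow> complex" where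
  "ft f v = (LINT u|lborel. f u * cis (- (u * v)))"

lemma borel_measurable_ft [measurable]:
  assumes [measurable]: "f \<in> borel_measurable borel"
  shows "ft f \<in> borel_measurable borel"
  unfolding ft_def by measurable

lemma norm_ft_le: "norm (ft f v) \<le> (LINT u|lborel. norm (f u))"
  unfolding ft_def by (rule order_trans[OF integral_norm_bound]) (simp add: norm_mult)

lemma continuous_on_ft:
  assumes f: "integrable lborel f"
  shows "continuous_on A (ft f)"
proof -
  have [measurable]: "f \<in> borel_measurable borel"
    using f by (auto dest: borel_measurable_integrable)
  have "isCont (ft f) v" for v
    unfolding continuous_at_sequentially comp_def
  proof (intro allI impI)
    fix X assume X: "X \<longlonglongrightarrow> v"
    show "(\<lambda>n. ft f (X n)) \<longlonglongrightarrow> ft f v"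
      unfolding ft_def
    proof (rule integral_dominated_convergence[where w = "\<lambda>u. norm (f u)"])
      show "AE u in lborel. (\<lambda>n. f u * cis (- (u * X n))) \<longlonglongrightarrow> f u * cis (- (u * v))"
        using X by (intro AE_I2 tendsto_intros)
    qed (use f in \<open>auto simp: norm_mult\<close>)
  qed
  then show ?thesis
    by (simp add: continuous_at_imp_continuous_on)
qed

lemma integral_std_normal_cis:
  "(LINT x|lborel. of_real (std_normal_density x) * cis (x * t)) = of_real (exp (- t\<^sup>2 / 2))"
proof -
  have "of_real (exp (- t\<^sup>2 / 2)) = char std_normal_distribution t"
    by (simp add: char_std_normal_distribution)
  also have "\<dots> = (LINT x|lborel. std_normal_density x *\<^sub>R cis (t * x))"
    unfolding char_def
    by (subst integral_density) (auto simp: normal_density_nonneg cis_conv_exp intro!: borel_measurable_continuous_onI continuous_intros)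
  finally show ?thesis
    by (simp add: scaleR_conv_of_real mult.commute)
qed

lemma exp_eq_std_normal_density: "exp (- x\<^sup>2 / 2) = sqrt (2 * pi) * std_normal_density x"
  by (simp add: std_normal_density_def)

text \<open>Gaussian summation: a factor exp(-(s v)^2 / 2) makes Fubini applicable, and as s tends
  to 0 the left side is recovered by dominated convergence, since \<open>ft f\<close> is integrable.
  The other side is a Gaussian average of \<open>f\<close> around \<open>x\<close>, which tends to
  f(x) at every point because \<open>f\<close> is continuous and bounded.\<close>

lemma ft_inversion:
  fixes f :: "real \<Rightarrow> complex"
  assumes f: "integrable lborel f" and cont: "continuous_on UNIV f" and bdd: "\<And>x. norm (f x) \<le> B"
    and ff: "integrable lborel (ft f)"
  shows "(LINT v|lborel. ft f v * cis (v * x)) = of_real (2 * pi) * f x"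
proof (rule LIMSEQ_unique)
  let ?\<rho> = std_normal_density
  define s where "s n = 1 / real (Suc n)" for n
  have s0: "s n > 0" for n by (simp add: s_def)
  have slim: "s \<longlonglongrightarrow> 0"
    unfolding s_def by (rule LIMSEQ_Suc) (rule lim_1_over_n)
  have [measurable]: "f \<in> borel_measurable borel"
    using f by (auto dest: borel_measurable_integrable)
  define I where "I n = (LINT v|lborel. (ft f v * cis (v * x)) * of_real (exp (- (s n * v)\<^sup>2 / 2)))" for n
  show "I \<longlonglongrightarrow> (LINT v|lborel. ft f v * cis (v * x))"
    unfolding I_def
  proof (rule integral_dominated_convergence[where w = "\<lambda>v. norm (ft f v)"])
    show "AE v in lborel. (\<lambda>n. ft f v * cis (v * x) * of_real (exp (- (s n * v)\<^sup>2 / 2)))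
      \<longlonglongrightarrow> ft f v * cis (v * x)"
    proof (rule AE_I2)
      fix v
      have "(\<lambda>n. ft f v * cis (v * x) * of_real (exp (- (s n * v)\<^sup>2 / 2)))
      \<longlonglongrightarrow> ft f v * cis (v * x) * of_real (exp (- (0 * v)\<^sup>2 / 2))"
        by (intro tendsto_intros slim) auto
      then show "(\<lambda>n. ft f v * cis (v * x) * of_real (exp (- (s n * v)\<^sup>2 / 2)))
      \<longlonglongrightarrow> ft f v * cis (v * x)" by simp
    qed
  qed (use ff in \<open>auto simp: norm_mult intro!: mult_left_le\<close>)
  \<comment> \<open>The Gaussian is its own transform up to scaling: the inner integral is a
    Gaussian of width \<open>s n\<close> centred at \<open>x\<close>, and u = x + s n t standardises
    it.\<close>
  have I_eq: "I n = of_real (2 * pi) * (LINT t|lborel. f (x + s n * t) * of_real (?\<rho> t))" for n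
  proof -
    let ?g = "\<lambda>v. of_real (exp (- (s n * v)\<^sup>2 / 2)) * cis (v * x)"
    have g: "integrable lborel (\<lambda>v. of_real (exp (- (s n * v)\<^sup>2 / 2)) :: complex)"
    proof -
      have "integrable lborel (\<lambda>v. sqrt (2 * pi) * ?\<rho> (0 + s n * v))"
        using s0[of n] by (intro integrable_mult_right lborel_integrable_real_affine) auto
      then show ?thesis
        unfolding exp_eq_std_normal_density by simp
    qed
    then have g': "integrable lborel ?g"
      by (intro integrable_mult_cis) auto
    have "I n = (LINT v|lborel. ?g v * (LINT u|lborel. f u * cis (- (u * v))))"
      unfolding I_def ft_def by (simp add: mult_ac)
    also have "\<dots> = (LINT u|lborel. f u * (LINT v|lborel. ?g v * cis (- (u * v))))"
      by (rule Fubini_bounded_kernel[OF f g', symmetric, where B = 1]) auto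
    also have "\<dots> = (LINT u|lborel. f u * (of_real (2 * pi / s n * ?\<rho> ((x - u) / s n))))"
    proof (rule Bochner_Integration.integral_cong)
      fix u
      have "(LINT v|lborel. ?g v * cis (- (u * v)))
         = (LINT v|lborel. of_real (exp (- (s n * v)\<^sup>2 / 2)) * cis (v * (x - u)))"
        by (rule Bochner_Integration.integral_cong) (simp_all add: mult.assoc cis_mult, simp add: algebra_simps)
      also have "\<dots> = \<bar>1 / s n\<bar> *\<^sub>R (LINT v|lborel. of_real (exp (- (s n * (0 + 1 / s n * v))\<^sup>2 / 2)) * cis ((0 + 1 / s n * v) * (x - u)))"
        using s0[of n] by (intro lborel_integral_real_affine) auto
      also have "\<dots> = of_real (1 / s n) * (LINT v|lborel. of_real (sqrt (2 * pi)) * (of_real (?\<rho> v) * cis (v * ((x - u) / s n))))"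
        unfolding exp_eq_std_normal_density using s0[of n] by (simp add: scaleR_conv_of_real mult.assoc)
      also have "\<dots> = of_real (1 / s n * sqrt (2 * pi) * exp (- ((x - u) / s n)\<^sup>2 / 2))"
        by (simp only: integral_mult_right_zero integral_std_normal_cis of_real_mult mult.assoc)
      also have "\<dots> = of_real (2 * pi / s n * ?\<rho> ((x - u) / s n))"
        unfolding exp_eq_std_normal_density
        by (simp add: mult.assoc[symmetric] del: of_real_mult)
      finally show "f u * (LINT v|lborel. ?g v * cis (- (u * v))) = f u * of_real (2 * pi / s n * ?\<rho> ((x - u) / s n))"
        by simp
    qed simp
    also have "\<dots> = \<bar>s n\<bar> *\<^sub>R (LINT t|lborel. f (x + s n * t) * (of_real (2 * pi / s n * ?\<rho> ((x - (x + s n * t)) / s n))))"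
      using s0[of n] by (intro lborel_integral_real_affine) auto
    also have "\<dots> = of_real (s n) * (LINT t|lborel. of_real (2 * pi / s n) * (f (x + s n * t) * of_real (?\<rho> t)))"
      using s0[of n] by (simp add: scaleR_conv_of_real normal_density_def mult_ac)
    also have "\<dots> = of_real (2 * pi) * (LINT t|lborel. f (x + s n * t) * of_real (?\<rho> t))"
      using s0[of n] by (subst integral_mult_right_zero) (simp add: mult.assoc[symmetric] del: of_real_mult of_real_divide, simp)
    finally show ?thesis .
  qed
  have "(\<lambda>n. LINT t|lborel. f (x + s n * t) * of_real (?\<rho> t)) \<longlonglongrightarrow> (LINT t|lborel. f x * of_real (?\<rho> t))"
  proof (rule integral_dominated_convergence[where w = "\<lambda>t. B * ?\<rho> t"])
    show "AE t in lborel. (\<lambda>n. f (x + s n * t) * of_real (?\<rho> t)) \<longlonglongrightarrow> f x * of_real (?\<rho> t)"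
    proof (rule AE_I2)
      fix t
      have "(\<lambda>n. x + s n * t) \<longlonglongrightarrow> x + 0 * t"
        by (intro tendsto_intros slim)
      moreover have "isCont f x"
        using cont by (simp add: continuous_on_eq_continuous_at)
      ultimately have "(\<lambda>n. f (x + s n * t)) \<longlonglongrightarrow> f x"
        using isCont_tendsto_compose by fastforce
      then show "(\<lambda>n. f (x + s n * t) * of_real (?\<rho> t)) \<longlonglongrightarrow> f x * of_real (?\<rho> t)"
        by (intro tendsto_intros)
    qed
    show "AE t in lborel. norm (f (x + s n * t) * of_real (?\<rho> t)) \<le> B * ?\<rho> t" for n
      using bdd by (intro AE_I2) (simp add: norm_mult mult_right_mono)
  qed auto
  also have "(LINT t|lborel. f x * of_real (?\<rho> t)) = f x"
    by (simp)
  finally show "I \<longlonglongrightarrow> of_real (2 * pi) * f x"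
    unfolding I_eq by (intro tendsto_intros)
qed

subsection \<open>Continuity of translation in the mean\<close>

lemma integrable_translate:
  fixes f :: "real \<Rightarrow> 'a :: {banach, second_countable_topology}"
  assumes "integrable lborel f"
  shows "integrable lborel (\<lambda>x. f (x - s))"
  using lborel_integrable_real_affine[OF assms, of 1 "-s"] by simp

lemma integral_translate:
  fixes f :: "real \<Rightarrow> 'a :: {banach, second_countable_topology}"
  shows "(LINT x|lborel. f (x - s)) = (LINT x|lborel. f x)"
  using lborel_integral_real_affine[of 1 f "-s"] by simp

text \<open>A three-epsilon argument: translation preserves the norm, so continuity of translation
  passes to L1 limits. Both the step from open to measurable sets and the limit case of the later
  induction use it.\<close>

lemma tendsto_L1_translate_approx:
  fixes f :: "real \<Rightarrow> complex"
  assumes f: "integrable lborel f"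
    and approx: "\<And>e. e > 0 \<Longrightarrow> \<exists>g. integrable lborel g \<and> (LINT x|lborel. norm (g x - f x)) < e \<and>
                   ((\<lambda>s. LINT x|lborel. norm (g (x - s) - g x)) \<longlongrightarrow> 0) (at 0)"
  shows "((\<lambda>s. LINT x|lborel. norm (f (x - s) - f x)) \<longlongrightarrow> 0) (at 0)"
proof (rule tendstoI)
  fix e :: real assume e: "e > 0"
  then obtain g where g: "integrable lborel g" and n: "(LINT x|lborel. norm (g x - f x)) < e / 3"
    and lim: "((\<lambda>s. LINT x|lborel. norm (g (x - s) - g x)) \<longlongrightarrow> 0) (at 0)"
    using approx[of "e / 3"] by auto
  have "\<forall>\<^sub>F s in at 0. (LINT x|lborel. norm (g (x - s) - g x)) < e / 3"
    using order_tendstoD(2)[OF lim, of "e / 3"] e by auto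
  then show "\<forall>\<^sub>F s in at 0. dist (LINT x|lborel. norm (f (x - s) - f x)) 0 < e"
  proof eventually_elim
    case (elim s)
    note i = integrable_translate[OF f, of s] integrable_translate[OF g, of s] f g
    have "(LINT x|lborel. norm (f (x - s) - f x)) \<le>
      (LINT x|lborel. norm (g (x - s) - f (x - s)) + norm (g (x - s) - g x) + norm (g x - f x))"
    proof (rule integral_mono)
      fix x
      have "norm (f (x - s) - f x) = norm (- (g (x - s) - f (x - s)) + (g (x - s) - g x) + (g x - f x))"
        by simp
      also have "\<dots> \<le> norm (- (g (x - s) - f (x - s))) + norm (g (x - s) - g x) + norm (g x - f x)"
        by (intro norm_triangle_mono order_refl)
      finally show "norm (f (x - s) - f x) \<le> norm (g (x - s) - f (x - s)) + norm (g (x - s) - g x) + norm (g x - f x)"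
        by (simp only: norm_minus_cancel)
    qed (use i in auto)
    also have "\<dots> = (LINT x|lborel. norm (g (x - s) - f (x - s))) + (LINT x|lborel. norm (g (x - s) - g x)) + (LINT x|lborel. norm (g x - f x))"
      using i by simp
    also have "(LINT x|lborel. norm (g (x - s) - f (x - s))) = (LINT x|lborel. norm (g x - f x))"
      by (rule integral_translate)
    finally show ?case
      using n elim by simp
  qed
qed

text \<open>For indicators |a - b| = a + b - 2ab, so the norm is controlled by the overlap of
  \<open>U\<close> with its translate. Openness makes the overlap indicator converge at every point:
  a point of \<open>U\<close> stays in \<open>U\<close> under small shifts.\<close>

lemma tendsto_L1_translate_indicator_open:
  fixes U :: "real set" and c :: complex
  assumes U: "open U" and fin: "emeasure lborel U < \<infinity>"
  shows "((\<lambda>s. LINT x|lborel. norm (indicator U (x - s) *\<^sub>R c - indicator U x *\<^sub>R c)) \<longlongrightarrow> 0) (at 0)"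
proof -
  have [measurable]: "U \<in> sets borel" using U by auto
  have i: "integrable lborel (indicat_real U)"
    using fin by (intro integrable_real_indicator) auto
  have i2: "integrable lborel (\<lambda>x. indicat_real U (x - s) * indicat_real U x)" for s
    by (rule Bochner_Integration.integrable_bound[OF i]) (auto simp: indicator_def)
  have eq: "(LINT x|lborel. norm (indicator U (x - s) *\<^sub>R c - indicator U x *\<^sub>R c))
     = 2 * norm c * ((LINT x|lborel. indicat_real U x) - (LINT x|lborel. indicat_real U (x - s) * indicat_real U x))" for s
  proof -
    have "(LINT x|lborel. norm (indicator U (x - s) *\<^sub>R c - indicator U x *\<^sub>R c))
       = (LINT x|lborel. norm c * (indicat_real U (x - s) + indicat_real U x - 2 * (indicat_real U (x - s) * indicat_real U x)))"
      by (intro Bochner_Integration.integral_cong) (auto simp: indicator_def)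
    also have "\<dots> = norm c * ((LINT x|lborel. indicat_real U (x - s)) + (LINT x|lborel. indicat_real U x)
        - 2 * (LINT x|lborel. indicat_real U (x - s) * indicat_real U x))"
      using i i2[of s] integrable_translate[OF i, of s] by simp
    finally show ?thesis
      unfolding integral_translate[of "indicat_real U"] by (simp only: algebra_simps)
  qed
  have "((\<lambda>s. LINT x|lborel. indicat_real U (x - s) * indicat_real U x) \<longlongrightarrow> (LINT x|lborel. indicat_real U x)) (at 0)"
    unfolding tendsto_at_iff_sequentially comp_def
  proof (intro allI impI)
    fix X :: "nat \<Rightarrow> real" assume X: "X \<longlonglongrightarrow> 0"
    show "(\<lambda>n. LINT x|lborel. indicat_real U (x - X n) * indicat_real U x) \<longlonglongrightarrow> (LINT x|lborel. indicat_real U x)"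
    proof (rule integral_dominated_convergence[OF _ _ i])
      show "AE x in lborel. (\<lambda>n. indicat_real U (x - X n) * indicat_real U x) \<longlonglongrightarrow> indicat_real U x"
      proof (rule AE_I2)
        fix x
        show "(\<lambda>n. indicat_real U (x - X n) * indicat_real U x) \<longlonglongrightarrow> indicat_real U x"
        proof (cases "x \<in> U")
          case True
          have "(\<lambda>n. x - X n) \<longlonglongrightarrow> x - 0"
            by (intro tendsto_intros X)
          then have "\<forall>\<^sub>F n in sequentially. x - X n \<in> U"
            using U True topological_tendstoD by fastforce
          then show ?thesis
            by (intro tendsto_eventually) (auto elim!: eventually_mono simp: True)
        qed simp
      qed
    qed (auto simp: indicator_def)
  qed
  then have "((\<lambda>s. 2 * norm c * ((LINT x|lborel. indicat_real U x) - (LINT x|lborel. indicat_real U (x - s) * indicat_real U x)))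
      \<longlongrightarrow> 2 * norm c * ((LINT x|lborel. indicat_real U x) - (LINT x|lborel. indicat_real U x))) (at 0)"
    by (intro tendsto_intros)
  then show ?thesis
    unfolding eq by simp
qed

text \<open>Induction over integrable functions. An indicator is approximated in L1 by that of an
  open set through outer regularity, as pointwise convergence of the shifts can fail for a general
  set.\<close>

lemma tendsto_L1_translate:
  fixes g :: "real \<Rightarrow> complex"
  assumes "integrable lborel g"
  shows "((\<lambda>s. LINT x|lborel. norm (g (x - s) - g x)) \<longlongrightarrow> 0) (at 0)"
  using assms
proof (induction rule: integrable_induct)
  case (base A c)
  show ?case
  proof (rule tendsto_L1_translate_approx)
    show "integrable lborel (\<lambda>x. indicat_real A x *\<^sub>R c)"
      using base by (intro integrable_scaleR_left integrable_real_indicator) auto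
    fix e :: real assume e: "e > 0"
    \<comment> \<open>\<open>norm c + 1\<close> rather than \<open>norm c\<close> in the denominator
      covers \<open>c = 0\<close>.\<close>
    obtain U where U: "open U" "A \<subseteq> U" "emeasure lborel (U - A) < ennreal (e / (norm c + 1))"
      using outer_regular_lborel[of A "e / (norm c + 1)"] base e by (auto simp: add_nonneg_pos)
    have [measurable]: "A \<in> sets borel" "U \<in> sets borel" using U base by auto
    have UA: "measure lborel (U - A) < e / (norm c + 1)"
      using U(3) e by (simp add: measure_def) (metis enn2real_less_iff add_nonneg_pos divide_pos_pos ennreal_less_top less_trans norm_ge_zero zero_less_one)
    have "emeasure lborel U = emeasure lborel A + emeasure lborel (U - A)"
      using U(2) by (subst plus_emeasure) (auto intro: arg_cong[where f = "emeasure lborel"])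
    then have fin: "emeasure lborel U < \<infinity>"
      using base(2) U(3) by (metis ennreal_less_top infinity_ennreal_def less_trans ennreal_add_less_top)
    show "\<exists>g. integrable lborel g \<and> (LINT x|lborel. norm (g x - indicator A x *\<^sub>R c)) < e \<and>
                   ((\<lambda>s. LINT x|lborel. norm (g (x - s) - g x)) \<longlongrightarrow> 0) (at 0)"
    proof (rule exI[where x = "\<lambda>x. indicator U x *\<^sub>R c"], intro conjI)
      show "((\<lambda>s. LINT x|lborel. norm (indicator U (x - s) *\<^sub>R c - indicator U x *\<^sub>R c)) \<longlongrightarrow> 0) (at 0)"
        by (rule tendsto_L1_translate_indicator_open[OF U(1) fin])
      show "integrable lborel (\<lambda>x. indicat_real U x *\<^sub>R c)"
        using fin by (intro integrable_scaleR_left integrable_real_indicator) auto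
      have "(LINT x|lborel. norm (indicator U x *\<^sub>R c - indicator A x *\<^sub>R c)) = (LINT x|lborel. indicat_real (U - A) x * norm c)"
        using U(2) by (intro Bochner_Integration.integral_cong) (auto simp: indicator_def)
      also have "\<dots> = measure lborel (U - A) * norm c"
        by simp
      also have "\<dots> \<le> measure lborel (U - A) * (norm c + 1)"
        by (intro mult_left_mono) auto
      also have "\<dots> < e"
        using UA by (simp add: pos_less_divide_eq add_nonneg_pos)
      finally show "(LINT x|lborel. norm (indicator U x *\<^sub>R c - indicator A x *\<^sub>R c)) < e" .
    qed
  qed
next
  case (add f g)
  note fs = integrable_translate[OF add(1)] integrable_translate[OF add(2)] add(1,2)
  have lim: "((\<lambda>s. (LINT x|lborel. norm (f (x - s) - f x)) + (LINT x|lborel. norm (g (x - s) - g x))) \<longlongrightarrow> 0) (at 0)"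
    using add(3,4) by (rule tendsto_add_zero)
  have "(LINT x|lborel. norm (f (x - s) + g (x - s) - (f x + g x))) \<le>
       (LINT x|lborel. norm (f (x - s) - f x)) + (LINT x|lborel. norm (g (x - s) - g x))" for s
  proof -
    have "(LINT x|lborel. norm (f (x - s) + g (x - s) - (f x + g x))) \<le> (LINT x|lborel. norm (f (x - s) - f x) + norm (g (x - s) - g x))"
      using fs by (intro integral_mono) (auto simp: norm_diff_triangle_ineq)
    also have "\<dots> = (LINT x|lborel. norm (f (x - s) - f x)) + (LINT x|lborel. norm (g (x - s) - g x))"
      using fs by (intro Bochner_Integration.integral_add) auto
    finally show ?thesis .
  qed
  then show ?case
    by (intro Lim_null_comparison[OF _ lim] always_eventually allI) simp
next
  case (lim f S)
  have "(\<lambda>n. LINT x|lborel. norm (S n x - f x)) \<longlonglongrightarrow> (LINT x|(lborel::real measure). (0::real))"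
  proof (rule integral_dominated_convergence[where w = "\<lambda>x. 3 * norm (f x)"])
    show "AE x in lborel. (\<lambda>n. norm (S n x - f x)) \<longlonglongrightarrow> 0"
      using lim(2) by (intro AE_I2 tendsto_norm_zero LIM_zero) auto
    show "AE x in lborel. norm (norm (S n x - f x)) \<le> 3 * norm (f x)" for n
    proof (rule AE_I2)
      fix x show "norm (norm (S n x - f x)) \<le> 3 * norm (f x)"
        using lim(3)[of x n] norm_triangle_ineq4[of "S n x" "f x"] by simp
    qed
  qed (use lim in auto)
  then have S: "(\<lambda>n. LINT x|lborel. norm (S n x - f x)) \<longlonglongrightarrow> 0" by simp
  show ?case
  proof (rule tendsto_L1_translate_approx[OF lim(4)])
    fix e :: real assume e: "e > 0"
    obtain n where "(LINT x|lborel. norm (S n x - f x)) < e"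
      using order_tendstoD(2)[OF S, of e] e by (auto simp: eventually_sequentially)
    then show "\<exists>g. integrable lborel g \<and> (LINT x|lborel. norm (g x - f x)) < e \<and>
                   ((\<lambda>s. LINT x|lborel. norm (g (x - s) - g x)) \<longlongrightarrow> 0) (at 0)"
      using lim(1,5) by blast
  qed
qed

subsection \<open>Poisson summation\<close>

text \<open>Half-open, so that the translates by multiples of 2 pi partition the line; the measure
  is not normalised and has mass 2 pi.\<close>

abbreviation circ :: "real measure" where
  "circ \<equiv> restrict_space lborel {-pi..<pi}"

lemma space_circ: "space circ = {-pi..<pi}"
  by (simp add: space_restrict_space)

lemma finite_measure_circ: "finite_measure circ"
  by (intro finite_measure_restrict_space finite_measureI) (auto simp: emeasure_restrict_space space_restrict_space intro!: finite_measureI)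

lemma integral_circ:
  fixes f :: "real \<Rightarrow> 'a :: {banach, second_countable_topology}"
  shows "integral\<^sup>L circ f = (LINT t|lborel. indicator {-pi..<pi} t *\<^sub>R f t)"
  by (simp add: integral_restrict_space)

lemma integrable_circ_bounded:
  fixes f :: "real \<Rightarrow> 'a :: {banach, second_countable_topology}"
  assumes "f \<in> borel_measurable borel" "\<And>t. - pi \<le> t \<Longrightarrow> t < pi \<Longrightarrow> norm (f t) \<le> B"
  shows "integrable circ f"
proof -
  interpret finite_measure circ by (rule finite_measure_circ)
  show ?thesis
    using assms by (intro integrable_const_bound[of _ B] measurable_restrict_space1) (auto simp: space_circ)
qed

lemma integral_circ_const: "(LINT t|circ. c) = 2 * pi * (c :: real)"
  by (simp add: measure_restrict_space space_restrict_space)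

lemma integral_circ_cis: "(LINT t|circ. cis (of_int k * t)) = (if k = 0 then of_real (2 * pi) else 0)"
proof -
  have "(LINT t|circ. cis (of_int k * t)) = (LINT t|lborel. indicator {-pi..pi} t *\<^sub>R cis (of_int k * t))"
    unfolding integral_circ
  proof (rule integral_cong_AE)
    show "AE t in lborel. indicat_real {- pi..<pi} t *\<^sub>R cis (real_of_int k * t) = indicat_real {- pi..pi} t *\<^sub>R cis (real_of_int k * t)"
      using AE_lborel_singleton[of pi] by eventually_elim (auto simp: indicator_def)
  qed auto
  also have "\<dots> = (if k = 0 then of_real (2 * pi) else 0)"
  proof (cases "k = 0")
    case False
    have "(LINT t|lborel. indicator {-pi..pi} t *\<^sub>R cis (of_int k * t))
       = cis (of_int k * pi) / (\<i> * of_int k) - cis (of_int k * (- pi)) / (\<i> * of_int k)"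
    proof (rule integral_FTC_atLeastAtMost)
      fix x :: real
      show "((\<lambda>t. cis (of_int k * t) / (\<i> * of_int k)) has_vector_derivative cis (of_int k * x)) (at x within {- pi..pi})"
        unfolding has_vector_derivative_def using False
        by (auto intro!: derivative_eq_intros simp: field_simps scaleR_conv_of_real)
    qed (auto intro!: continuous_intros)
    also have "cis (of_int k * (- pi)) = cis (of_int k * pi)"
      by (simp add: cis.code sin_zero_iff_int2)
    finally show ?thesis using False by simp
  qed (simp add: scaleR_conv_of_real)
  finally show ?thesis .
qed

text \<open>Geometric series, with the real part of 1 - cis t bounding the denominator from below.
  The bound does not depend on \<open>N\<close>: away from 0 the kernel of Fejer's argument stays
  bounded while its mass grows with \<open>N\<close>.\<close>

lemma norm_sum_cis_le:
  assumes "cos t < 1"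
  shows "norm (\<Sum>j<N. cis (real j * t)) \<le> 2 / (1 - cos t)"
proof -
  have ne: "cis t \<noteq> 1"
    using assms by (metis Re_complex_of_real cis.sel(1) of_real_1 less_irrefl)
  have "(\<Sum>j<N. cis (real j * t)) = (\<Sum>j<N. cis t ^ j)"
    by (simp add: Complex.DeMoivre)
  also have "\<dots> = (1 - cis t ^ N) / (1 - cis t)"
    using ne by (simp add: geometric_sum field_simps)
  finally have "norm (\<Sum>j<N. cis (real j * t)) = norm (1 - cis t ^ N) / norm (1 - cis t)"
    by (simp add: norm_divide)
  moreover have "norm (1 - cis t ^ N) \<le> 2"
    using norm_triangle_ineq4[of 1 "cis t ^ N"] by (simp add: norm_power)
  moreover have "1 - cos t \<le> norm (1 - cis t)"
    using complex_Re_le_cmod[of "1 - cis t"] by simp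
  ultimately show ?thesis
    using assms by (simp add: frac_le)
qed

text \<open>Testing against the Fejer kernel \<open>\<bar>\<Sum>j<N. cis (j t)\<bar>\<^sup>2 / N\<close>.\<close>

lemma zero_Fourier_coefficients_imp_zero:
  fixes D :: "real \<Rightarrow> complex"
  assumes [measurable]: "D \<in> borel_measurable borel"
    and bdd: "\<And>t. - pi \<le> t \<Longrightarrow> t < pi \<Longrightarrow> norm (D t) \<le> B"
    and cont: "isCont D 0"
    and zero: "\<And>k :: int. (LINT t|circ. D t * cis (of_int k * t)) = 0"
  shows "D 0 = 0"
proof -
  define S where "S N t = (\<Sum>j<N. cis (real j * t))" for N :: nat and t :: real
  have [measurable]: "S N \<in> borel_measurable borel" for N
    unfolding S_def by measurable
  have S_le: "norm (S N t) \<le> real N" for N t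
    unfolding S_def by (rule order_trans[OF norm_sum]) simp
  have S2_le: "(norm (S N t))\<^sup>2 \<le> (real N)\<^sup>2" for N t
    by (intro power_mono S_le) auto
  have S2: "of_real ((norm (S N t))\<^sup>2) = (\<Sum>i<N. \<Sum>j<N. cis (of_int (int i - int j) * t))" for N t
  proof -
    have "of_real ((norm (S N t))\<^sup>2) = S N t * cnj (S N t)"
      by (simp add: complex_norm_square del: of_real_power)
    also have "\<dots> = (\<Sum>i<N. \<Sum>j<N. cis (of_int (int i - int j) * t))"
      unfolding S_def cnj_sum sum_product by (simp add: cis_cnj cis_mult algebra_simps)
    finally show ?thesis .
  qed
  have Di: "integrable circ (\<lambda>t. D t * cis (of_int k * t))" for k
    using bdd by (intro integrable_circ_bounded[where B = B]) (auto simp: norm_mult)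
  have ci: "integrable circ (\<lambda>t. cis (of_int k * t))" for k
    by (intro integrable_circ_bounded[where B = 1]) auto
  have Fi: "integrable circ (\<lambda>t. (norm (S N t))\<^sup>2)" for N
    using S2_le by (intro integrable_circ_bounded[where B = "(real N)\<^sup>2"]) auto
  have DF: "(LINT t|circ. D t * of_real ((norm (S N t))\<^sup>2)) = 0" for N
    unfolding S2 sum_distrib_left using Di zero by (simp del: of_int_diff)
  have F: "(LINT t|circ. (norm (S N t))\<^sup>2) = 2 * pi * real N" for N
  proof -
    have "(LINT t|circ. complex_of_real ((norm (S N t))\<^sup>2)) = (\<Sum>i<N. \<Sum>j<N. if i = j then of_real (2 * pi) else 0)"
      unfolding S2 using ci by (simp add: integral_circ_cis del: of_int_diff)
    also have "\<dots> = of_real (2 * pi * real N)"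
      by (simp add: sum.delta)
    finally show ?thesis
      unfolding integral_complex_of_real of_real_eq_iff .
  qed
  have B: "0 \<le> B"
    using order_trans[OF norm_ge_zero bdd[of 0]] by simp
  have "norm (D 0) \<le> e" if e: "e > 0" for e
  proof -
    obtain d0 where d0: "d0 > 0" "\<And>t. \<bar>t\<bar> < d0 \<Longrightarrow> norm (D t - D 0) < e"
      using cont e unfolding continuous_at_eps_delta by (auto simp: dist_norm)
    define d where "d = min d0 1"
    have d: "0 < d" "d \<le> pi" "\<And>t. \<bar>t\<bar> < d \<Longrightarrow> norm (D t - D 0) < e"
      using d0 pi_gt3 by (auto simp: d_def)
    have cosd: "cos d < 1"
      using cos_monotone_0_pi[of 0 d] d(1,2) by simp
    define C where "C = (B + norm (D 0)) * (2 / (1 - cos d))\<^sup>2"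
    have C: "0 \<le> C"
      unfolding C_def by (intro mult_nonneg_nonneg add_nonneg_nonneg B norm_ge_zero zero_le_power2)
    have pt: "norm (D t - D 0) * (norm (S N t))\<^sup>2 \<le> e * (norm (S N t))\<^sup>2 + C" if t: "- pi \<le> t" "t < pi" for t N
    proof (cases "\<bar>t\<bar> < d")
      case True
      then have "norm (D t - D 0) * (norm (S N t))\<^sup>2 \<le> e * (norm (S N t))\<^sup>2"
        using d(3) by (intro mult_right_mono) (auto intro: less_imp_le)
      then show ?thesis
        using C by linarith
    next
      case False
      have "cos \<bar>t\<bar> \<le> cos d"
        using False d t by (intro cos_monotone_0_pi_le) auto
      then have ct: "cos t \<le> cos d" by simp
      have "norm (S N t) \<le> 2 / (1 - cos t)"
        unfolding S_def by (rule norm_sum_cis_le) (use ct cosd in simp)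
      also have "\<dots> \<le> 2 / (1 - cos d)"
        using ct cosd by (intro divide_left_mono) auto
      finally have "(norm (S N t))\<^sup>2 \<le> (2 / (1 - cos d))\<^sup>2"
        by (intro power_mono) auto
      moreover have "norm (D t - D 0) \<le> B + norm (D 0)"
        using norm_triangle_ineq4[of "D t" "D 0"] bdd[OF t] by simp
      ultimately have "norm (D t - D 0) * (norm (S N t))\<^sup>2 \<le> C"
        unfolding C_def using B by (intro mult_mono) auto
      then show ?thesis
        using e by (simp add: add_increasing)
    qed
    have main: "2 * pi * real N * norm (D 0) \<le> e * (2 * pi * real N) + 2 * pi * C" for N
    proof -
      have i1: "integrable circ (\<lambda>t. D t * of_real ((norm (S N t))\<^sup>2))"
        unfolding S2 sum_distrib_left using Di by (auto simp del: of_int_diff)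
      have i2: "integrable circ (\<lambda>t. D 0 * of_real ((norm (S N t))\<^sup>2))"
        using Fi by (intro integrable_mult_right integrable_of_real)
      \<comment> \<open>\<open>(norm (S N t))\<^sup>2\<close> is a trigonometric polynomial, so
        \<open>D\<close> integrates to 0 against it and only the constant D(0) contributes, times
        the mass 2 pi N.\<close>
      have eq: "(LINT t|circ. (D t - D 0) * of_real ((norm (S N t))\<^sup>2)) = - of_real (2 * pi * real N) * D 0"
      proof -
        have "(LINT t|circ. (D t - D 0) * of_real ((norm (S N t))\<^sup>2))
          = (LINT t|circ. D t * of_real ((norm (S N t))\<^sup>2) - D 0 * of_real ((norm (S N t))\<^sup>2))"
          by (simp only: left_diff_distrib)
        also have "\<dots> = 0 - D 0 * of_real (LINT t|circ. (norm (S N t))\<^sup>2)"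
          using i1 i2 by (simp only: Bochner_Integration.integral_diff DF integral_mult_right_zero integral_complex_of_real)
        finally show ?thesis unfolding F by simp
      qed
      have "2 * pi * real N * norm (D 0) = norm (LINT t|circ. (D t - D 0) * of_real ((norm (S N t))\<^sup>2))"
        unfolding eq by (simp add: norm_mult)
      also have "\<dots> \<le> (LINT t|circ. norm (D t - D 0) * (norm (S N t))\<^sup>2)"
        by (rule order_trans[OF integral_norm_bound]) (simp add: norm_mult norm_power)
      also have "\<dots> \<le> (LINT t|circ. e * (norm (S N t))\<^sup>2 + C)"
      proof (rule integral_mono)
        show "integrable circ (\<lambda>t. norm (D t - D 0) * (norm (S N t))\<^sup>2)"
        proof -
          have "integrable circ (\<lambda>t. norm (D t * of_real ((norm (S N t))\<^sup>2) - D 0 * of_real ((norm (S N t))\<^sup>2)))"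
            using i1 i2 by (intro integrable_norm Bochner_Integration.integrable_diff)
          then show ?thesis
            by (simp only: left_diff_distrib[symmetric] norm_mult norm_of_real abs_power2 abs_norm_cancel)
        qed
        show "integrable circ (\<lambda>t. e * (norm (S N t))\<^sup>2 + C)"
          using Fi integrable_circ_bounded[of "\<lambda>_. C" C] C by auto
      qed (use pt in \<open>auto simp: space_circ\<close>)
      also have "\<dots> = (LINT t|circ. e * (norm (S N t))\<^sup>2) + (LINT t|circ. C)"
        using Fi integrable_circ_bounded[of "\<lambda>_. C" C] C by (intro Bochner_Integration.integral_add) auto
      also have "\<dots> = e * (2 * pi * real N) + 2 * pi * C"
        by (simp only: integral_mult_right_zero F integral_circ_const)
      finally show ?thesis .
    qed
    \<comment> \<open>Division by the mass turns the contribution \<open>C\<close> of the region |t|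
      \<ge> d into O(1/N).\<close>
    have "norm (D 0) \<le> e + C * (1 / real (Suc N))" for N
    proof -
      have "2 * pi * (real (Suc N) * norm (D 0)) \<le> 2 * pi * (e * real (Suc N) + C)"
        using main[of "Suc N"] by (simp only: algebra_simps)
      then have "real (Suc N) * norm (D 0) \<le> e * real (Suc N) + C"
        by (rule mult_left_le_imp_le) (simp add: pi_gt_zero)
      then show ?thesis
        by (simp add: field_simps del: of_nat_Suc)
    qed
    moreover have "(\<lambda>N. e + C * (1 / real (Suc N))) \<longlonglongrightarrow> e + C * 0"
      by (intro tendsto_intros LIMSEQ_Suc[OF lim_1_over_n])
    ultimately show "norm (D 0) \<le> e"
      by (intro tendsto_lowerbound[of "\<lambda>N. e + C * (1 / real (Suc N))" e]) auto
  qed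
  then show ?thesis
    by (metis field_le_epsilon norm_le_zero_iff add_0)
qed

section \<open>Sums over the integers\<close>

lemma has_sum_int_symmetric:
  fixes a :: "nat \<Rightarrow> real"
  assumes nn: "\<And>n. 0 \<le> a n" and a: "summable (\<lambda>n. a (Suc n))"
  shows "((\<lambda>k :: int. a (nat \<bar>k\<bar>)) has_sum (2 * (\<Sum>n. a (Suc n)))) (- {0})"
proof -
  have 1: "((\<lambda>n. a (Suc n)) has_sum (\<Sum>n. a (Suc n))) UNIV"
    using a nn by (intro norm_summable_imp_has_sum summable_sums) auto
  have 2: "((\<lambda>k :: int. a (nat \<bar>k\<bar>)) has_sum (\<Sum>n. a (Suc n))) (range (\<lambda>n. int (Suc n)))"
    by (subst has_sum_reindex) (use 1 in \<open>auto simp: inj_on_def comp_def nat_add_distrib\<close>)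
  have 3: "((\<lambda>k :: int. a (nat \<bar>k\<bar>)) has_sum (\<Sum>n. a (Suc n))) (range (\<lambda>n. - int (Suc n)))"
    by (subst has_sum_reindex) (use 1 in \<open>auto simp: inj_on_def comp_def nat_add_distrib\<close>)
  have "range (\<lambda>n. int (Suc n)) \<union> range (\<lambda>n. - int (Suc n)) = - {0}"
  proof (intro set_eqI iffI)
    fix k :: int assume "k \<in> - {0}"
    then have "k = int (Suc (nat (k - 1))) \<or> k = - int (Suc (nat (- k - 1)))"
      by auto
    then show "k \<in> range (\<lambda>n. int (Suc n)) \<union> range (\<lambda>n. - int (Suc n))"
      by blast
  qed auto
  moreover have "range (\<lambda>n. int (Suc n)) \<inter> range (\<lambda>n. - int (Suc n)) = {}"
    by auto
  ultimately show ?thesis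
    using has_sum_Un_disjoint[OF 2 3] by (simp only: mult_2)
qed

lemma has_sum_int_powr:
  assumes "\<alpha> > 1"
  shows "((\<lambda>k :: int. real_of_int \<bar>k\<bar> powr (- \<alpha>)) has_sum (2 * zeta_real \<alpha>)) (- {0})"
proof -
  have "summable (\<lambda>n. real (Suc n) powr (- \<alpha>))"
    using assms summable_real_powr_iff[of "- \<alpha>"] by (subst summable_Suc_iff) simp
  from has_sum_int_symmetric[of "\<lambda>n. real n powr (- \<alpha>)", OF _ this]
  show ?thesis
    by (simp add: zeta_real_def powr_minus_divide)
qed

text \<open>Series over the integers are handled as series over the naturals along
  \<open>int_decode\<close>, where countable additivity and termwise integration apply; for
  nonnegative terms the order of enumeration is immaterial.\<close>

lemma summable_int_decode_iff:
  fixes a :: "int \<Rightarrow> real"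
  assumes "\<And>k. 0 \<le> a k"
  shows "summable (\<lambda>n. a (int_decode n)) \<longleftrightarrow> a summable_on UNIV"
  using assms summable_on_UNIV_nonneg_real_iff[of "\<lambda>n. a (int_decode n)"]
    summable_on_reindex_bij_betw[OF bij_int_decode, of a] by simp

lemma suminf_int_decode:
  fixes a :: "int \<Rightarrow> complex"
  assumes "(\<lambda>k. norm (a k)) summable_on UNIV"
  shows "(\<Sum>n. a (int_decode n)) = (\<Sum>\<^sub>\<infinity>k. a k)"
proof -
  have s: "summable (\<lambda>n. norm (a (int_decode n)))"
    using assms by (subst summable_int_decode_iff) auto
  have "((\<lambda>n. a (int_decode n)) has_sum (\<Sum>n. a (int_decode n))) UNIV"
    by (rule norm_summable_imp_has_sum[OF s summable_sums[OF summable_norm_cancel[OF s]]])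
  then have "(\<Sum>n. a (int_decode n)) = (\<Sum>\<^sub>\<infinity>n. a (int_decode n))"
    by (rule infsumI[symmetric])
  also have "\<dots> = (\<Sum>\<^sub>\<infinity>k. a k)"
    by (rule infsum_reindex_bij_betw[OF bij_int_decode])
  finally show ?thesis .
qed

lemma UN_int_intervals:
  assumes "p > (0 :: real)"
  shows "(\<Union>n. {a + p * of_int (int_decode n) ..< a + p + p * of_int (int_decode n)}) = UNIV"
proof (intro set_eqI iffI UNIV_I)
  fix t :: real
  define m where "m = \<lfloor>(t - a) / p\<rfloor>"
  have "of_int m \<le> (t - a) / p" "(t - a) / p < of_int m + 1"
    unfolding m_def by linarith+
  then have "t \<in> {a + p * of_int m ..< a + p + p * of_int m}"
    using assms by (simp add: field_simps)
  then show "t \<in> (\<Union>n. {a + p * of_int (int_decode n) ..< a + p + p * of_int (int_decode n)})"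
    by (intro UN_I[of "int_encode m"]) auto
qed

lemma disjoint_int_intervals:
  assumes "p > (0 :: real)" and "i \<noteq> j"
  shows "{a + p * of_int (int_decode i) ..< a + p + p * of_int (int_decode i)} \<inter>
         {a + p * of_int (int_decode j) ..< a + p + p * of_int (int_decode j)} = {}"
proof -
  have disj: "{a + p * of_int k ..< a + p + p * of_int k} \<inter> {a + p * of_int l ..< a + p + p * of_int l} = {}"
    if "k < l" for k l :: int
  proof -
    have "p * (of_int k + 1) \<le> p * of_int l"
      using that assms by (intro mult_left_mono) linarith+
    then show ?thesis by (auto simp: algebra_simps)
  qed
  have "int_decode i \<noteq> int_decode j"
    using assms(2) by (simp add: int_decode_eq)
  then show ?thesis
    using disj[of "int_decode i" "int_decode j"] disj[of "int_decode j" "int_decode i"]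
    by (cases "int_decode i < int_decode j") (auto simp: Int_commute)
qed

text \<open>The line is cut into periods: \<open>cis (of_int k * t)\<close> is unchanged by shifts
  through multiples of 2 pi, so each piece moves back to [-pi, pi).\<close>

lemma Fourier_coefficient_periodization:
  fixes F :: "real \<Rightarrow> complex"
  assumes F: "integrable lborel F"
  shows "(\<Sum>n. LINT t|circ. F (t + 2 * pi * of_int (int_decode n)) * cis (of_int k * t))
       = (LINT t|lborel. F t * cis (of_int k * t))"
proof -
  let ?A = "\<lambda>n. {- pi + 2 * pi * of_int (int_decode n) ..< - pi + 2 * pi + 2 * pi * of_int (int_decode n)}"
  have Fi: "integrable lborel (\<lambda>t. F t * cis (of_int k * t))"
    using F by (intro integrable_mult_cis) auto
  have "(LINT t|lborel. F t * cis (of_int k * t)) = (LINT t:(\<Union>n. ?A n)|lborel. F t * cis (of_int k * t))"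
    by (subst UN_int_intervals) (simp_all add: set_lebesgue_integral_def)
  also have "\<dots> = (\<Sum>n. LINT t:?A n|lborel. F t * cis (of_int k * t))"
  proof (rule lebesgue_integral_countable_add)
    show "set_integrable lborel (\<Union>n. ?A n) (\<lambda>t. F t * cis (of_int k * t))"
      using Fi by (subst UN_int_intervals) (simp_all add: set_integrable_def)
    show "?A i \<inter> ?A j = {}" if "i \<noteq> j" for i j
      by (rule disjoint_int_intervals[OF _ that]) simp
  qed simp
  also have "\<dots> = (\<Sum>n. LINT t|circ. F (t + 2 * pi * of_int (int_decode n)) * cis (of_int k * t))"
  proof (rule suminf_cong)
    fix n
    let ?s = "2 * pi * of_int (int_decode n)"
    have "(LINT t:?A n|lborel. F t * cis (of_int k * t))
      = (LINT t|lborel. indicator (?A n) (t - - ?s) *\<^sub>R (F (t - - ?s) * cis (of_int k * (t - - ?s))))"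
      unfolding set_lebesgue_integral_def by (rule integral_translate[symmetric])
    also have "\<dots> = (LINT t|lborel. indicator {-pi..<pi} t *\<^sub>R (F (t + ?s) * cis (of_int k * t)))"
    proof (rule Bochner_Integration.integral_cong)
      fix t
      have "cis (2 * pi * of_int (k * int_decode n)) = 1"
        by (rule cis_multiple_2pi) simp
      then have "cis (of_int k * (t - - ?s)) = cis (of_int k * t)"
        by (simp add: distrib_left cis_mult[symmetric] mult_ac)
      then show "indicator (?A n) (t - - ?s) *\<^sub>R (F (t - - ?s) * cis (of_int k * (t - - ?s)))
          = indicat_real {-pi..<pi} t *\<^sub>R (F (t + ?s) * cis (of_int k * t))"
        by (simp add: indicator_def)
    qed simp
    finally show "(LINT t:?A n|lborel. F t * cis (of_int k * t)) = (LINT t|circ. F (t + ?s) * cis (of_int k * t))"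
      by (simp only: integral_circ)
  qed
  finally show ?thesis by simp
qed

text \<open>Weierstrass M-test on one period, shared by the periodised transform and the series of
  samples. The majorants are assumed only for t in [-pi, pi), so continuity is proved on the open
  interval and claimed at 0, the point at which Fejer's argument needs it.\<close>

lemma
  fixes u :: "nat \<Rightarrow> real \<Rightarrow> complex"
  assumes cont: "\<And>n. continuous_on UNIV (u n)"
    and bd: "\<And>n t. - pi \<le> t \<Longrightarrow> t < pi \<Longrightarrow> norm (u n t) \<le> M n" and M: "summable M"
  shows isCont_suminf_circ: "isCont (\<lambda>t. \<Sum>n. u n t) 0"
    and norm_suminf_circ: "- pi \<le> t \<Longrightarrow> t < pi \<Longrightarrow> norm (\<Sum>n. u n t) \<le> suminf M"
    and summable_circ: "- pi \<le> t \<Longrightarrow> t < pi \<Longrightarrow> summable (\<lambda>n. norm (u n t))"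
    and Fourier_coefficient_suminf: "(LINT t|circ. (\<Sum>n. u n t) * cis (of_int k * t)) = (\<Sum>n. LINT t|circ. u n t * cis (of_int k * t))"
proof -
  have [measurable]: "u n \<in> borel_measurable borel" for n
    by (intro borel_measurable_continuous_onI cont)
  show sm: "summable (\<lambda>n. norm (u n t))" if "- pi \<le> t" "t < pi" for t
    using bd[OF that] M by (intro summable_comparison_test'[OF M]) auto
  show "norm (\<Sum>n. u n t) \<le> suminf M" if "- pi \<le> t" "t < pi" for t
    using summable_norm[OF sm[OF that]] suminf_le[OF bd[OF that] sm[OF that] M] by simp
  have "continuous_on {-pi<..<pi} (\<lambda>t. \<Sum>n. u n t)"
  proof (rule uniform_limit_theorem)
    show "uniform_limit {-pi<..<pi} (\<lambda>n t. \<Sum>i<n. u i t) (\<lambda>t. \<Sum>n. u n t) sequentially"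
      using bd M by (intro Weierstrass_m_test) auto
    show "\<forall>\<^sub>F n in sequentially. continuous_on {- pi<..<pi} (\<lambda>t. \<Sum>i<n. u i t)"
      by (intro always_eventually allI continuous_intros continuous_on_subset[OF cont]) auto
  qed simp
  then show "isCont (\<lambda>t. \<Sum>n. u n t) 0"
    by (simp add: continuous_on_eq_continuous_at)
  have i: "integrable circ (\<lambda>t. u n t * cis (of_int k * t))" for n
    using bd by (intro integrable_circ_bounded[where B = "M n"]) (auto simp: norm_mult)
  have s1: "AE t in circ. summable (\<lambda>n. norm (u n t * cis (of_int k * t)))"
    using sm by (intro AE_I2) (simp add: norm_mult space_circ)
  have s2: "summable (\<lambda>n. LINT t|circ. norm (u n t * cis (of_int k * t)))"
  proof (rule summable_comparison_test')
    show "summable (\<lambda>n. 2 * pi * M n)"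
      using M by (rule summable_mult)
    fix n
    have "(LINT t|circ. norm (u n t * cis (of_int k * t))) \<le> (LINT t|circ. M n)"
    proof (rule integral_mono)
      show "integrable circ (\<lambda>t. M n)"
        by (rule integrable_circ_bounded[where B = "norm (M n)"]) auto
      show "norm (u n t * cis (of_int k * t)) \<le> M n" if "t \<in> space circ" for t
        using that bd[of t n] by (simp add: norm_mult space_circ)
    qed (rule integrable_norm[OF i])
    then show "norm (LINT t|circ. norm (u n t * cis (of_int k * t))) \<le> 2 * pi * M n"
      by (simp only: integral_circ_const) simp
  qed
  have "(LINT t|circ. (\<Sum>n. u n t) * cis (of_int k * t)) = (LINT t|circ. (\<Sum>n. u n t * cis (of_int k * t)))"
  proof (rule Bochner_Integration.integral_cong)
    fix t assume "t \<in> space circ"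
    then show "(\<Sum>n. u n t) * cis (of_int k * t) = (\<Sum>n. u n t * cis (of_int k * t))"
      by (intro suminf_mult2[OF summable_norm_cancel[OF sm]]) (auto simp: space_circ)
  qed simp
  also have "\<dots> = (\<Sum>n. LINT t|circ. u n t * cis (of_int k * t))"
    by (rule integral_suminf[OF i s1 s2])
  finally show "(LINT t|circ. (\<Sum>n. u n t) * cis (of_int k * t)) = (\<Sum>n. LINT t|circ. u n t * cis (of_int k * t))" .
qed

text \<open>Two functions of t are compared: the periodisation \<open>\<Sum>n. u n t\<close> of the
  rescaled transform and the trigonometric series \<open>\<Sum>n. w n t\<close> of the samples.
  Inversion gives the first the coefficients 2 pi h f(hk), orthogonality gives the second the same
  ones. Their difference is bounded, continuous at 0 and has vanishing coefficients, hence is 0 at t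
  = 0, which is the formula.\<close>

lemma poisson_summation:
  fixes f :: "real \<Rightarrow> complex"
  assumes h: "h > 0" and \<alpha>: "\<alpha> > 1"
    and f: "integrable lborel f" and cont: "continuous_on UNIV f" and bdd: "\<And>x. norm (f x) \<le> B"
    and ff: "integrable lborel (ft f)"
    and decay: "\<And>v. v \<noteq> 0 \<Longrightarrow> norm (ft f v) \<le> G * \<bar>v\<bar> powr (- \<alpha>)"
    and summ: "(\<lambda>k :: int. norm (f (h * of_int k))) summable_on UNIV"
  shows "(\<lambda>k :: int. norm (ft f (2 * pi / h * of_int k))) summable_on UNIV"
    and "of_real h * (\<Sum>\<^sub>\<infinity>k :: int. f (h * of_int k)) = (\<Sum>\<^sub>\<infinity>k :: int. ft f (2 * pi / h * of_int k))"
proof -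
  let ?e = "\<lambda>n. real_of_int (int_decode n)"
  define F where "F t = ft f (t / h)" for t
  define u where "u n t = F (t + 2 * pi * ?e n)" for n t
  define w where "w n t = of_real h * f (h * ?e n) * cis (- ?e n * t)" for n t
  \<comment> \<open>For |t| \<le> pi and k \<noteq> 0 one has |t + 2 pi k| \<ge> pi |k|, which fixes
    the factor \<open>(pi / h) powr (- \<alpha>)\<close>. At k = 0 the decay gives no bound near the
    origin and the L1 norm of \<open>f\<close> serves instead.\<close>
  define b where "b k = (if k = 0 then (LINT x|lborel. norm (f x)) else G * (pi / h) powr (- \<alpha>) * real_of_int \<bar>k\<bar> powr (- \<alpha>))" for k :: int
  have G: "0 \<le> G"
    using order_trans[OF norm_ge_zero decay[of 1]] by simp
  have b0: "0 \<le> b k" for k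
    using G by (simp add: b_def)
  have "(\<lambda>k :: int. real_of_int \<bar>k\<bar> powr (- \<alpha>)) summable_on (- {0})"
    using has_sum_int_powr[OF \<alpha>] by (auto simp: summable_on_def)
  then have "b summable_on (- {0})"
    by (subst summable_on_cong[of _ _ "\<lambda>k. G * (pi / h) powr (- \<alpha>) * real_of_int \<bar>k\<bar> powr (- \<alpha>)"])
       (auto simp: b_def intro: summable_on_cmult_right)
  then have bs: "b summable_on UNIV"
    using summable_on_insert_iff[of b 0 "- {0}"] by (simp add: insert_UNIV insert_Diff_single Compl_eq_Diff_UNIV)
  have u_le: "norm (u n t) \<le> b (int_decode n)" if t: "- pi \<le> t" "t < pi" for n t
  proof (cases "int_decode n = 0")
    case True
    then show ?thesis
      by (simp add: u_def F_def b_def norm_ft_le)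
  next
    case False
    then have "1 \<le> \<bar>?e n\<bar>" by linarith
    have "pi * \<bar>?e n\<bar> \<le> 2 * pi * \<bar>?e n\<bar> - pi"
      using mult_left_mono[OF \<open>1 \<le> \<bar>?e n\<bar>\<close>, of pi] by simp
    also have "\<dots> \<le> \<bar>2 * pi * ?e n\<bar> - \<bar>t\<bar>"
      using t by (simp add: abs_mult)
    also have "\<dots> \<le> \<bar>t + 2 * pi * ?e n\<bar>" by linarith
    finally have le: "pi / h * \<bar>?e n\<bar> \<le> \<bar>(t + 2 * pi * ?e n) / h\<bar>"
      using h by (simp add: field_simps)
    have pos: "0 < pi / h * \<bar>?e n\<bar>"
      using h \<open>1 \<le> \<bar>?e n\<bar>\<close> by (intro mult_pos_pos) auto
    have "norm (u n t) \<le> G * \<bar>(t + 2 * pi * ?e n) / h\<bar> powr (- \<alpha>)"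
      unfolding u_def F_def using le pos by (intro decay) auto
    also have "\<dots> \<le> G * (pi / h * \<bar>?e n\<bar>) powr (- \<alpha>)"
      using G \<alpha> le pos by (intro mult_left_mono powr_mono2') auto
    also have "\<dots> = b (int_decode n)"
      using False powr_mult[of "pi / h" "\<bar>?e n\<bar>" "- \<alpha>"] h
      by (simp only: b_def if_False mult.assoc of_int_abs)
    finally show ?thesis .
  qed
  have sb: "summable (\<lambda>n. b (int_decode n))"
    using b0 bs by (simp add: summable_int_decode_iff)
  have cu: "continuous_on UNIV (u n)" for n
    unfolding u_def F_def using h
    by (intro continuous_on_compose2[OF continuous_on_ft[OF f, of UNIV]] continuous_intros) auto
  have w_le: "norm (w n t) \<le> h * norm (f (h * ?e n))" for n t
    using h by (simp add: w_def norm_mult)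
  have sn: "summable (\<lambda>n. norm (f (h * ?e n)))"
    using summ summable_int_decode_iff[of "\<lambda>k. norm (f (h * of_int k))"] by simp
  have sw: "summable (\<lambda>n. h * norm (f (h * ?e n)))"
    by (rule summable_mult[OF sn])
  have cw: "continuous_on UNIV (w n)" for n
    unfolding w_def by (intro continuous_intros)
  note uu = isCont_suminf_circ[of u, OF cu u_le sb] norm_suminf_circ[of u, OF cu u_le sb]
  note ww = isCont_suminf_circ[of w, OF cw w_le sw] norm_suminf_circ[of w, OF cw w_le sw]
  have Fi: "integrable lborel F"
    unfolding F_def using lborel_integrable_real_affine[OF ff, of "1 / h" 0] h by simp
  have cf_u: "(LINT t|circ. (\<Sum>n. u n t) * cis (of_int k * t)) = of_real (2 * pi * h) * f (h * of_int k)" for k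
  proof -
    have "(LINT t|circ. (\<Sum>n. u n t) * cis (of_int k * t)) = (\<Sum>n. LINT t|circ. u n t * cis (of_int k * t))"
      by (rule Fourier_coefficient_suminf[of u, OF cu u_le sb])
    also have "\<dots> = (LINT t|lborel. F t * cis (of_int k * t))"
      unfolding u_def by (rule Fourier_coefficient_periodization[OF Fi])
    also have "\<dots> = \<bar>h\<bar> *\<^sub>R (LINT t|lborel. F (0 + h * t) * cis (of_int k * (0 + h * t)))"
      using h by (intro lborel_integral_real_affine) auto
    also have "\<dots> = of_real h * (LINT t|lborel. ft f t * cis (t * (h * of_int k)))"
      using h by (simp add: F_def scaleR_conv_of_real mult_ac)
    also have "\<dots> = of_real (2 * pi * h) * f (h * of_int k)"
      by (simp add: ft_inversion[OF f cont bdd ff])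
    finally show ?thesis .
  qed
  have cf_w: "(LINT t|circ. (\<Sum>n. w n t) * cis (of_int k * t)) = of_real (2 * pi * h) * f (h * of_int k)" for k
  proof -
    have "(LINT t|circ. w n t * cis (of_int k * t)) = (if n = int_encode k then of_real (2 * pi * h) * f (h * of_int k) else 0)" for n
    proof -
      have "(LINT t|circ. w n t * cis (of_int k * t)) = (LINT t|circ. of_real h * f (h * ?e n) * cis (of_int (k - int_decode n) * t))"
        by (simp add: w_def mult.assoc cis_mult) (simp add: algebra_simps)
      also have "\<dots> = (if n = int_encode k then of_real (2 * pi * h) * f (h * of_int k) else 0)"
        by (auto simp only: integral_mult_right_zero integral_circ_cis) auto
      finally show ?thesis .
    qed
    then have "(\<Sum>n. LINT t|circ. w n t * cis (of_int k * t)) = of_real (2 * pi * h) * f (h * of_int k)"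
      by (subst suminf_finite[of "{int_encode k}"]) auto
    with Fourier_coefficient_suminf[of w, OF cw w_le sw] show ?thesis
      by (rule trans)
  qed
  have [measurable]: "u n \<in> borel_measurable borel" "w n \<in> borel_measurable borel" for n
    by (intro borel_measurable_continuous_onI cu cw)+
  define D where "D t = (\<Sum>n. u n t) - (\<Sum>n. w n t)" for t
  have "D 0 = 0"
  proof (rule zero_Fourier_coefficients_imp_zero)
    show "D \<in> borel_measurable borel"
      unfolding D_def by measurable
    show "norm (D t) \<le> suminf (\<lambda>n. b (int_decode n)) + suminf (\<lambda>n. h * norm (f (h * ?e n)))" if "- pi \<le> t" "t < pi" for t
      unfolding D_def by (rule order_trans[OF norm_triangle_ineq4 add_mono[OF uu(2) ww(2)]]) (use that in auto)
    show "isCont D 0"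
      unfolding D_def by (intro continuous_diff uu ww)
    fix k
    have "integrable circ (\<lambda>t. (\<Sum>n. u n t) * cis (of_int k * t))"
      using uu(2) by (intro integrable_circ_bounded[where B = "suminf (\<lambda>n. b (int_decode n))"]) (auto simp: norm_mult)
    moreover have "integrable circ (\<lambda>t. (\<Sum>n. w n t) * cis (of_int k * t))"
      using ww(2) by (intro integrable_circ_bounded[where B = "suminf (\<lambda>n. h * norm (f (h * ?e n)))"]) (auto simp: norm_mult)
    ultimately show "(LINT t|circ. D t * cis (of_int k * t)) = 0"
      by (simp add: D_def left_diff_distrib cf_u cf_w)
  qed
  show s: "(\<lambda>k :: int. norm (ft f (2 * pi / h * of_int k))) summable_on UNIV"
    using summable_circ[of u, OF cu u_le sb, of 0] summable_int_decode_iff[of "\<lambda>k. norm (ft f (2 * pi / h * of_int k))"]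
    by (simp add: u_def F_def)
  have "of_real h * (\<Sum>\<^sub>\<infinity>k :: int. f (h * of_int k)) = of_real h * (\<Sum>n. f (h * ?e n))"
    by (simp add: suminf_int_decode[OF summ])
  also have "\<dots> = (\<Sum>n. w n 0)"
    by (simp add: w_def suminf_mult summable_norm_cancel[OF sn])
  also have "\<dots> = (\<Sum>n. u n 0)"
    using \<open>D 0 = 0\<close> by (simp add: D_def)
  also have "\<dots> = (\<Sum>\<^sub>\<infinity>k :: int. ft f (2 * pi / h * of_int k))"
    using suminf_int_decode[OF s] by (simp add: u_def F_def)
  finally show "of_real h * (\<Sum>\<^sub>\<infinity>k :: int. f (h * of_int k)) = (\<Sum>\<^sub>\<infinity>k :: int. ft f (2 * pi / h * of_int k))" .
qed

subsection \<open>The symbol of the truncated Riesz integral\<close>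

lemma integrable_powr_near_0:
  assumes "a > (-1::real)"
  shows "integrable lborel (\<lambda>s. indicat_real {0<..1} s * s powr a)"
proof -
  have "(\<lambda>x. x powr a) absolutely_integrable_on {0<..1}"
    using assms by (intro nonnegative_absolutely_integrable_1 integrable_on_powr_from_0') auto
  then show ?thesis
    by (simp add: set_integrable_def integrable_completion)
qed

lemma
  assumes "b < (-1::real)" "e > 0"
  shows integrable_powr_at_top: "integrable lborel (\<lambda>s. indicat_real {e<..} s * s powr b)"
    and integral_powr_at_top: "(LINT s|lborel. indicat_real {e<..} s * s powr b) = e powr (b + 1) / (- b - 1)"
proof -
  have hi: "((\<lambda>x. x powr b) has_integral -(e powr (b+1)) / (b+1)) {e..}"
    using assms by (rule has_integral_powr_to_inf)
  then have hi': "((\<lambda>x. x powr b) has_integral -(e powr (b+1)) / (b+1)) {e<..}"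
    by (rule has_integral_spike_set_eq[THEN iffD1, rotated -1])
       (auto intro: negligible_subset[of "{e}"])
  have "(\<lambda>x. x powr b) absolutely_integrable_on {e<..}"
    using hi' by (intro nonnegative_absolutely_integrable_1) auto
  then show i: "integrable lborel (\<lambda>s. indicat_real {e<..} s * s powr b)"
    by (simp add: set_integrable_def integrable_completion)
  have "(LINT s|lborel. indicat_real {e<..} s * s powr b) = integral {e<..} (\<lambda>x. x powr b)"
    using set_borel_integral_eq_integral(2)[of "{e<..}" "\<lambda>x. x powr b"] i
    by (simp add: set_lebesgue_integral_def set_integrable_def)
  also have "\<dots> = e powr (b + 1) / (- b - 1)"
    using hi' assms by (simp add: integral_unique field_simps)
  finally show "(LINT s|lborel. indicat_real {e<..} s * s powr b) = e powr (b + 1) / (- b - 1)" .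
qed

lemma integrable_powr_reflect:
  assumes "a > (1::real)" "e > 0"
  shows "integrable lborel (\<lambda>w. indicat_real {w. e < \<bar>w\<bar>} w * \<bar>w\<bar> powr (- a))"
proof -
  have i: "integrable lborel (\<lambda>s. indicat_real {e<..} s * s powr (- a))"
    using assms by (intro integrable_powr_at_top) auto
  then have "integrable lborel (\<lambda>s. indicat_real {e<..} (0 + -1 * s) * (0 + -1 * s) powr (- a))"
    by (rule lborel_integrable_real_affine) simp
  with i have "integrable lborel (\<lambda>s. indicat_real {e<..} s * s powr (- a) + indicat_real {e<..} (- s) * (- s) powr (- a))"
    by (intro Bochner_Integration.integrable_add) auto
  also have "(\<lambda>s. indicat_real {e<..} s * s powr (- a) + indicat_real {e<..} (- s) * (- s) powr (- a))
     = (\<lambda>w. indicat_real {w. e < \<bar>w\<bar>} w * \<bar>w\<bar> powr (- a))"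
    using assms by (intro ext) (auto simp: indicator_def)
  finally show ?thesis .
qed

lemma tendsto_0_mult_le_1:
  fixes f g :: "'a \<Rightarrow> real"
  assumes f: "(f \<longlongrightarrow> 0) F" and g: "\<And>x. \<bar>g x\<bar> \<le> 1"
  shows "((\<lambda>x. f x * g x) \<longlongrightarrow> 0) F"
  by (rule Lim_null_comparison[OF _ tendsto_rabs_zero[OF f]])
     (auto simp: abs_mult g intro!: always_eventually mult_left_le)

text \<open>\<open>j\<close> remains a parameter because it has two roles: for an arbitrary strong
  Riesz derivative it is whatever the definition supplies, for the existence proof it is taken
  large.\<close>

locale riesz_kernel =
  fixes \<alpha> :: real and j :: nat
  assumes alpha_gt: "1 < \<alpha>" and alpha_lt: "\<alpha> < 2 * real j"
begin

text \<open>\<open>q\<close> is the integrand of \<open>riesz_const\<close> after the substitution \<open>u = s / 2\<close>, up to a constant factor.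
  The truncated Riesz integral multiplies the Fourier transform by \<open>\<bar>v\<bar>\<^sup>\<alpha> m(\<epsilon>v)\<close>.\<close>

definition q :: "real \<Rightarrow> real" where
  "q s = sin (s / 2) ^ (2 * j) / s powr (1 + \<alpha>)"

definition Q :: "real \<Rightarrow> real" where
  "Q w = (LINT s|lborel. indicat_real {\<bar>w\<bar><..} s * q s)"

definition m :: "real \<Rightarrow> real" where
  "m w = Q w / Q 0"

lemma q_measurable [measurable]: "q \<in> borel_measurable borel"
  unfolding q_def by measurable

lemma q_nonneg: "0 \<le> q s"
  by (simp add: q_def)

lemma sin_half_power_le_1: "sin (s / 2 :: real) ^ (2 * j) \<le> 1"
proof -
  have "\<bar>sin (s / 2)\<bar> ^ (2 * j) \<le> 1 ^ (2 * j)"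
    by (intro power_mono) auto
  then show ?thesis by (simp add: power_even_abs)
qed

lemma q_le_at_top: "q s \<le> s powr (- (1 + \<alpha>))"
  unfolding q_def powr_minus_divide by (intro divide_right_mono sin_half_power_le_1) simp

lemma abs_sin_half_le: "0 < s \<Longrightarrow> \<bar>sin (s / 2)\<bar> \<le> (s :: real)"
  using abs_sin_x_le_abs_x[of "s / 2"] by simp

lemma q_le_near_0:
  assumes "0 < s" shows "q s \<le> s powr (2 * real j - 1 - \<alpha>)"
proof -
  have "\<bar>sin (s / 2)\<bar> ^ (2 * j) \<le> s ^ (2 * j)"
    using assms by (intro power_mono abs_sin_half_le) auto
  then have "q s \<le> s ^ (2 * j) / s powr (1 + \<alpha>)"
    unfolding q_def by (intro divide_right_mono) (auto simp: power_even_abs)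
  also have "\<dots> = s powr (2 * real j - 1 - \<alpha>)"
    using assms by (simp add: powr_realpow[symmetric] powr_diff[symmetric] diff_diff_eq)
  finally show ?thesis .
qed

text \<open>\<open>\<alpha> < 2 * real j\<close> puts the exponent 2j - 1 - \<alpha> above -1, which
  gives integrability near 0; at infinity the sine power is at most 1 and the weight alone
  suffices.\<close>

lemma integrable_q0: "integrable lborel (\<lambda>s. indicat_real {0<..} s * q s)"
proof (rule Bochner_Integration.integrable_bound)
  show "integrable lborel (\<lambda>s. indicat_real {0<..1} s * s powr (2 * real j - 1 - \<alpha>) + indicat_real {1<..} s * s powr (- (1 + \<alpha>)))"
    using alpha_gt alpha_lt by (intro Bochner_Integration.integrable_add integrable_powr_near_0 integrable_powr_at_top) auto
  show "AE s in lborel. norm (indicat_real {0<..} s * q s)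
     \<le> norm (indicat_real {0<..1} s * s powr (2 * real j - 1 - \<alpha>) + indicat_real {1<..} s * s powr (- (1 + \<alpha>)))"
    using q_nonneg q_le_near_0 q_le_at_top by (intro AE_I2) (auto simp: indicator_def)
qed measurable

lemma integrable_q: "integrable lborel (\<lambda>s. indicat_real {\<bar>w\<bar><..} s * q s)"
  by (rule Bochner_Integration.integrable_bound[OF integrable_q0]) (auto simp: indicator_def)

lemma Q0_pos: "0 < Q 0"
proof -
  \<comment> \<open>On [1, 2] the argument s / 2 stays in [1/2, 1], where the sine increases, so
    \<open>q\<close> is at least its smallest numerator over its largest denominator.\<close>
  define c where "c = sin (1/2) ^ (2 * j) / 2 powr (1 + \<alpha>)"
  have s12: "0 < sin (1/2 :: real)"
    using pi_gt3 by (intro sin_gt_zero) auto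
  have "c \<le> q s" if "1 \<le> s" "s \<le> 2" for s
  proof -
    have "sin (1/2) \<le> sin (s / 2)"
      using that pi_gt3 by (intro sin_monotone_2pi_le) auto
    then show ?thesis
      unfolding c_def q_def using that s12 alpha_gt
      by (intro frac_le power_mono powr_mono2) auto
  qed
  then have "(LINT s|lborel. indicat_real {1..2::real} s * c) \<le> Q 0"
    unfolding Q_def
  proof (intro integral_mono)
    show "integrable lborel (\<lambda>s. indicat_real {1..2::real} s * c)"
      by (intro integrable_mult_left integrable_real_indicator) auto
  qed (use integrable_q[of 0] q_nonneg in \<open>auto simp: indicator_def\<close>)
  moreover have "0 < c"
    unfolding c_def using s12 by simp
  ultimately show ?thesis by simp
qed

lemma Q_nonneg: "0 \<le> Q w"
  unfolding Q_def by (intro integral_nonneg_AE AE_I2) (simp add: q_nonneg)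

lemma Q_le: "w \<noteq> 0 \<Longrightarrow> Q w \<le> \<bar>w\<bar> powr (- \<alpha>) / \<alpha>"
proof -
  assume w: "w \<noteq> 0"
  have "Q w \<le> (LINT s|lborel. indicat_real {\<bar>w\<bar><..} s * s powr (- (1 + \<alpha>)))"
    unfolding Q_def using integrable_q integrable_powr_at_top[of "- (1 + \<alpha>)" "\<bar>w\<bar>"] w alpha_gt q_le_at_top
    by (intro integral_mono) (auto simp: indicator_def)
  also have "\<dots> = \<bar>w\<bar> powr (- \<alpha>) / \<alpha>"
    using integral_powr_at_top[of "- (1 + \<alpha>)" "\<bar>w\<bar>"] w alpha_gt by simp
  finally show ?thesis .
qed

lemma Q_le_Q0: "Q w \<le> Q 0"
  unfolding Q_def using integrable_q[of w] integrable_q[of 0] q_nonneg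
  by (intro integral_mono) (auto simp: indicator_def)

lemma m_0: "m 0 = 1" and m_even: "m (- w) = m w" and m_nonneg: "0 \<le> m w" and m_le_1: "m w \<le> 1"
  using Q0_pos Q_nonneg[of w] Q_le_Q0[of w] by (auto simp: m_def Q_def)

text \<open>Moving \<open>w\<close> affects the indicator of the tail, in the limit, only at s =
  |w|, a null set. Continuity at 0 is what later identifies the transform of the derivative.\<close>

lemma isCont_m: "isCont m w"
  unfolding continuous_at_sequentially comp_def
proof (intro allI impI)
  fix X assume X: "X \<longlonglongrightarrow> w"
  have "(\<lambda>n. Q (X n)) \<longlonglongrightarrow> Q w"
    unfolding Q_def
  proof (rule integral_dominated_convergence[OF _ _ integrable_q0])
    show "AE s in lborel. (\<lambda>n. indicat_real {\<bar>X n\<bar><..} s * q s) \<longlonglongrightarrow> indicat_real {\<bar>w\<bar><..} s * q s"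
      using AE_lborel_singleton[of "\<bar>w\<bar>"]
    proof eventually_elim
      case (elim s)
      have X': "(\<lambda>n. \<bar>X n\<bar>) \<longlonglongrightarrow> \<bar>w\<bar>"
        using X by (intro tendsto_intros)
      have "\<forall>\<^sub>F n in sequentially. indicat_real {\<bar>X n\<bar><..} s = indicat_real {\<bar>w\<bar><..} s"
      proof (cases "\<bar>w\<bar> < s")
        case True
        then show ?thesis
          using order_tendstoD(2)[OF X' True] by (auto elim!: eventually_mono)
      next
        case False
        then show ?thesis
          using order_tendstoD(1)[OF X', of s] elim by (auto elim!: eventually_mono)
      qed
      then show ?case
        by (intro tendsto_eventually) (auto elim!: eventually_mono)
    qed
    show "AE s in lborel. norm (indicat_real {\<bar>X n\<bar><..} s * q s) \<le> indicat_real {0<..} s * q s" for n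
      using q_nonneg by (intro AE_I2) (auto simp: indicator_def)
  qed auto
  then show "(\<lambda>n. m (X n)) \<longlonglongrightarrow> m w"
    unfolding m_def using Q0_pos by (intro tendsto_divide tendsto_const) auto
qed

lemma m_measurable [measurable]: "m \<in> borel_measurable borel"
  by (intro borel_measurable_continuous_onI continuous_at_imp_continuous_on ballI isCont_m)

text \<open>On [-1, 1] the bound m \<le> 1 serves; outside, the tail decays like |w|^(-\<alpha>),
  integrable since \<open>\<alpha> > 1\<close>.\<close>

lemma integrable_m: "integrable lborel m"
proof (rule Bochner_Integration.integrable_bound)
  show "integrable lborel (\<lambda>w. indicat_real {-1..1} w + 1 / (\<alpha> * Q 0) * (indicat_real {w. 1 < \<bar>w\<bar>} w * \<bar>w\<bar> powr (- \<alpha>)))"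
    using alpha_gt by (intro Bochner_Integration.integrable_add integrable_mult_right integrable_powr_reflect integrable_real_indicator) auto
  show "AE w in lborel. norm (m w) \<le> norm (indicat_real {-1..1} w + 1 / (\<alpha> * Q 0) * (indicat_real {w. 1 < \<bar>w\<bar>} w * \<bar>w\<bar> powr (- \<alpha>)))"
  proof (rule AE_I2)
    fix w
    show "norm (m w) \<le> norm (indicat_real {-1..1} w + 1 / (\<alpha> * Q 0) * (indicat_real {w. 1 < \<bar>w\<bar>} w * \<bar>w\<bar> powr (- \<alpha>)))"
    proof (cases "\<bar>w\<bar> \<le> 1")
      case True
      then show ?thesis using m_le_1 m_nonneg by (auto simp: indicator_def abs_le_iff)
    next
      case False
      then have "m w \<le> \<bar>w\<bar> powr (- \<alpha>) / \<alpha> / Q 0"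
        unfolding m_def using Q0_pos by (intro divide_right_mono Q_le) auto
      then show ?thesis
        using False m_nonneg[of w] Q0_pos alpha_gt by (auto simp: indicator_def field_simps)
    qed
  qed
qed measurable

lemma DERIV_m:
  assumes w: "0 < w"
  shows "(m has_real_derivative - q w / Q 0) (at w)"
proof -
  \<comment> \<open>The base point w / 2 keeps the interval away from the singular weight at 0, so
    the fundamental theorem meets a continuous integrand.\<close>
  let ?a = "w / 2" and ?b = "w + 1"
  have cont: "continuous_on {?a..?b} q"
    unfolding q_def using w by (intro continuous_intros) auto
  have eq: "Q x = Q ?a - integral {?a..x} q" if "x \<in> {?a..?b}" for x
  proof -
    have "set_integrable lborel {?a<..x} q"
      unfolding set_integrable_def
      using w by (intro Bochner_Integration.integrable_bound[OF integrable_q0]) (auto simp: indicator_def)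
    then have i: "integrable lborel (\<lambda>s. indicat_real {?a<..x} s * q s)"
      by (simp add: set_integrable_def)
    have "Q ?a = (LINT s|lborel. indicat_real {?a<..x} s * q s + indicat_real {\<bar>x\<bar><..} s * q s)"
      unfolding Q_def using that w by (intro Bochner_Integration.integral_cong) (auto simp: indicator_def)
    also have "\<dots> = (LINT s|lborel. indicat_real {?a<..x} s * q s) + Q x"
      unfolding Q_def using i integrable_q by (intro Bochner_Integration.integral_add)
    also have "(LINT s|lborel. indicat_real {?a<..x} s * q s) = (LINT s|lborel. indicat_real {?a..x} s * q s)"
    proof (rule integral_cong_AE)
      show "AE s in lborel. indicat_real {?a<..x} s * q s = indicat_real {?a..x} s * q s"
        using AE_lborel_singleton[of ?a] by eventually_elim (auto simp: indicator_def)
    qed auto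
    also have "\<dots> = integral {?a..x} q"
      using set_borel_integral_eq_integral(2)[of "{?a..x}" q]
        borel_integrable_atLeastAtMost'[OF continuous_on_subset[OF cont, of "{?a..x}"]] that
      by (simp add: set_lebesgue_integral_def)
    finally show ?thesis by simp
  qed
  have "((\<lambda>x. integral {?a..x} q) has_real_derivative q w) (at w within {?a..?b})"
    using w by (intro integral_has_real_derivative cont) auto
  then have "((\<lambda>x. (Q ?a - integral {?a..x} q) / Q 0) has_real_derivative - q w / Q 0) (at w within {?a..?b})"
    using Q0_pos by (auto intro!: derivative_eq_intros)
  then have "(m has_real_derivative - q w / Q 0) (at w within {?a..?b})"
  proof (rule has_field_derivative_transform_within[of _ _ _ _ 1])
    show "(Q ?a - integral {?a..x} q) / Q 0 = m x" if "x \<in> {?a..?b}" for x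
      using eq[OF that] by (simp only: m_def)
  qed (use w in auto)
  moreover have "at w within {?a..?b} = at w"
    using w by (intro at_within_interior) auto
  ultimately show ?thesis by simp
qed

definition q' :: "real \<Rightarrow> real" where
  "q' s = real j * sin (s / 2) ^ (2 * j - 1) * cos (s / 2) * s powr (- 1 - \<alpha>)
        + (- 1 - \<alpha>) * sin (s / 2) ^ (2 * j) * s powr (- 2 - \<alpha>)"

lemma q'_measurable [measurable]: "q' \<in> borel_measurable borel"
  unfolding q'_def by measurable

lemma DERIV_q:
  assumes "0 < s"
  shows "(q has_real_derivative q' s) (at s)"
proof -
  have pw: "s powr (- \<alpha> - 2) = s powr (- 2 - \<alpha>)"
    by (rule arg_cong[where f = "(powr) s"]) linarith
  have "((\<lambda>s. sin (s / 2) ^ (2 * j) * s powr (- 1 - \<alpha>)) has_real_derivative q' s) (at s)"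
    unfolding q'_def using assms
    by (auto intro!: derivative_eq_intros simp: field_simps pw)
  moreover have "q = (\<lambda>s. sin (s / 2) ^ (2 * j) * s powr (- 1 - \<alpha>))"
  proof -
    have e: "- 1 - \<alpha> = - (1 + \<alpha>)"
      by simp
    show ?thesis
      unfolding q_def e powr_minus divide_inverse ..
  qed
  ultimately show ?thesis by simp
qed

text \<open>Source of the requirement 2j \<ge> \<alpha> + 2: near 0 both terms of \<open>q'\<close>
  are of size s^(2j - 2 - \<alpha>), and the requirement makes this exponent nonnegative. For s > 1
  the trigonometric factors are at most 1 in absolute value and s^(-1 - \<alpha>) is the larger
  power.\<close>

lemma abs_q'_le:
  assumes j: "\<alpha> + 2 \<le> 2 * real j" and s: "0 < s"
  shows "\<bar>q' s\<bar> \<le> (real j + 1 + \<alpha>) * (if s \<le> 1 then 1 else s powr (- 1 - \<alpha>))"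
proof -
  let ?B = "if s \<le> 1 then 1 else s powr (- 1 - \<alpha>)"
  have j1: "1 \<le> 2 * j" "real (2 * j - 1) = 2 * real j - 1"
    using alpha_gt j by linarith+
  have sp: "\<bar>sin (s / 2)\<bar> ^ k \<le> 1" "\<bar>sin (s / 2)\<bar> ^ k \<le> s powr real k" for k
    using power_mono[OF abs_sin_half_le[OF s], of k] s
    by (auto intro: power_le_one simp: powr_realpow)
  have 1: "\<bar>sin (s / 2)\<bar> ^ (2 * j - 1) * s powr (- 1 - \<alpha>) \<le> ?B"
  proof (cases "s \<le> 1")
    case True
    have "\<bar>sin (s / 2)\<bar> ^ (2 * j - 1) * s powr (- 1 - \<alpha>) \<le> s powr (2 * real j - 1) * s powr (- 1 - \<alpha>)"
      using sp(2)[of "2 * j - 1"] j1 by (intro mult_right_mono) auto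
    also have "\<dots> = s powr (2 * real j - 2 - \<alpha>)"
      by (simp add: powr_add[symmetric] algebra_simps)
    also have "\<dots> \<le> 1"
      using s True j by (intro powr_le1) auto
    finally show ?thesis using True by simp
  next
    case False
    then show ?thesis
      using mult_right_mono[OF sp(1)[of "2 * j - 1"], of "s powr (- 1 - \<alpha>)"] by simp
  qed
  have 2: "\<bar>sin (s / 2)\<bar> ^ (2 * j) * s powr (- 2 - \<alpha>) \<le> ?B"
  proof (cases "s \<le> 1")
    case True
    have "\<bar>sin (s / 2)\<bar> ^ (2 * j) * s powr (- 2 - \<alpha>) \<le> s powr (2 * real j) * s powr (- 2 - \<alpha>)"
      using sp(2)[of "2 * j"] by (intro mult_right_mono) auto
    also have "\<dots> = s powr (2 * real j - 2 - \<alpha>)"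
      by (simp add: powr_add[symmetric] algebra_simps)
    also have "\<dots> \<le> 1"
      using s True j by (intro powr_le1) auto
    finally show ?thesis using True by simp
  next
    case False
    have "\<bar>sin (s / 2)\<bar> ^ (2 * j) * s powr (- 2 - \<alpha>) \<le> 1 * s powr (- 1 - \<alpha>)"
      using False sp(1)[of "2 * j"] by (intro mult_mono powr_mono) auto
    then show ?thesis using False by simp
  qed
  have "\<bar>q' s\<bar> \<le> real j * (\<bar>sin (s / 2)\<bar> ^ (2 * j - 1) * s powr (- 1 - \<alpha>)) * \<bar>cos (s / 2)\<bar>
      + (1 + \<alpha>) * (\<bar>sin (s / 2)\<bar> ^ (2 * j) * s powr (- 2 - \<alpha>))"
    unfolding q'_def using alpha_gt
    by (intro order_trans[OF abs_triangle_ineq] add_mono) (simp_all add: abs_mult power_abs mult_ac add_ac)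
  also have "\<dots> \<le> real j * ?B * 1 + (1 + \<alpha>) * ?B"
    using 1 2 alpha_gt by (intro add_mono mult_mono mult_left_mono) auto
  finally show ?thesis
    by (simp add: algebra_simps)
qed

lemma integrable_q':
  assumes j: "\<alpha> + 2 \<le> 2 * real j"
  shows "integrable lborel (\<lambda>s. indicat_real {0<..} s * q' s)"
proof (rule Bochner_Integration.integrable_bound)
  show "integrable lborel (\<lambda>s. (real j + 1 + \<alpha>) * (indicat_real {0<..1} s + indicat_real {1<..} s * s powr (- 1 - \<alpha>)))"
    using alpha_gt
    by (intro integrable_mult_right Bochner_Integration.integrable_add integrable_powr_at_top integrable_real_indicator) auto
  show "AE s in lborel. norm (indicat_real {0<..} s * q' s)
     \<le> norm ((real j + 1 + \<alpha>) * (indicat_real {0<..1} s + indicat_real {1<..} s * s powr (- 1 - \<alpha>)))"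
  proof (rule AE_I2)
    fix s
    show "norm (indicat_real {0<..} s * q' s)
     \<le> norm ((real j + 1 + \<alpha>) * (indicat_real {0<..1} s + indicat_real {1<..} s * s powr (- 1 - \<alpha>)))"
      using abs_q'_le[OF j, of s] alpha_gt by (cases "0 < s"; cases "s \<le> 1") (auto simp: abs_mult)
  qed
qed measurable

text \<open>Two integrations by parts; the boundary terms vanish because \<open>q(0+) = 0\<close> for \<open>2j \<ge> \<alpha> + 2\<close>.\<close>

lemma cos_transform_m:
  assumes j: "\<alpha> + 2 \<le> 2 * real j" and y: "y \<noteq> 0"
  shows "(LINT w|lborel. indicat_real {0<..} w * (m w * cos (y * w)))
       = (LINT w|lborel. indicat_real {0<..} w * (q' w * cos (y * w))) / (Q 0 * y\<^sup>2)"
proof -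
  \<comment> \<open>An antiderivative of \<open>?g\<close>: the derivative of \<open>m\<close> is -
    q / \<open>Q 0\<close>, so the sine terms produced by the two products cancel.\<close>
  let ?G = "\<lambda>w. m w * sin (y * w) / y - q w * cos (y * w) / (Q 0 * y\<^sup>2)"
  let ?g = "\<lambda>w. m w * cos (y * w) - q' w * cos (y * w) / (Q 0 * y\<^sup>2)"
  have i1: "integrable lborel (\<lambda>w. indicat_real {0<..} w * (m w * cos (y * w)))"
    by (rule Bochner_Integration.integrable_bound[OF integrable_m])
       (auto simp: indicator_def abs_mult intro!: mult_left_le)
  have i2: "integrable lborel (\<lambda>w. indicat_real {0<..} w * (q' w * cos (y * w)))"
    by (rule Bochner_Integration.integrable_bound[OF integrable_q'[OF j]])
       (auto simp: indicator_def abs_mult intro!: mult_left_le)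
  have i3: "integrable lborel (\<lambda>w. indicat_real {0<..} w * ?g w)"
    using Bochner_Integration.integrable_diff[OF i1 integrable_divide[OF i2, of "Q 0 * y\<^sup>2"]]
    by (simp add: right_diff_distrib)
  have "(LBINT w=ereal 0..\<infinity>. ?g w) = 0 - 0"
  proof (rule interval_integral_FTC_integrable)
    fix w assume "ereal 0 < ereal w"
    then have w: "0 < w" by simp
    show "(?G has_vector_derivative ?g w) (at w)"
      unfolding has_real_derivative_iff_has_vector_derivative[symmetric]
      using y Q0_pos w
      by (auto intro!: derivative_eq_intros DERIV_m DERIV_q) (simp add: field_simps power2_eq_square)
    show "isCont ?g w"
      unfolding q'_def using w y Q0_pos by (intro continuous_intros isCont_m) auto
  next
    show "set_integrable lborel (einterval (ereal 0) \<infinity>) ?g"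
      using i3 by (simp add: set_integrable_def)
    have "(q \<longlongrightarrow> 0) (at_right 0)"
    proof (rule tendsto_sandwich[OF _ _ tendsto_const])
      show "((\<lambda>s. s) \<longlongrightarrow> 0) (at_right (0::real))"
        by (rule tendsto_ident_at)
      show "\<forall>\<^sub>F s in at_right 0. q s \<le> s"
        using eventually_at_right_real[OF zero_less_one]
      proof eventually_elim
        case (elim s)
        have "s powr (2 * real j - 1 - \<alpha>) \<le> s powr 1"
          using elim j by (intro powr_mono') auto
        then show ?case
          using q_le_near_0[of s] elim by simp
      qed
    qed (simp add: q_nonneg)
    moreover have "(m \<longlongrightarrow> 1) (at_right 0)"
      using isCont_m[of 0] m_0 by (simp add: isCont_def filterlim_at_split)
    ultimately have "(?G \<longlongrightarrow> 1 * sin (y * 0) / y - 0 * cos (y * 0) / (Q 0 * y\<^sup>2)) (at_right 0)"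
      using y Q0_pos by (intro tendsto_intros) auto
    then show "((?G \<circ> real_of_ereal) \<longlongrightarrow> 0) (at_right (ereal 0))"
      by (simp add: ereal_tendsto_simps)
    have "(q \<longlongrightarrow> 0) at_top"
    proof (rule tendsto_sandwich[OF _ _ tendsto_const])
      show "((\<lambda>s. s powr (- (1 + \<alpha>))) \<longlongrightarrow> 0) at_top"
        using alpha_gt by (intro tendsto_neg_powr filterlim_ident) auto
    qed (intro always_eventually allI q_nonneg q_le_at_top)+
    then have q: "((\<lambda>w. q w * cos (y * w)) \<longlongrightarrow> 0) at_top"
      by (rule tendsto_0_mult_le_1) simp
    have "(m \<longlongrightarrow> 0) at_top"
    proof (rule tendsto_sandwich[OF _ _ tendsto_const])
      have "((\<lambda>s. s powr (- \<alpha>)) \<longlongrightarrow> 0) at_top"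
        using alpha_gt by (intro tendsto_neg_powr filterlim_ident) auto
      then have "((\<lambda>s. s powr (- \<alpha>) / \<alpha> / Q 0) \<longlongrightarrow> 0 / \<alpha> / Q 0) at_top"
        using alpha_gt Q0_pos by (intro tendsto_intros) auto
      then show "((\<lambda>s. s powr (- \<alpha>) / \<alpha> / Q 0) \<longlongrightarrow> 0) at_top" by simp
      show "\<forall>\<^sub>F w in at_top. m w \<le> w powr (- \<alpha>) / \<alpha> / Q 0"
        using eventually_gt_at_top[of "0::real"]
      proof eventually_elim
        case (elim w)
        then show ?case
          unfolding m_def using Q_le[of w] Q0_pos by (intro divide_right_mono) auto
      qed
    qed (simp add: m_nonneg)
    then have m: "((\<lambda>w. m w * sin (y * w)) \<longlongrightarrow> 0) at_top"
      by (rule tendsto_0_mult_le_1) simp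
    have "(?G \<longlongrightarrow> 0 / y - 0 / (Q 0 * y\<^sup>2)) at_top"
      using y Q0_pos by (intro tendsto_intros q m) auto
    then show "((?G \<circ> real_of_ereal) \<longlongrightarrow> 0) (at_left \<infinity>)"
      by (simp add: ereal_tendsto_simps)
  qed simp
  then have "(LINT w|lborel. indicat_real {0<..} w * ?g w) = 0"
    by (simp add: interval_integral_to_infinity_eq set_lebesgue_integral_def)
  then show ?thesis
    using Bochner_Integration.integral_diff[OF i1 integrable_divide[OF i2, of "Q 0 * y\<^sup>2"]]
    by (simp add: right_diff_distrib)
qed

lemma integrable_cm: "integrable lborel (\<lambda>w. complex_of_real (m w))"
  using integrable_m by simp

text \<open>\<open>m\<close> is even, so the sine part integrates to 0 and the transform is real and
  even in \<open>y\<close>. The passage to the open half-line matches the domain on which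
  \<open>m\<close> is differentiated.\<close>

lemma ft_m_eq: "ft (\<lambda>w. of_real (m w)) y = of_real (2 * (LINT w|lborel. indicat_real {0<..} w * (m w * cos (y * w))))"
proof -
  have i1: "integrable lborel (\<lambda>w. indicat_real {0..} w * (m w * cos (y * w)))"
    by (rule Bochner_Integration.integrable_bound[OF integrable_m])
       (auto simp: indicator_def abs_mult intro!: mult_left_le)
  have i2: "integrable lborel (\<lambda>w. indicat_real {0..} w * (m w * sin (y * w)))"
    by (rule Bochner_Integration.integrable_bound[OF integrable_m])
       (auto simp: indicator_def abs_mult intro!: mult_left_le)
  have c: "has_bochner_integral lborel (\<lambda>w. m w * cos (y * w)) (2 *\<^sub>R (LINT w|lborel. indicat_real {0..} w * (m w * cos (y * w))))"
    using i1 by (intro has_bochner_integral_even_function) (simp_all add: has_bochner_integral_iff m_even)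
  have s: "has_bochner_integral lborel (\<lambda>w. m w * sin (y * w)) 0"
    by (rule has_bochner_integral_odd_function[where x = "LINT w|lborel. indicat_real {0..} w * (m w * sin (y * w))"])
       (use i2 in \<open>simp_all add: has_bochner_integral_iff m_even\<close>)
  have "(LINT w|lborel. indicat_real {0..} w * (m w * cos (y * w))) = (LINT w|lborel. indicat_real {0<..} w * (m w * cos (y * w)))"
  proof (rule integral_cong_AE)
    show "AE w in lborel. indicat_real {0..} w * (m w * cos (y * w)) = indicat_real {0<..} w * (m w * cos (y * w))"
      using AE_lborel_singleton[of "0::real"] by eventually_elim (auto simp: indicator_def)
  qed auto
  moreover have "ft (\<lambda>w. of_real (m w)) y = (LINT w|lborel. complex_of_real (m w * cos (y * w)) - \<i> * complex_of_real (m w * sin (y * w)))"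
    unfolding ft_def by (intro Bochner_Integration.integral_cong) (auto simp: complex_eq_iff mult.commute)
  moreover have "\<dots> = (LINT w|lborel. complex_of_real (m w * cos (y * w))) - (LINT w|lborel. \<i> * complex_of_real (m w * sin (y * w)))"
    using c s by (intro Bochner_Integration.integral_diff integrable_mult_right integrable_of_real)
                 (auto simp: has_bochner_integral_iff simp del: of_real_mult)
  moreover have "\<dots> = of_real (LINT w|lborel. m w * cos (y * w)) - \<i> * of_real (LINT w|lborel. m w * sin (y * w))"
    by (simp only: integral_mult_right_zero integral_complex_of_real)
  ultimately show ?thesis
    using c s by (simp add: has_bochner_integral_iff)
qed

text \<open>The trivial bound by the L1 norm and the bound of y^2 times the transform, from the
  integrations by parts, are added; this yields one estimate for all \<open>y\<close> without
  separating small and large ones.\<close>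

lemma ft_m_decay:
  assumes j: "\<alpha> + 2 \<le> 2 * real j"
  shows "\<exists>C. \<forall>y. norm (ft (\<lambda>w. of_real (m w)) y) \<le> C / (1 + y\<^sup>2)"
proof -
  define K where "K = (LINT s|lborel. \<bar>indicat_real {0<..} s * q' s\<bar>)"
  define L where "L = (LINT w|lborel. norm (complex_of_real (m w)))"
  have "norm (ft (\<lambda>w. of_real (m w)) y) \<le> (L + 2 * K / Q 0) / (1 + y\<^sup>2)" for y
  proof -
    let ?n = "norm (ft (\<lambda>w. of_real (m w)) y)"
    have 1: "?n \<le> L"
      unfolding L_def by (rule norm_ft_le)
    have K: "0 \<le> K" unfolding K_def by simp
    have 2: "?n * y\<^sup>2 \<le> 2 * K / Q 0"
    proof (cases "y = 0")
      case False
      have "\<bar>LINT w|lborel. indicat_real {0<..} w * (q' w * cos (y * w))\<bar> \<le> K"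
        unfolding K_def
      proof (rule order_trans[OF integral_abs_bound], rule integral_mono)
        show "integrable lborel (\<lambda>w. \<bar>indicat_real {0<..} w * (q' w * cos (y * w))\<bar>)"
          by (rule Bochner_Integration.integrable_bound[OF integrable_q'[OF j]])
             (auto simp: indicator_def abs_mult intro!: mult_left_le)
        show "integrable lborel (\<lambda>s. \<bar>indicat_real {0<..} s * q' s\<bar>)"
          using integrable_q'[OF j] by (rule integrable_abs)
      qed (auto simp: indicator_def abs_mult intro!: mult_left_le)
      then show ?thesis
        unfolding ft_m_eq cos_transform_m[OF j False] norm_of_real using False Q0_pos
        by (simp add: abs_mult field_simps)
    qed (use Q0_pos K in simp)
    have "?n * (1 + y\<^sup>2) \<le> L + 2 * K / Q 0"
      using 1 2 by (simp add: distrib_left)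
    then show ?thesis
      by (simp add: pos_le_divide_eq add_pos_nonneg)
  qed
  then show ?thesis by blast
qed

text \<open>The substitution u = s / 2 contributes \<open>2 powr \<alpha>\<close>, which combines
  with 2^(2j - \<alpha>) to 4^j. The factor (-1)^j 4^j is also the (2i)^(2j) in the symbol of the
  central difference, so the normalisation in \<open>riesz_symbol\<close> comes out exact.\<close>

lemma riesz_const_eq: "riesz_const \<alpha> j = (-1) ^ j * 4 ^ j * Q 0"
proof -
  have "(LINT u:{0<..}|lebesgue. sin u ^ (2 * j) / u powr (1 + \<alpha>))
      = (LINT u|lborel. indicat_real {0<..} u * (sin u ^ (2 * j) / u powr (1 + \<alpha>)))"
    unfolding set_lebesgue_integral_def by (simp add: integral_completion)
  also have "\<dots> = \<bar>1/2\<bar> *\<^sub>R (LINT s|lborel. indicat_real {0<..} (0 + 1/2 * s) * (sin (0 + 1/2 * s) ^ (2 * j) / (0 + 1/2 * s) powr (1 + \<alpha>)))"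
    by (rule lborel_integral_real_affine) simp
  also have "(LINT s|lborel. indicat_real {0<..} (0 + 1/2 * s) * (sin (0 + 1/2 * s) ^ (2 * j) / (0 + 1/2 * s) powr (1 + \<alpha>)))
      = (LINT s|lborel. 2 powr (1 + \<alpha>) * (indicat_real {0<..} s * q s))"
    by (intro Bochner_Integration.integral_cong) (auto simp: indicator_def q_def powr_divide)
  also have "\<bar>1/2\<bar> *\<^sub>R \<dots> = 2 powr \<alpha> * Q 0"
    by (simp add: Q_def powr_add)
  finally have I: "(LINT u:{0<..}|lebesgue. sin u ^ (2 * j) / u powr (1 + \<alpha>)) = 2 powr \<alpha> * Q 0" .
  have "2 powr (2 * real j - \<alpha>) * 2 powr \<alpha> = (2::real) powr (real (2 * j))"
    by (simp add: powr_add[symmetric])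
  also have "\<dots> = 4 ^ j"
    by (subst powr_realpow) (auto simp: power_mult)
  finally show ?thesis
    unfolding riesz_const_def I by simp
qed

end

text \<open>An average over translates is a Fourier multiplier: f(x + a u) contributes the phase
  cis(a u v). No substitution in \<open>u\<close> is made, so \<open>a = 0\<close>, the central term
  of the difference, is covered.\<close>

lemma
  fixes \<kappa> f :: "real \<Rightarrow> complex"
  assumes \<kappa>: "integrable lborel \<kappa>" and f: "integrable lborel f"
  shows integrable_kernel_average: "integrable lborel (\<lambda>x. LINT u|lborel. \<kappa> u * f (x + a * u))"
    and ft_kernel_average: "ft (\<lambda>x. LINT u|lborel. \<kappa> u * f (x + a * u)) v = ft f v * (LINT u|lborel. \<kappa> u * cis (a * u * v))"
proof -
  have [measurable]: "\<kappa> \<in> borel_measurable borel" "f \<in> borel_measurable borel"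
    using \<kappa> f by (auto dest: borel_measurable_integrable)
  have fi: "integrable lborel (\<lambda>x. f (x + c))" for c
    using integrable_translate[OF f, of "-c"] by simp
  have int: "integrable (lborel \<Otimes>\<^sub>M lborel) (\<lambda>(u, x). \<kappa> u * f (x + a * u) * cis (- (x * v)))" for v
  proof (rule lborel_pair.Fubini_integrable)
    show "(\<lambda>(u, x). \<kappa> u * f (x + a * u) * cis (- (x * v))) \<in> borel_measurable (lborel \<Otimes>\<^sub>M lborel)"
      by measurable
    show "AE u in lborel. integrable lborel (\<lambda>x. case (u, x) of (u, x) \<Rightarrow> \<kappa> u * f (x + a * u) * cis (- (x * v)))"
      using fi by (intro AE_I2) (auto intro!: integrable_mult_cis)
    have "(LINT x|lborel. norm (\<kappa> u * f (x + a * u) * cis (- (x * v)))) = norm (\<kappa> u) * (LINT x|lborel. norm (f x))" for u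
      using integral_translate[of "\<lambda>x. norm (f x)" "- (a * u)"] by (simp add: norm_mult)
    then show "integrable lborel (\<lambda>u. LINT x|lborel. norm (case (u, x) of (u, x) \<Rightarrow> \<kappa> u * f (x + a * u) * cis (- (x * v))))"
      using \<kappa> by simp
  qed
  show "integrable lborel (\<lambda>x. LINT u|lborel. \<kappa> u * f (x + a * u))"
    using lborel_pair.integrable_snd[OF int[of 0]] by simp
  have "ft (\<lambda>x. LINT u|lborel. \<kappa> u * f (x + a * u)) v = (LINT x|lborel. LINT u|lborel. \<kappa> u * f (x + a * u) * cis (- (x * v)))"
    unfolding ft_def by simp
  also have "\<dots> = (LINT u|lborel. LINT x|lborel. \<kappa> u * f (x + a * u) * cis (- (x * v)))"
    by (rule lborel_pair.Fubini_integral[OF int])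
  also have "\<dots> = (LINT u|lborel. ft f v * (\<kappa> u * cis (a * u * v)))"
  proof (rule Bochner_Integration.integral_cong)
    fix u
    have "(LINT x|lborel. \<kappa> u * f (x + a * u) * cis (- (x * v)))
       = (LINT x|lborel. \<kappa> u * (f (x + a * u) * cis (- ((x + a * u) * v)) * cis (a * u * v)))"
      by (intro Bochner_Integration.integral_cong) (simp_all add: mult.assoc cis_mult, simp add: algebra_simps)
    also have "\<dots> = \<kappa> u * ((LINT x|lborel. f (x - - (a * u)) * cis (- ((x - - (a * u)) * v))) * cis (a * u * v))"
      by simp
    also have "(LINT x|lborel. f (x - - (a * u)) * cis (- ((x - - (a * u)) * v))) = ft f v"
      unfolding ft_def by (rule integral_translate)
    finally show "(LINT x|lborel. \<kappa> u * f (x + a * u) * cis (- (x * v))) = ft f v * (\<kappa> u * cis (a * u * v))"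
      by (simp add: mult_ac)
  qed simp
  also have "\<dots> = ft f v * (LINT u|lborel. \<kappa> u * cis (a * u * v))"
    by simp
  finally show "ft (\<lambda>x. LINT u|lborel. \<kappa> u * f (x + a * u)) v = ft f v * (LINT u|lborel. \<kappa> u * cis (a * u * v))" .
qed

text \<open>For bounded continuous \<open>f\<close> the averages exist at every \<open>x\<close> and
  are continuous in \<open>x\<close>, which the L1 statement alone cannot give; Fourier inversion is
  later applied pointwise to their combination.\<close>

lemma
  fixes \<kappa> f :: "real \<Rightarrow> complex"
  assumes \<kappa>: "integrable lborel \<kappa>" and cont: "continuous_on UNIV f" and bdd: "\<And>x. norm (f x) \<le> B"
  shows integrable_kernel_average_arg: "integrable lborel (\<lambda>u. \<kappa> u * f (x + a * u))"
    and norm_kernel_average_le: "norm (LINT u|lborel. \<kappa> u * f (x + a * u)) \<le> (LINT u|lborel. norm (\<kappa> u)) * B"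
    and continuous_on_kernel_average: "continuous_on UNIV (\<lambda>x. LINT u|lborel. \<kappa> u * f (x + a * u))"
proof -
  have [measurable]: "\<kappa> \<in> borel_measurable borel" "f \<in> borel_measurable borel"
    using \<kappa> cont by (auto dest: borel_measurable_integrable intro: borel_measurable_continuous_onI)
  have B: "0 \<le> B"
    using order_trans[OF norm_ge_zero bdd] .
  have dom: "integrable lborel (\<lambda>u. norm (\<kappa> u) * B)"
    using \<kappa> by simp
  have le: "norm (\<kappa> u * f (x + a * u)) \<le> norm (\<kappa> u) * B" for u x
    by (simp add: norm_mult mult_left_mono bdd)
  show i: "integrable lborel (\<lambda>u. \<kappa> u * f (x + a * u))" for x
    by (rule Bochner_Integration.integrable_bound[OF dom])
       (use le B in \<open>auto simp: abs_mult\<close>)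
  have "norm (LINT u|lborel. \<kappa> u * f (x + a * u)) \<le> (LINT u|lborel. norm (\<kappa> u * f (x + a * u)))"
    by (rule integral_norm_bound)
  also have "\<dots> \<le> (LINT u|lborel. norm (\<kappa> u) * B)"
    by (rule integral_mono[OF integrable_norm[OF i] dom le])
  finally show "norm (LINT u|lborel. \<kappa> u * f (x + a * u)) \<le> (LINT u|lborel. norm (\<kappa> u)) * B"
    by simp
  have "isCont (\<lambda>x. LINT u|lborel. \<kappa> u * f (x + a * u)) x" for x
    unfolding continuous_at_sequentially comp_def
  proof (intro allI impI)
    fix X assume X: "X \<longlonglongrightarrow> x"
    show "(\<lambda>n. LINT u|lborel. \<kappa> u * f (X n + a * u)) \<longlonglongrightarrow> (LINT u|lborel. \<kappa> u * f (x + a * u))"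
    proof (rule integral_dominated_convergence[OF _ _ dom])
      show "AE u in lborel. (\<lambda>n. \<kappa> u * f (X n + a * u)) \<longlonglongrightarrow> \<kappa> u * f (x + a * u)"
      proof (rule AE_I2)
        fix u
        have "isCont f (x + a * u)"
          using cont by (simp add: continuous_on_eq_continuous_at)
        then have "(\<lambda>n. f (X n + a * u)) \<longlonglongrightarrow> f (x + a * u)"
          by (rule isCont_tendsto_compose) (intro tendsto_intros X)
        then show "(\<lambda>n. \<kappa> u * f (X n + a * u)) \<longlonglongrightarrow> \<kappa> u * f (x + a * u)"
          by (intro tendsto_intros)
      qed
    qed (use le in auto)
  qed
  then show "continuous_on UNIV (\<lambda>x. LINT u|lborel. \<kappa> u * f (x + a * u))"
    by (simp add: continuous_at_imp_continuous_on)
qed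

text \<open>Binomial expansion of (cis(t/2) - cis(-t/2))^(2j) = (2i sin(t/2))^(2j).\<close>

lemma central_diff_symbol:
  "(\<Sum>k\<le>2 * j. (-1) ^ k * of_nat ((2 * j) choose k) * cis ((real j - real k) * t))
     = of_real ((-1) ^ j * 4 ^ j * sin (t / 2) ^ (2 * j))"
proof -
  have "(- cis (- (t / 2)) + cis (t / 2)) ^ (2 * j)
     = (\<Sum>k\<le>2 * j. of_nat ((2 * j) choose k) * (- cis (- (t / 2))) ^ k * cis (t / 2) ^ (2 * j - k))"
    by (rule binomial_ring)
  also have "\<dots> = (\<Sum>k\<le>2 * j. (-1) ^ k * of_nat ((2 * j) choose k) * cis ((real j - real k) * t))"
  proof (rule sum.cong)
    fix k assume "k \<in> {..2 * j}"
    then have "k \<le> 2 * j" by simp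
    then have arg: "real k * - (t / 2) + real (2 * j - k) * (t / 2) = (real j - real k) * t"
      by (simp add: of_nat_diff field_simps)
    have "cis (- (t / 2)) ^ k * cis (t / 2) ^ (2 * j - k) = cis ((real j - real k) * t)"
      by (simp only: Complex.DeMoivre cis_mult arg)
    then show "of_nat ((2 * j) choose k) * (- cis (- (t / 2))) ^ k * cis (t / 2) ^ (2 * j - k)
       = (-1) ^ k * of_nat ((2 * j) choose k) * cis ((real j - real k) * t)"
      by (simp add: power_minus[of "cis (- (t / 2))"] mult_ac)
  qed simp
  also have "- cis (- (t / 2)) + cis (t / 2) = 2 * \<i> * of_real (sin (t / 2))"
    by (simp add: complex_eq_iff)
  also have "(2 * \<i> * of_real (sin (t / 2))) ^ (2 * j) = of_real ((-1) ^ j * 4 ^ j * sin (t / 2) ^ (2 * j))"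
  proof -
    have "(2 * \<i> * of_real (sin (t / 2))) ^ 2 = complex_of_real (-1 * 4 * sin (t / 2) ^ 2)"
      by (simp add: power_mult_distrib)
    then show ?thesis
      unfolding power_mult by (simp only: of_real_power[symmetric] power_mult_distrib)
  qed
  finally show ?thesis ..
qed

section \<open>The truncated Riesz integral as a Fourier multiplier\<close>

context riesz_kernel
begin

definition \<kappa> :: "real \<Rightarrow> real \<Rightarrow> complex" where
  "\<kappa> \<epsilon> u = of_real (indicat_real {\<epsilon><..} u * u powr (- (1 + \<alpha>)))"

lemma integrable_\<kappa>: "\<epsilon> > 0 \<Longrightarrow> integrable lborel (\<kappa> \<epsilon>)"
  unfolding \<kappa>_def using alpha_gt
  by (intro integrable_of_real integrable_powr_at_top) auto

lemma truncated_riesz_eq: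
  assumes \<epsilon>: "\<epsilon> > 0" and cont: "continuous_on UNIV f" and bdd: "\<And>x. norm (f x) \<le> B"
  shows "truncated_riesz \<alpha> j \<epsilon> f x = of_real (1 / riesz_const \<alpha> j) *
    (\<Sum>k\<le>2 * j. (-1) ^ k * of_nat ((2 * j) choose k) * (LINT u|lborel. \<kappa> \<epsilon> u * f (x + (real j - real k) * u)))"
proof -
  have [measurable]: "f \<in> borel_measurable borel"
    using cont by (rule borel_measurable_continuous_onI)
  have "(LINT u:{\<epsilon><..}|lebesgue. central_diff j u f x / complex_of_real (u powr (1 + \<alpha>)))
     = (LINT u|lborel. indicat_real {\<epsilon><..} u *\<^sub>R (central_diff j u f x / complex_of_real (u powr (1 + \<alpha>))))"
    unfolding set_lebesgue_integral_def central_diff_def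
    by (rule integral_completion) measurable
  also have "\<dots> = (LINT u|lborel. (\<Sum>k\<le>2 * j. (-1) ^ k * of_nat ((2 * j) choose k) * (\<kappa> \<epsilon> u * f (x + (real j - real k) * u))))"
  proof (rule Bochner_Integration.integral_cong)
    fix u
    have "indicat_real {\<epsilon><..} u *\<^sub>R (central_diff j u f x / complex_of_real (u powr (1 + \<alpha>))) = \<kappa> \<epsilon> u * central_diff j u f x"
      unfolding \<kappa>_def powr_minus by (simp add: scaleR_conv_of_real divide_inverse mult_ac)
    then show "indicat_real {\<epsilon><..} u *\<^sub>R (central_diff j u f x / complex_of_real (u powr (1 + \<alpha>)))
        = (\<Sum>k\<le>2 * j. (-1) ^ k * of_nat ((2 * j) choose k) * (\<kappa> \<epsilon> u * f (x + (real j - real k) * u)))"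
      by (simp add: central_diff_def sum_distrib_left mult_ac)
  qed simp
  also have "\<dots> = (\<Sum>k\<le>2 * j. (-1) ^ k * of_nat ((2 * j) choose k) * (LINT u|lborel. \<kappa> \<epsilon> u * f (x + (real j - real k) * u)))"
    using integrable_kernel_average_arg[OF integrable_\<kappa>[OF \<epsilon>] cont bdd]
    by (subst Bochner_Integration.integral_sum) auto
  finally show ?thesis
    unfolding truncated_riesz_def by simp
qed

text \<open>Summed under the integral, the phases give the sine power of the central difference; s =
  |v| u then turns the integral into |v|^\<alpha> Q(\<epsilon> v), so the truncation enters only
  through the argument of \<open>m\<close>.\<close>

lemma riesz_symbol:
  assumes \<epsilon>: "\<epsilon> > 0"
  shows "(\<Sum>k\<le>2 * j. (-1) ^ k * of_nat ((2 * j) choose k) * (LINT u|lborel. \<kappa> \<epsilon> u * cis ((real j - real k) * u * v)))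
      = of_real (riesz_const \<alpha> j * (\<bar>v\<bar> powr \<alpha> * m (\<epsilon> * v)))"
proof -
  \<comment> \<open>At v = 0 the right side vanishes since \<open>0 powr \<alpha> = 0\<close>; the
    left side then needs \<open>sin 0 ^ (2 * j) = 0\<close>, hence a positive
    \<open>j\<close>.\<close>
  have j0: "0 < j"
    using alpha_gt alpha_lt by (cases j) auto
  have i: "integrable lborel (\<lambda>u. \<kappa> \<epsilon> u * cis ((real j - real k) * u * v))" for k
    using integrable_\<kappa>[OF \<epsilon>] by (intro integrable_mult_cis) auto
  have "(\<Sum>k\<le>2 * j. (-1) ^ k * of_nat ((2 * j) choose k) * (LINT u|lborel. \<kappa> \<epsilon> u * cis ((real j - real k) * u * v)))
     = (LINT u|lborel. (\<Sum>k\<le>2 * j. (-1) ^ k * of_nat ((2 * j) choose k) * (\<kappa> \<epsilon> u * cis ((real j - real k) * u * v))))"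
    using i by (subst Bochner_Integration.integral_sum) auto
  also have "\<dots> = (LINT u|lborel. \<kappa> \<epsilon> u * (\<Sum>k\<le>2 * j. (-1) ^ k * of_nat ((2 * j) choose k) * cis ((real j - real k) * (u * v))))"
    by (simp add: sum_distrib_left mult_ac)
  also have "\<dots> = (LINT u|lborel. of_real ((-1) ^ j * 4 ^ j * (indicat_real {\<epsilon><..} u * u powr (- (1 + \<alpha>)) * sin (u * v / 2) ^ (2 * j))))"
    unfolding central_diff_symbol \<kappa>_def by (simp add: mult_ac)
  also have "\<dots> = of_real ((-1) ^ j * 4 ^ j * (LINT u|lborel. indicat_real {\<epsilon><..} u * u powr (- (1 + \<alpha>)) * sin (u * v / 2) ^ (2 * j)))"
    by (simp only: integral_complex_of_real integral_mult_right_zero)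
  also have "(LINT u|lborel. indicat_real {\<epsilon><..} u * u powr (- (1 + \<alpha>)) * sin (u * v / 2) ^ (2 * j)) = \<bar>v\<bar> powr \<alpha> * Q (\<epsilon> * v)"
  proof (cases "v = 0")
    case True
    then show ?thesis using j0 by simp
  next
    case False
    have "Q (\<epsilon> * v) = \<bar>\<bar>v\<bar>\<bar> *\<^sub>R (LINT u|lborel. indicat_real {\<bar>\<epsilon> * v\<bar><..} (0 + \<bar>v\<bar> * u) * q (0 + \<bar>v\<bar> * u))"
      unfolding Q_def using False by (intro lborel_integral_real_affine) auto
    then have "\<bar>v\<bar> powr \<alpha> * Q (\<epsilon> * v) = (LINT u|lborel. \<bar>v\<bar> powr (1 + \<alpha>) * (indicat_real {\<bar>\<epsilon> * v\<bar><..} (\<bar>v\<bar> * u) * q (\<bar>v\<bar> * u)))"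
      using False by (simp add: powr_add)
    also have "\<dots> = (LINT u|lborel. indicat_real {\<epsilon><..} u * u powr (- (1 + \<alpha>)) * sin (u * v / 2) ^ (2 * j))"
    proof (rule Bochner_Integration.integral_cong)
      fix u
      have ind: "indicat_real {\<bar>\<epsilon> * v\<bar><..} (\<bar>v\<bar> * u) = indicat_real {\<epsilon><..} u"
        using \<epsilon> False by (simp add: indicator_def abs_mult mult.commute)
      have sin: "sin (\<bar>v\<bar> * u / 2) ^ (2 * j) = sin (u * v / 2) ^ (2 * j)"
        by (cases "0 \<le> v") (simp_all add: abs_if mult.commute)
      show "\<bar>v\<bar> powr (1 + \<alpha>) * (indicat_real {\<bar>\<epsilon> * v\<bar><..} (\<bar>v\<bar> * u) * q (\<bar>v\<bar> * u))
          = indicat_real {\<epsilon><..} u * u powr (- (1 + \<alpha>)) * sin (u * v / 2) ^ (2 * j)"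
      proof (cases "\<epsilon> < u")
        case True
        have "(\<bar>v\<bar> * u) powr (1 + \<alpha>) = \<bar>v\<bar> powr (1 + \<alpha>) * u powr (1 + \<alpha>)"
          by (rule powr_mult)
        then show ?thesis
          unfolding ind q_def sin powr_minus using False True \<epsilon> by (simp add: field_simps)
      qed (simp add: ind)
    qed simp
    finally show ?thesis ..
  qed
  also have "(-1) ^ j * 4 ^ j * (\<bar>v\<bar> powr \<alpha> * Q (\<epsilon> * v)) = riesz_const \<alpha> j * (\<bar>v\<bar> powr \<alpha> * m (\<epsilon> * v))"
    using Q0_pos by (simp add: riesz_const_eq m_def)
  finally show ?thesis .
qed

lemma riesz_const_nz: "riesz_const \<alpha> j \<noteq> 0"
  using Q0_pos by (simp add: riesz_const_eq)

context
  fixes f :: "real \<Rightarrow> complex" and B :: real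
  assumes f: "integrable lborel f" and cont: "continuous_on UNIV f" and bdd: "\<And>x. norm (f x) \<le> B"
begin

lemma truncated_riesz_ext:
  "\<epsilon> > 0 \<Longrightarrow> truncated_riesz \<alpha> j \<epsilon> f = (\<lambda>x. of_real (1 / riesz_const \<alpha> j) *
    (\<Sum>k\<le>2 * j. (-1) ^ k * of_nat ((2 * j) choose k) * (LINT u|lborel. \<kappa> \<epsilon> u * f (x + (real j - real k) * u))))"
  by (intro ext truncated_riesz_eq[OF _ cont bdd])

lemma integrable_truncated_riesz: "\<epsilon> > 0 \<Longrightarrow> integrable lborel (truncated_riesz \<alpha> j \<epsilon> f)"
  by (simp only: truncated_riesz_ext)
     (intro integrable_mult_right Bochner_Integration.integrable_sum integrable_kernel_average integrable_\<kappa> f)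

lemma continuous_on_truncated_riesz: "\<epsilon> > 0 \<Longrightarrow> continuous_on UNIV (truncated_riesz \<alpha> j \<epsilon> f)"
  by (simp only: truncated_riesz_ext)
     (intro continuous_intros continuous_on_kernel_average[OF _ cont bdd] integrable_\<kappa>)

lemma bounded_truncated_riesz: "\<epsilon> > 0 \<Longrightarrow> \<exists>B'. \<forall>x. norm (truncated_riesz \<alpha> j \<epsilon> f x) \<le> B'"
proof (intro exI allI)
  fix x assume \<epsilon>: "\<epsilon> > 0"
  show "norm (truncated_riesz \<alpha> j \<epsilon> f x) \<le> norm (complex_of_real (1 / riesz_const \<alpha> j)) *
     (\<Sum>k\<le>2 * j. norm ((-1) ^ k * of_nat ((2 * j) choose k) :: complex) * ((LINT u|lborel. norm (\<kappa> \<epsilon> u)) * B))"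
    unfolding truncated_riesz_eq[OF \<epsilon> cont bdd] norm_mult[of "complex_of_real (1 / riesz_const \<alpha> j)"]
  proof (intro mult_left_mono sum_norm_le norm_ge_zero)
    fix k
    show "norm ((-1) ^ k * of_nat ((2 * j) choose k) * (LINT u|lborel. \<kappa> \<epsilon> u * f (x + (real j - real k) * u)))
       \<le> norm ((-1) ^ k * of_nat ((2 * j) choose k) :: complex) * ((LINT u|lborel. norm (\<kappa> \<epsilon> u)) * B)"
      unfolding norm_mult[of "(-1) ^ k * of_nat ((2 * j) choose k)"]
      by (intro mult_left_mono norm_kernel_average_le[OF integrable_\<kappa>[OF \<epsilon>] cont bdd] norm_ge_zero)
  qed
qed

lemma ft_truncated_riesz:
  assumes \<epsilon>: "\<epsilon> > 0"
  shows "ft (truncated_riesz \<alpha> j \<epsilon> f) v = of_real (\<bar>v\<bar> powr \<alpha> * m (\<epsilon> * v)) * ft f v"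
proof -
  let ?E = "\<lambda>k x. LINT u|lborel. \<kappa> \<epsilon> u * f (x + (real j - real k) * u)"
  let ?c = "\<lambda>k. (-1) ^ k * of_nat ((2 * j) choose k) :: complex"
  note E = integrable_kernel_average[OF integrable_\<kappa>[OF \<epsilon>] f] ft_kernel_average[OF integrable_\<kappa>[OF \<epsilon>] f]
  have "ft (truncated_riesz \<alpha> j \<epsilon> f) v = (LINT x|lborel. of_real (1 / riesz_const \<alpha> j) * (\<Sum>k\<le>2 * j. ?c k * (?E k x * cis (- (x * v)))))"
    unfolding ft_def truncated_riesz_eq[OF \<epsilon> cont bdd] by (simp add: sum_distrib_left sum_distrib_right mult_ac)
  also have "\<dots> = of_real (1 / riesz_const \<alpha> j) * (\<Sum>k\<le>2 * j. ?c k * ft (?E k) v)"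
  proof -
    have "integrable lborel (\<lambda>x. ?E k x * cis (- (x * v)))" for k
      by (rule integrable_mult_cis[OF E(1)]) simp
    then show ?thesis
      unfolding ft_def by (subst integral_mult_right_zero, subst Bochner_Integration.integral_sum) auto
  qed
  also have "\<dots> = of_real (1 / riesz_const \<alpha> j) * ft f v * (\<Sum>k\<le>2 * j. ?c k * (LINT u|lborel. \<kappa> \<epsilon> u * cis ((real j - real k) * u * v)))"
    unfolding E(2) by (simp add: sum_distrib_left mult_ac)
  also have "\<dots> = of_real (1 / riesz_const \<alpha> j) * ft f v * of_real (riesz_const \<alpha> j * (\<bar>v\<bar> powr \<alpha> * m (\<epsilon> * v)))"
    by (simp only: riesz_symbol[OF \<epsilon>])
  also have "\<dots> = of_real (\<bar>v\<bar> powr \<alpha> * m (\<epsilon> * v)) * ft f v"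
    using riesz_const_nz by (simp add: field_simps)
  finally show ?thesis .
qed

end

end

subsection \<open>Existence and Fourier transform of the strong Riesz derivative\<close>

lemma fourier_eq:
  "fourier G v = of_real (1 / sqrt (2 * pi)) * (LINT u|lebesgue. G u * cis (- (u * v)))"
  by (simp add: fourier_def cis_conv_exp)

lemma fourier_eq_ft:
  assumes [measurable]: "f \<in> borel_measurable borel"
  shows "fourier f v = of_real (1 / sqrt (2 * pi)) * ft f v"
  unfolding fourier_eq ft_def by (subst integral_completion) auto

lemma integrable_lebesgue:
  fixes f :: "real \<Rightarrow> complex"
  assumes "integrable lborel f"
  shows "integrable lebesgue f"
  using assms borel_measurable_integrable[OF assms] by (subst integrable_completion) auto

lemma L1_norm_eq:
  assumes "f \<in> borel_measurable borel"
  shows "L1_norm f = (LINT x|lborel. norm (f x))"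
  unfolding L1_norm_def using assms by (subst integral_completion) auto

lemma norm_integral_cis_le:
  assumes "integrable lebesgue G"
  shows "norm (LINT u|lebesgue. G u * cis (- (u * v))) \<le> L1_norm G"
  unfolding L1_norm_def by (rule order_trans[OF integral_norm_bound]) (simp add: norm_mult)

lemma integrable_lebesgue_cis:
  assumes "integrable lebesgue G"
  shows "integrable lebesgue (\<lambda>u. G u * cis (- (u * v)))"
  using assms by (rule integrable_mult_cis) (rule measurable_completion, measurable)

text \<open>L1 convergence carries over to the transforms at each \<open>v\<close>, and the
  multiplier tends to |v|^\<alpha> m(0). Of the \<open>j\<close> in the definition only
  \<open>\<alpha> < 2 * real j\<close> is known, so the argument rests on continuity of
  \<open>m\<close> at 0 and not on decay of its transform.\<close>

lemma fourier_strong_riesz_deriv: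
  assumes \<alpha>: "1 < \<alpha>" and f: "integrable lborel f" and cont: "continuous_on UNIV f" and bdd: "\<And>x. norm (f x) \<le> B"
    and G: "has_strong_riesz_deriv \<alpha> f G"
  shows "fourier G v = of_real (\<bar>v\<bar> powr \<alpha>) * fourier f v"
proof -
  obtain j where j: "\<alpha> < 2 * real j"
    and lim: "((\<lambda>\<epsilon>. L1_norm (\<lambda>x. truncated_riesz \<alpha> j \<epsilon> f x - G x)) \<longlongrightarrow> 0) (at_right 0)"
    and G1: "integrable lebesgue G"
    using G by (auto simp: has_strong_riesz_deriv_def L1_def)
  interpret riesz_kernel \<alpha> j
    using \<alpha> j by unfold_locales
  define I where "I = (LINT u|lebesgue. G u * cis (- (u * v)))"
  have [measurable]: "f \<in> borel_measurable borel"
    using cont by (rule borel_measurable_continuous_onI)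
  have "norm (ft (truncated_riesz \<alpha> j \<epsilon> f) v - I) \<le> L1_norm (\<lambda>x. truncated_riesz \<alpha> j \<epsilon> f x - G x)" if "\<epsilon> > 0" for \<epsilon>
  proof -
    let ?T = "truncated_riesz \<alpha> j \<epsilon> f"
    have T: "integrable lborel ?T"
      by (rule integrable_truncated_riesz[OF f cont bdd that])
    have [measurable]: "?T \<in> borel_measurable borel"
      using T by (auto dest: borel_measurable_integrable)
    note TL = integrable_lebesgue[OF T]
    have "ft ?T v = (LINT u|lebesgue. ?T u * cis (- (u * v)))"
      unfolding ft_def by (rule integral_completion[symmetric]) measurable
    then have "ft ?T v - I = (LINT u|lebesgue. (?T u - G u) * cis (- (u * v)))"
      using integrable_lebesgue_cis[OF TL] integrable_lebesgue_cis[OF G1]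
      by (simp add: I_def left_diff_distrib)
    also have "norm \<dots> \<le> L1_norm (\<lambda>x. ?T x - G x)"
      using TL G1 by (intro norm_integral_cis_le Bochner_Integration.integrable_diff)
    finally show ?thesis .
  qed
  then have "\<forall>\<^sub>F \<epsilon> in at_right 0. norm (ft (truncated_riesz \<alpha> j \<epsilon> f) v - I) \<le> L1_norm (\<lambda>x. truncated_riesz \<alpha> j \<epsilon> f x - G x)"
    by (intro eventually_at_rightI[of 0 1]) auto
  then have "((\<lambda>\<epsilon>. ft (truncated_riesz \<alpha> j \<epsilon> f) v - I) \<longlongrightarrow> 0) (at_right 0)"
    by (rule Lim_null_comparison[OF _ lim])
  then have lim1: "((\<lambda>\<epsilon>. ft (truncated_riesz \<alpha> j \<epsilon> f) v) \<longlongrightarrow> I) (at_right 0)"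
    by (rule LIM_zero_cancel)
  have "((\<lambda>\<epsilon>. m (\<epsilon> * v)) \<longlongrightarrow> m (0 * v)) (at_right 0)"
    by (rule isCont_tendsto_compose[OF isCont_m]) (intro tendsto_intros)
  then have "((\<lambda>\<epsilon>. of_real (\<bar>v\<bar> powr \<alpha> * m (\<epsilon> * v)) * ft f v) \<longlongrightarrow> of_real (\<bar>v\<bar> powr \<alpha> * m (0 * v)) * ft f v) (at_right 0)"
    by (intro tendsto_intros)
  moreover have "\<forall>\<^sub>F \<epsilon> in at_right 0. of_real (\<bar>v\<bar> powr \<alpha> * m (\<epsilon> * v)) * ft f v = ft (truncated_riesz \<alpha> j \<epsilon> f) v"
    by (intro eventually_at_rightI[of 0 1]) (auto simp: ft_truncated_riesz[OF f cont bdd])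
  ultimately have "((\<lambda>\<epsilon>. ft (truncated_riesz \<alpha> j \<epsilon> f) v) \<longlongrightarrow> of_real (\<bar>v\<bar> powr \<alpha> * m (0 * v)) * ft f v) (at_right 0)"
    by (rule Lim_transform_eventually)
  from tendsto_unique[OF _ lim1 this] have "I = of_real (\<bar>v\<bar> powr \<alpha>) * ft f v"
    by (simp add: m_0)
  then show ?thesis
    unfolding fourier_eq[of G] fourier_eq_ft[OF \<open>f \<in> borel_measurable borel\<close>] I_def by (simp add: mult_ac)
qed

lemma L1_translate_diff_le:
  fixes g :: "real \<Rightarrow> complex"
  assumes g: "integrable lborel g"
  shows "(LINT x|lborel. norm (g (x - s) - g x)) \<le> 2 * (LINT x|lborel. norm (g x))"
proof -
  have "(LINT x|lborel. norm (g (x - s) - g x)) \<le> (LINT x|lborel. norm (g (x - s)) + norm (g x))"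
    using integrable_translate[OF g, of s] g by (intro integral_mono norm_triangle_ineq4) auto
  also have "\<dots> = 2 * (LINT x|lborel. norm (g x))"
    using integrable_translate[OF g, of s] g integral_translate[of "\<lambda>x. norm (g x)" s] by simp
  finally show ?thesis .
qed

lemma integrable_inverse_1_plus_square: "integrable lborel (\<lambda>x. C / (1 + (x::real)\<^sup>2))"
proof (rule Bochner_Integration.integrable_bound)
  show "integrable lborel (\<lambda>x. \<bar>C\<bar> * (indicat_real {-1..1} x + indicat_real {w. 1 < \<bar>w\<bar>} x * \<bar>x\<bar> powr (- 2)))"
    by (intro integrable_mult_right Bochner_Integration.integrable_add integrable_powr_reflect integrable_real_indicator) auto
  show "AE x in lborel. norm (C / (1 + x\<^sup>2)) \<le> norm (\<bar>C\<bar> * (indicat_real {-1..1} x + indicat_real {w. 1 < \<bar>w\<bar>} x * \<bar>x\<bar> powr (- 2)))"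
  proof (rule AE_I2)
    fix x :: real
    have p: "0 < 1 + x\<^sup>2" by (simp add: add_pos_nonneg)
    have "1 / (1 + x\<^sup>2) \<le> indicat_real {-1..1} x + indicat_real {w. 1 < \<bar>w\<bar>} x * \<bar>x\<bar> powr (- 2)"
    proof (cases "\<bar>x\<bar> \<le> 1")
      case True
      then show ?thesis using p by (auto simp: indicator_def abs_le_iff)
    next
      case False
      then have "\<bar>x\<bar> powr (- 2) = 1 / x\<^sup>2"
        using powr_realpow[of "\<bar>x\<bar>" 2] by (simp add: powr_minus divide_inverse)
      then show ?thesis
        using False p by (auto simp: indicator_def frac_le)
    qed
    then have "\<bar>C\<bar> * (1 / (1 + x\<^sup>2)) \<le> \<bar>C\<bar> * (indicat_real {-1..1} x + indicat_real {w. 1 < \<bar>w\<bar>} x * \<bar>x\<bar> powr (- 2))"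
      by (rule mult_left_mono) simp
    then show "norm (C / (1 + x\<^sup>2)) \<le> norm (\<bar>C\<bar> * (indicat_real {-1..1} x + indicat_real {w. 1 < \<bar>w\<bar>} x * \<bar>x\<bar> powr (- 2)))"
      using p by (simp add: abs_mult)
  qed
qed measurable

section \<open>The truncated integral as a convolution with an approximate identity\<close>

context riesz_kernel
begin

text \<open>Scaled by \<epsilon> and divided by 2 pi this is the approximate identity;
  \<open>ft\<close> is unnormalised, hence the factors 2 pi below.\<close>

definition X :: "real \<Rightarrow> complex" where
  "X = ft (\<lambda>w. of_real (m w))"

lemma X_even: "X (- t) = X t"
  by (simp add: X_def ft_m_eq)

lemma X_measurable [measurable]: "X \<in> borel_measurable borel"
  unfolding X_def by measurable

lemma X_bounded: "norm (X t) \<le> (LINT w|lborel. m w)"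
  unfolding X_def by (rule order_trans[OF norm_ft_le]) (simp add: m_nonneg)

lemma integrable_X:
  assumes "\<alpha> + 2 \<le> 2 * real j"
  shows "integrable lborel X"
proof -
  obtain C where "\<And>y. norm (X y) \<le> C / (1 + y\<^sup>2)"
    using ft_m_decay[OF assms] unfolding X_def by blast
  then have "norm (X y) \<le> norm (C / (1 + y\<^sup>2))" for y
    by (metis abs_ge_self order_trans real_norm_def)
  then show ?thesis
    by (intro Bochner_Integration.integrable_bound[OF integrable_inverse_1_plus_square] AE_I2) auto
qed

text \<open>Inversion for \<open>m\<close> at the point 0, where m(0) = 1; integrability of its
  transform is what licenses it.\<close>

lemma integral_X:
  assumes "\<alpha> + 2 \<le> 2 * real j"
  shows "(LINT t|lborel. X t) = of_real (2 * pi)"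
proof -
  have "(LINT v|lborel. ft (\<lambda>w. of_real (m w)) v * cis (v * 0)) = of_real (2 * pi) * of_real (m 0)"
  proof (rule ft_inversion[OF integrable_cm])
    show "continuous_on UNIV (\<lambda>w. complex_of_real (m w))"
      by (intro continuous_intros continuous_at_imp_continuous_on ballI isCont_m)
    show "norm (complex_of_real (m w)) \<le> 1" for w
      using m_nonneg m_le_1 by simp
    show "integrable lborel (ft (\<lambda>w. complex_of_real (m w)))"
      using integrable_X[OF assms] by (simp add: X_def)
  qed
  then show ?thesis
    by (simp add: X_def m_0)
qed

context
  fixes f g :: "real \<Rightarrow> complex" and B :: real
  assumes j: "\<alpha> + 2 \<le> 2 * real j"
    and f: "integrable lborel f" and cont: "continuous_on UNIV f" and bdd: "\<And>x. norm (f x) \<le> B"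
    and g: "integrable lborel g" and gf: "\<And>v. ft g v = of_real (\<bar>v\<bar> powr \<alpha>) * ft f v"
begin

text \<open>The transform of the truncated integral is m(\<epsilon> v) times that of
  \<open>g\<close>, integrable because \<open>m\<close> is and the transform of \<open>g\<close> is
  bounded. Inversion followed by Fubini moves the phase onto \<open>m\<close>, whose scaled
  transform is \<open>X\<close>. As the truncated integral is continuous, the identity holds at
  every \<open>x\<close>.\<close>

lemma truncated_riesz_conv:
  assumes \<epsilon>: "\<epsilon> > 0"
  shows "of_real (2 * pi) * truncated_riesz \<alpha> j \<epsilon> f x = (LINT t|lborel. g (x - \<epsilon> * t) * X t)"
proof -
  let ?T = "truncated_riesz \<alpha> j \<epsilon> f"
  have [measurable]: "g \<in> borel_measurable borel"
    using g by (auto dest: borel_measurable_integrable)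
  have ftT: "ft ?T v = of_real (m (\<epsilon> * v)) * ft g v" for v
    by (simp add: ft_truncated_riesz[OF f cont bdd \<epsilon>] gf)
  have me: "integrable lborel (\<lambda>v. complex_of_real (m (\<epsilon> * v)))"
    using lborel_integrable_real_affine[OF integrable_cm, of \<epsilon> 0] \<epsilon> by simp
  have iT: "integrable lborel (ft ?T)"
  proof (rule Bochner_Integration.integrable_bound)
    show "integrable lborel (\<lambda>v. norm (complex_of_real (m (\<epsilon> * v))) * (LINT u|lborel. norm (g u)))"
      using me by (intro integrable_mult_left integrable_norm)
    show "AE v in lborel. norm (ft ?T v) \<le> norm (norm (complex_of_real (m (\<epsilon> * v))) * (LINT u|lborel. norm (g u)))"
      unfolding ftT norm_mult by (intro AE_I2 mult_mono) (auto intro!: order_trans[OF norm_ft_le])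
  qed (simp add: ftT[abs_def])
  obtain B' where B': "\<And>x. norm (?T x) \<le> B'"
    using bounded_truncated_riesz[OF f cont bdd \<epsilon>] by blast
  have "of_real (2 * pi) * ?T x = (LINT v|lborel. ft ?T v * cis (v * x))"
    by (rule ft_inversion[symmetric, OF _ _ B' iT])
       (auto intro: integrable_truncated_riesz[OF f cont bdd \<epsilon>] continuous_on_truncated_riesz[OF f cont bdd \<epsilon>])
  also have "\<dots> = (LINT v|lborel. (of_real (m (\<epsilon> * v)) * cis (v * x)) * (LINT u|lborel. g u * cis (- (u * v))))"
    unfolding ftT by (simp add: ft_def mult_ac)
  also have "\<dots> = (LINT u|lborel. g u * (LINT v|lborel. (of_real (m (\<epsilon> * v)) * cis (v * x)) * cis (- (u * v))))"
    by (rule Fubini_bounded_kernel[where B = 1]) (auto intro: integrable_mult_cis me g)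
  also have "\<dots> = (LINT u|lborel. g u * (of_real (1 / \<epsilon>) * X ((u - x) / \<epsilon>)))"
  proof (rule Bochner_Integration.integral_cong)
    fix u
    have "X ((u - x) / \<epsilon>) = \<bar>\<epsilon>\<bar> *\<^sub>R (LINT v|lborel. of_real (m (0 + \<epsilon> * v)) * cis (- ((0 + \<epsilon> * v) * ((u - x) / \<epsilon>))))"
      unfolding X_def ft_def using \<epsilon> by (intro lborel_integral_real_affine) auto
    also have "\<dots> = of_real \<epsilon> * (LINT v|lborel. of_real (m (\<epsilon> * v)) * cis (v * x) * cis (- (u * v)))"
      using \<epsilon> by (simp add: scaleR_conv_of_real mult.assoc cis_mult) (simp add: algebra_simps)
    finally show "g u * (LINT v|lborel. of_real (m (\<epsilon> * v)) * cis (v * x) * cis (- (u * v)))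
        = g u * (of_real (1 / \<epsilon>) * X ((u - x) / \<epsilon>))"
      using \<epsilon> by simp
  qed simp
  also have "\<dots> = \<bar>- \<epsilon>\<bar> *\<^sub>R (LINT t|lborel. g (x + - \<epsilon> * t) * (of_real (1 / \<epsilon>) * X ((x + - \<epsilon> * t - x) / \<epsilon>)))"
    using \<epsilon> by (intro lborel_integral_real_affine) auto
  also have "\<dots> = (LINT t|lborel. g (x - \<epsilon> * t) * X t)"
    using \<epsilon> by (simp add: X_even scaleR_conv_of_real)
  finally show ?thesis .
qed

text \<open>As \<open>X\<close> has mass 2 pi, g(x) can be moved under the integral of the
  convolution; Minkowski's integral inequality, through Fubini for the norms, does the rest.\<close>

lemma L1_norm_truncated_riesz_diff_le:
  assumes \<epsilon>: "\<epsilon> > 0"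
  shows "2 * pi * L1_norm (\<lambda>x. truncated_riesz \<alpha> j \<epsilon> f x - g x)
     \<le> (LINT t|lborel. norm (X t) * (LINT x|lborel. norm (g (x - \<epsilon> * t) - g x)))"
proof -
  let ?T = "truncated_riesz \<alpha> j \<epsilon> f"
  let ?H = "\<lambda>t x. (g (x - \<epsilon> * t) - g x) * X t"
  have [measurable]: "g \<in> borel_measurable borel"
    using g by (auto dest: borel_measurable_integrable)
  have T: "integrable lborel ?T"
    by (rule integrable_truncated_riesz[OF f cont bdd \<epsilon>])
  then have [measurable]: "?T \<in> borel_measurable borel"
    by (auto dest: borel_measurable_integrable)
  note gt = integrable_translate[OF g]
  note tau = L1_translate_diff_le[OF g]
  have HL: "(LINT x|lborel. norm (?H t x)) = norm (X t) * (LINT x|lborel. norm (g (x - \<epsilon> * t) - g x))" for t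
    by (simp add: norm_mult mult.commute)
  have H: "integrable (lborel \<Otimes>\<^sub>M lborel) (\<lambda>(t, x). ?H t x)"
  proof (rule lborel_pair.Fubini_integrable)
    show "AE t in lborel. integrable lborel (\<lambda>x. case (t, x) of (t, x) \<Rightarrow> ?H t x)"
      using gt g by (intro AE_I2) auto
    have "integrable lborel (\<lambda>t. norm (X t) * (LINT x|lborel. norm (g (x - \<epsilon> * t) - g x)))"
    proof (rule Bochner_Integration.integrable_bound)
      show "integrable lborel (\<lambda>t. norm (X t) * (2 * (LINT x|lborel. norm (g x))))"
        using integrable_X[OF j] by simp
      show "AE t in lborel. norm (norm (X t) * (LINT x|lborel. norm (g (x - \<epsilon> * t) - g x)))
          \<le> norm (norm (X t) * (2 * (LINT x|lborel. norm (g x))))"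
        using tau by (intro AE_I2) (auto simp: abs_mult intro!: mult_left_mono)
    qed measurable
    then show "integrable lborel (\<lambda>t. LINT x|lborel. norm (case (t, x) of (t, x) \<Rightarrow> ?H t x))"
      by (simp add: HL)
  qed measurable
  have Teq: "of_real (2 * pi) * (?T x - g x) = (LINT t|lborel. ?H t x)" for x
  proof -
    \<comment> \<open>Boundedness of \<open>X\<close> gives integrability in \<open>t\<close> for
      every \<open>x\<close>, where Fubini would give it only for almost every
      \<open>x\<close>.\<close>
    have i: "integrable lborel (\<lambda>t. g (x - \<epsilon> * t) * X t)"
    proof (rule Bochner_Integration.integrable_bound)
      show "integrable lborel (\<lambda>t. norm (g (x + - \<epsilon> * t)) * (LINT w|lborel. m w))"
        using lborel_integrable_real_affine[OF g, of "- \<epsilon>" x] \<epsilon> by simp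
      show "AE t in lborel. norm (g (x - \<epsilon> * t) * X t) \<le> norm (norm (g (x + - \<epsilon> * t)) * (LINT w|lborel. m w))"
      proof (rule AE_I2)
        fix t
        have "norm (g (x - \<epsilon> * t)) * norm (X t) \<le> norm (g (x - \<epsilon> * t)) * (LINT w|lborel. m w)"
          by (intro mult_left_mono X_bounded norm_ge_zero)
        also have "\<dots> \<le> \<bar>\<dots>\<bar>"
          by (rule abs_ge_self)
        finally show "norm (g (x - \<epsilon> * t) * X t) \<le> norm (norm (g (x + - \<epsilon> * t)) * (LINT w|lborel. m w))"
          by (simp add: norm_mult)
      qed
    qed measurable
    have "(LINT t|lborel. ?H t x) = (LINT t|lborel. g (x - \<epsilon> * t) * X t - g x * X t)"
      by (simp only: left_diff_distrib)
    also have "\<dots> = (LINT t|lborel. g (x - \<epsilon> * t) * X t) - g x * (LINT t|lborel. X t)"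
      using i integrable_X[OF j] by simp
    finally show ?thesis
      unfolding integral_X[OF j] truncated_riesz_conv[OF \<epsilon>, symmetric] by (simp add: algebra_simps)
  qed
  have "2 * pi * L1_norm (\<lambda>x. ?T x - g x) = (LINT x|lborel. norm (of_real (2 * pi) * (?T x - g x)))"
    by (simp add: L1_norm_eq norm_mult)
  also have "\<dots> = (LINT x|lborel. norm (LINT t|lborel. ?H t x))"
    by (simp only: Teq)
  also have "\<dots> \<le> (LINT x|lborel. LINT t|lborel. norm (?H t x))"
  proof (rule integral_mono[OF _ _ integral_norm_bound])
    show "integrable lborel (\<lambda>x. norm (LINT t|lborel. ?H t x))"
      using lborel_pair.integrable_snd[OF H] by (rule integrable_norm)
    show "integrable lborel (\<lambda>x. LINT t|lborel. norm (?H t x))"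
      using lborel_pair.integrable_snd[of "\<lambda>t x. norm (?H t x)"] integrable_norm[OF H] by (simp add: case_prod_beta')
  qed
  also have "\<dots> = (LINT t|lborel. LINT x|lborel. norm (?H t x))"
    using integrable_norm[OF H] by (intro lborel_pair.Fubini_integral) (simp add: case_prod_beta')
  finally show ?thesis
    by (simp only: HL)
qed

text \<open>Dominated convergence in \<open>t\<close>, with majorant 2 |X(t)| times the norm of
  \<open>g\<close>; for fixed \<open>t\<close> the inner norm tends to 0 by continuity of
  translation.\<close>

lemma has_strong_riesz_deriv: "has_strong_riesz_deriv \<alpha> f g"
proof -
  have [measurable]: "g \<in> borel_measurable borel"
    using g by (auto dest: borel_measurable_integrable)
  define R where "R \<epsilon> = (LINT t|lborel. norm (X t) * (LINT x|lborel. norm (g (x - \<epsilon> * t) - g x)))" for \<epsilon>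
  note gt = integrable_translate[OF g]
  note tau = L1_translate_diff_le[OF g]
  have R: "(R \<longlongrightarrow> 0) (at_right 0)"
    unfolding tendsto_at_iff_sequentially comp_def
  proof (intro allI impI)
    fix E :: "nat \<Rightarrow> real" assume E: "\<forall>n. E n \<in> {0<..} - {0}" "E \<longlonglongrightarrow> 0"
    have ne: "E n \<noteq> 0" for n
      using E(1)[rule_format, of n] by simp
    have "(\<lambda>n. R (E n)) \<longlonglongrightarrow> (LINT t|(lborel :: real measure). (0 :: real))"
      unfolding R_def
    proof (rule integral_dominated_convergence)
      show "integrable lborel (\<lambda>t. norm (X t) * (2 * (LINT x|lborel. norm (g x))))"
        using integrable_X[OF j] by simp
      show "AE t in lborel. norm (norm (X t) * (LINT x|lborel. norm (g (x - E n * t) - g x)))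
          \<le> norm (X t) * (2 * (LINT x|lborel. norm (g x)))" for n
        using tau by (intro AE_I2) (auto simp: abs_mult intro!: mult_left_mono)
      show "AE t in lborel. (\<lambda>n. norm (X t) * (LINT x|lborel. norm (g (x - E n * t) - g x))) \<longlonglongrightarrow> 0"
      proof (rule AE_I2)
        fix t :: real
        show "(\<lambda>n. norm (X t) * (LINT x|lborel. norm (g (x - E n * t) - g x))) \<longlonglongrightarrow> 0"
        \<comment> \<open>The translation limit is taken along \<open>at 0\<close>, so the shift
          must be nonzero; for t = 0 the term is identically 0.\<close>
        proof (cases "t = 0")
          case False
          have "(\<lambda>n. E n * t) \<longlonglongrightarrow> 0 * t"
            using E(2) by (intro tendsto_intros)
          then have "filterlim (\<lambda>n. E n * t) (at 0) sequentially"
            using ne False by (simp add: filterlim_at)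
          then have "(\<lambda>n. LINT x|lborel. norm (g (x - E n * t) - g x)) \<longlonglongrightarrow> 0"
            by (rule filterlim_compose[OF tendsto_L1_translate[OF g]])
          then show ?thesis
            by (rule tendsto_mult_right_zero)
        qed simp
      qed
    qed measurable
    then show "(\<lambda>n. R (E n)) \<longlonglongrightarrow> 0" by simp
  qed
  have "((\<lambda>\<epsilon>. L1_norm (\<lambda>x. truncated_riesz \<alpha> j \<epsilon> f x - g x)) \<longlongrightarrow> 0) (at_right 0)"
  proof (rule Lim_null_comparison)
    show "((\<lambda>\<epsilon>. R \<epsilon> / (2 * pi)) \<longlongrightarrow> 0) (at_right 0)"
      using tendsto_divide_zero[OF R] .
    have "L1_norm (\<lambda>x. truncated_riesz \<alpha> j \<epsilon> f x - g x) \<le> R \<epsilon> / (2 * pi)" if "\<epsilon> > 0" for \<epsilon>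
      using L1_norm_truncated_riesz_diff_le[OF that] by (simp add: R_def field_simps)
    moreover have "0 \<le> L1_norm h" for h
      by (simp add: L1_norm_def)
    ultimately show "\<forall>\<^sub>F \<epsilon> in at_right 0. norm (L1_norm (\<lambda>x. truncated_riesz \<alpha> j \<epsilon> f x - g x)) \<le> R \<epsilon> / (2 * pi)"
      by (intro eventually_at_rightI[of 0 1]) auto
  qed
  then show ?thesis
    unfolding has_strong_riesz_deriv_def L1_def
    using alpha_gt alpha_lt integrable_lebesgue[OF f] integrable_lebesgue[OF g] by auto
qed

end

end

subsection \<open>Absolute summability of the samples\<close>

text \<open>Uniformity in \<open>y\<close> is the point: moving \<open>y\<close> by a multiple of
  \<open>h\<close> only relabels the lattice, so \<open>y\<close> may be taken in a single cell,
  with offset \<theta> in [0, 1] measured in units of \<open>h\<close>.\<close>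

lemma lattice_sum_bounded:
  assumes h: "h > (0 :: real)"
  shows "\<exists>S. \<forall>F :: int set. finite F \<longrightarrow> (\<forall>y. (\<Sum>k\<in>F. 1 / (1 + (h * of_int k - y)\<^sup>2)) \<le> S)"
proof -
  \<comment> \<open>Chosen so that 1 + l^2 \<le> 3 + 2 (l - \<theta>)^2 \<le> C (1 + h^2 (l -
    \<theta>)^2) for 0 \<le> \<theta> \<le> 1: the 3 absorbs the constant, 2 / h^2 the quadratic
    term.\<close>
  define C where "C = 3 + 2 / h\<^sup>2"
  define b where "b l = C / (1 + (real_of_int l)\<^sup>2)" for l :: int
  have C: "0 < C"
    unfolding C_def by (simp add: add_pos_nonneg)
  have "(\<lambda>k :: int. C * real_of_int \<bar>k\<bar> powr (- 2)) summable_on (- {0})"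
    using has_sum_int_powr[of 2] by (intro summable_on_cmult_right) (auto simp: summable_on_def)
  then have "b summable_on (- {0})"
  proof (rule summable_on_comparison_test)
    fix l :: int assume "l \<in> - {0}"
    then have l: "l \<noteq> 0" by simp
    then have "real_of_int \<bar>l\<bar> powr (- 2) = 1 / (real_of_int l)\<^sup>2"
      using powr_realpow[of "real_of_int \<bar>l\<bar>" 2] by (simp add: powr_minus divide_inverse)
    then show "b l \<le> C * real_of_int \<bar>l\<bar> powr (- 2)"
      using C l by (simp add: b_def frac_le)
    show "0 \<le> b l"
      using C by (simp add: b_def)
  qed
  then have b: "b summable_on UNIV"
    using summable_on_insert_iff[of b 0 "- {0}"] by (simp add: insert_UNIV insert_Diff_single Compl_eq_Diff_UNIV)
  have "(\<Sum>k\<in>F. 1 / (1 + (h * of_int k - y)\<^sup>2)) \<le> infsum b UNIV" if F: "finite F" for F :: "int set" and y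
  proof -
    define n where "n = \<lfloor>y / h\<rfloor>"
    define \<theta> where "\<theta> = y / h - of_int n"
    have \<theta>: "0 \<le> \<theta>" "\<theta> \<le> 1"
      unfolding \<theta>_def n_def by linarith+
    have y: "y = h * (of_int n + \<theta>)"
      unfolding \<theta>_def using h by simp
    have "1 / (1 + (h * of_int k - y)\<^sup>2) \<le> b (k - n)" for k
    proof -
      define l where "l = real_of_int (k - n)"
      have "h * of_int k - y = h * (l - \<theta>)"
        unfolding y l_def by (simp add: algebra_simps)
      have "l\<^sup>2 \<le> 2 * (l - \<theta>)\<^sup>2 + 2 * \<theta>\<^sup>2"
        using zero_le_power2[of "l - 2 * \<theta>"] by (simp add: power2_eq_square algebra_simps)
      moreover have "\<theta>\<^sup>2 \<le> 1"
        using \<theta> by (simp add: power_le_one)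
      ultimately have "1 + l\<^sup>2 \<le> 3 + 2 * (l - \<theta>)\<^sup>2" by simp
      also have "\<dots> \<le> C * (1 + (h * (l - \<theta>))\<^sup>2)"
      proof -
        have "C * (1 + (h * (l - \<theta>))\<^sup>2) = 3 + 2 * (l - \<theta>)\<^sup>2 + (2 / h\<^sup>2 + 3 * (h * (l - \<theta>))\<^sup>2)"
          unfolding C_def power_mult_distrib using h by (simp add: field_simps)
        then show ?thesis by (simp add: add_nonneg_nonneg)
      qed
      finally have "1 + l\<^sup>2 \<le> C * (1 + (h * (l - \<theta>))\<^sup>2)" .
      then have "1 / (1 + (h * (l - \<theta>))\<^sup>2) \<le> C / (1 + l\<^sup>2)"
        by (simp add: divide_simps add_pos_nonneg mult.commute add_nonneg_eq_0_iff)
      then show ?thesis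
        by (simp add: b_def \<open>h * of_int k - y = h * (l - \<theta>)\<close> l_def)
    qed
    then have "(\<Sum>k\<in>F. 1 / (1 + (h * of_int k - y)\<^sup>2)) \<le> (\<Sum>k\<in>F. b (k - n))"
      by (intro sum_mono)
    also have "\<dots> = sum b ((\<lambda>k. k - n) ` F)"
      by (subst sum.reindex) (auto simp: inj_on_def)
    also have "\<dots> \<le> infsum b UNIV"
      using F b C by (intro finite_sum_le_infsum) (auto simp: b_def)
    finally show ?thesis .
  qed
  then show ?thesis by blast
qed

text \<open>Finite sums of samples go under the integral, where the lattice sum is bounded uniformly
  in \<open>y\<close>; bounded partial sums suffice for nonnegative terms.\<close>

lemma summable_lattice_samples:
  fixes f :: "real \<Rightarrow> complex" and \<psi> :: "real \<Rightarrow> real"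
  assumes h: "h > 0" and \<psi>: "integrable lborel \<psi>" "\<And>y. 0 \<le> \<psi> y"
    and f: "\<And>x. norm (f x) \<le> (LINT y|lborel. \<psi> y / (1 + (x - y)\<^sup>2))"
  shows "(\<lambda>k :: int. norm (f (h * of_int k))) summable_on UNIV"
proof -
  obtain S where S: "\<And>(F :: int set) y. finite F \<Longrightarrow> (\<Sum>k\<in>F. 1 / (1 + (h * of_int k - y)\<^sup>2)) \<le> S"
    using lattice_sum_bounded[OF h] by blast
  have [measurable]: "\<psi> \<in> borel_measurable borel"
    using \<psi> by (auto dest: borel_measurable_integrable)
  have i: "integrable lborel (\<lambda>y. \<psi> y / (1 + (x - y)\<^sup>2))" for x
    by (rule Bochner_Integration.integrable_bound[OF \<psi>(1)])
       (auto simp: divide_le_eq add_pos_nonneg mult_le_cancel_left1 leD[OF \<psi>(2)] \<psi>(2))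
  have "(\<Sum>k\<in>F. norm (f (h * of_int k))) \<le> (LINT y|lborel. \<psi> y * S)" if F: "finite F" for F :: "int set"
  proof -
    have "(\<Sum>k\<in>F. norm (f (h * of_int k))) \<le> (\<Sum>k\<in>F. LINT y|lborel. \<psi> y / (1 + (h * of_int k - y)\<^sup>2))"
      by (intro sum_mono f)
    also have "\<dots> = (LINT y|lborel. (\<Sum>k\<in>F. \<psi> y / (1 + (h * of_int k - y)\<^sup>2)))"
      using i by (subst Bochner_Integration.integral_sum) auto
    also have "\<dots> \<le> (LINT y|lborel. \<psi> y * S)"
    proof (rule integral_mono)
      show "(\<Sum>k\<in>F. \<psi> y / (1 + (h * of_int k - y)\<^sup>2)) \<le> \<psi> y * S" for y
        using mult_left_mono[OF S[OF F, of y] \<psi>(2)[of y]] by (simp add: sum_distrib_left)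
    qed (use i \<psi> in auto)
    finally show ?thesis .
  qed
  then show ?thesis
    by (intro nonneg_bdd_above_summable_on bdd_aboveI2) auto
qed

section \<open>Pointwise majorants for \<open>f\<close>\<close>

context riesz_kernel
begin

text \<open>For u > 1 and |a| \<ge> 1 the weight satisfies u^(-1 - \<alpha>) \<le> u^(-2) \<le> 2
  a^2 / (1 + (a u)^2). With y = x + a u this is the kernel 1 / (1 + (x - y)^2), and the substitution
  returns one factor |a|.\<close>

lemma norm_kernel_average_le_convolution:
  assumes f: "integrable lborel f" and cont: "continuous_on UNIV f" and bdd: "\<And>x. norm (f x) \<le> B" and a: "1 \<le> \<bar>a\<bar>"
  shows "norm (LINT u|lborel. \<kappa> 1 u * f (x + a * u)) \<le> 2 * \<bar>a\<bar> * (LINT y|lborel. norm (f y) / (1 + (x - y)\<^sup>2))"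
proof -
  define P where "P y = norm (f y) / (1 + (x - y)\<^sup>2)" for y
  have [measurable]: "f \<in> borel_measurable borel"
    using cont by (rule borel_measurable_continuous_onI)
  have P: "integrable lborel P"
    unfolding P_def
    by (rule Bochner_Integration.integrable_bound[OF integrable_norm[OF f]])
       (auto simp: divide_le_eq add_pos_nonneg mult_le_cancel_left1)
  then have Pa: "integrable lborel (\<lambda>u. P (x + a * u))"
    using a by (intro lborel_integrable_real_affine) auto
  have pt: "norm (\<kappa> 1 u * f (x + a * u)) \<le> 2 * a\<^sup>2 * P (x + a * u)" for u
  proof (cases "1 < u")
    case True
    have a2: "1 \<le> a\<^sup>2"
      using a abs_le_square_iff[of 1 a] by simp
    have "u powr (- (1 + \<alpha>)) \<le> u powr (- 2)"
      using True alpha_gt by (intro powr_mono) auto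
    also have "\<dots> = 1 / u\<^sup>2"
      using powr_realpow[of u 2] True by (simp add: powr_minus divide_inverse)
    also have "\<dots> \<le> 2 * a\<^sup>2 / (1 + (a * u)\<^sup>2)"
    proof -
      have "1 * 1 \<le> a\<^sup>2 * u\<^sup>2"
        using a2 True by (intro mult_mono) auto
      then have "1 + (a * u)\<^sup>2 \<le> 2 * a\<^sup>2 * u\<^sup>2"
        by (simp add: power_mult_distrib)
      then show ?thesis
        using True by (simp add: divide_simps add_pos_nonneg add_nonneg_eq_0_iff)
    qed
    finally have "u powr (- (1 + \<alpha>)) * norm (f (x + a * u)) \<le> 2 * a\<^sup>2 / (1 + (a * u)\<^sup>2) * norm (f (x + a * u))"
      by (rule mult_right_mono) simp
    then show ?thesis
      using True by (simp add: \<kappa>_def P_def norm_mult)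
  qed (simp add: \<kappa>_def P_def)
  have "norm (LINT u|lborel. \<kappa> 1 u * f (x + a * u)) \<le> (LINT u|lborel. norm (\<kappa> 1 u * f (x + a * u)))"
    by (rule integral_norm_bound)
  also have "\<dots> \<le> (LINT u|lborel. 2 * a\<^sup>2 * P (x + a * u))"
    using integrable_kernel_average_arg[OF integrable_\<kappa> cont bdd, of 1 x a] Pa pt
    by (intro integral_mono integrable_norm) auto
  also have "\<dots> = 2 * \<bar>a\<bar> * (\<bar>a\<bar> *\<^sub>R (LINT u|lborel. P (x + a * u)))"
    by (simp add: power2_eq_square[of a] abs_mult_self_eq mult.assoc[symmetric])
  also have "\<bar>a\<bar> *\<^sub>R (LINT u|lborel. P (x + a * u)) = (LINT y|lborel. P y)"
    using a by (intro lborel_integral_real_affine[symmetric]) auto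
  finally show ?thesis
    by (simp only: P_def)
qed

text \<open>The term \<open>k = j\<close> of the central difference is a multiple of \<open>f x\<close>, while the truncated integral equals a
  convolution of \<open>g\<close> with the kernel \<open>X\<close>.\<close>

lemma norm_le_convolution:
  fixes f g :: "real \<Rightarrow> complex" and B :: real
  assumes j: "\<alpha> + 2 \<le> 2 * real j"
    and f: "integrable lborel f" and cont: "continuous_on UNIV f" and bdd: "\<And>x. norm (f x) \<le> B"
    and g: "integrable lborel g" and gf: "\<And>v. ft g v = of_real (\<bar>v\<bar> powr \<alpha>) * ft f v"
  shows "\<exists>\<psi>. integrable lborel \<psi> \<and> (\<forall>y. 0 \<le> \<psi> y) \<and> (\<forall>x. norm (f x) \<le> (LINT y|lborel. \<psi> y / (1 + (x - y)\<^sup>2)))"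
proof -
  obtain C where C: "\<And>y. norm (X y) \<le> C / (1 + y\<^sup>2)"
    using ft_m_decay[OF j] unfolding X_def by blast
  have C0: "0 \<le> C"
    using order_trans[OF norm_ge_zero C[of 0]] by simp
  have [measurable]: "f \<in> borel_measurable borel" "g \<in> borel_measurable borel"
    using cont g by (auto dest: borel_measurable_integrable intro: borel_measurable_continuous_onI)
  let ?c = "\<lambda>k. (-1) ^ k * of_nat ((2 * j) choose k) :: complex"
  let ?E = "\<lambda>k x. LINT u|lborel. \<kappa> 1 u * f (x + (real j - real k) * u)"
  let ?K = "{..2 * j} - {j}"
  define P where "P \<phi> x = (LINT y|lborel. norm (\<phi> y) / (1 + (x - y)\<^sup>2))" for \<phi> :: "real \<Rightarrow> complex" and x
  \<comment> \<open>The factor \<alpha> inverts the mass 1 / \<alpha> of the weight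
    \<open>\<kappa> 1\<close> in the central term, \<open>2 * real j\<close> bounds the factors 2 |j
    - k| of the other shifts, and in \<open>A2\<close> the quotient C / (2 pi) comes from the
    convolution identity for \<open>X\<close>.\<close>
  define A1 where "A1 = \<alpha> * (\<Sum>k\<in>?K. norm (?c k) * (2 * real j))"
  define A2 where "A2 = \<alpha> * \<bar>riesz_const \<alpha> j\<bar> * (C / (2 * pi))"
  have A: "0 \<le> A1" "0 \<le> A2"
    unfolding A1_def A2_def using alpha_gt C0 by (auto intro!: sum_nonneg mult_nonneg_nonneg)
  have Pi: "integrable lborel (\<lambda>y. norm (\<phi> y) / (1 + (x - y)\<^sup>2))" if "integrable lborel \<phi>" "\<phi> \<in> borel_measurable borel" for \<phi> :: "real \<Rightarrow> complex" and x
    using that(2) by (intro Bochner_Integration.integrable_bound[OF integrable_norm[OF that(1)]])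
       (auto simp: divide_le_eq add_pos_nonneg mult_le_cancel_left1)
  have P0: "0 \<le> P \<phi> x" for \<phi> x
    unfolding P_def by (intro integral_nonneg_AE AE_I2) simp
  have main: "norm (f x) \<le> A1 * P f x + A2 * P g x" for x
  proof -
    have "(LINT u|lborel. \<kappa> 1 u) = of_real (1 / \<alpha>)"
      unfolding \<kappa>_def integral_complex_of_real using integral_powr_at_top[of "- (1 + \<alpha>)" 1] alpha_gt by simp
    then have Ej: "?E j x = f x / of_real \<alpha>"
      by simp
    have "complex_of_real (riesz_const \<alpha> j) * truncated_riesz \<alpha> j 1 f x = (\<Sum>k\<le>2 * j. ?c k * ?E k x)"
      using truncated_riesz_eq[OF _ cont bdd, of 1 x] riesz_const_nz by simp
    also have "\<dots> = ?c j * ?E j x + (\<Sum>k\<in>?K. ?c k * ?E k x)"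
      by (rule sum.remove) auto
    also have "?E j x = f x / of_real \<alpha>"
      by (rule Ej)
    finally have eq: "?c j * (f x / of_real \<alpha>) = complex_of_real (riesz_const \<alpha> j) * truncated_riesz \<alpha> j 1 f x - (\<Sum>k\<in>?K. ?c k * ?E k x)"
      by (simp add: algebra_simps)
    have T: "norm (truncated_riesz \<alpha> j 1 f x) \<le> C / (2 * pi) * P g x"
    proof -
      have "of_real (2 * pi) * truncated_riesz \<alpha> j 1 f x = (LINT t|lborel. g (x + -1 * t) * X t)"
        using truncated_riesz_conv[OF j f cont bdd g gf, of 1 x] by simp
      also have "\<dots> = (LINT y|lborel. g y * X (x - y))"
        using lborel_integral_real_affine[of "-1" "\<lambda>y. g y * X (x - y)" x] by simp
      finally have conv: "of_real (2 * pi) * truncated_riesz \<alpha> j 1 f x = (LINT y|lborel. g y * X (x - y))" .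
      have "2 * pi * norm (truncated_riesz \<alpha> j 1 f x) = norm (LINT y|lborel. g y * X (x - y))"
        unfolding conv[symmetric] by (simp add: norm_mult)
      also have "\<dots> \<le> (LINT y|lborel. norm (g y * X (x - y)))"
        by (rule integral_norm_bound)
      also have "\<dots> \<le> (LINT y|lborel. C * (norm (g y) / (1 + (x - y)\<^sup>2)))"
      proof (rule integral_mono)
        show le: "norm (g y * X (x - y)) \<le> C * (norm (g y) / (1 + (x - y)\<^sup>2))" for y
          using mult_left_mono[OF C[of "x - y"], of "norm (g y)"] by (simp add: norm_mult mult.commute)
        show iC: "integrable lborel (\<lambda>y. C * (norm (g y) / (1 + (x - y)\<^sup>2)))"
          by (intro integrable_mult_right Pi g) measurable
        show "integrable lborel (\<lambda>y. norm (g y * X (x - y)))"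
        proof (rule Bochner_Integration.integrable_bound[OF iC], measurable, rule AE_I2)
          show "norm (norm (g y * X (x - y))) \<le> norm (C * (norm (g y) / (1 + (x - y)\<^sup>2)))" for y
            using order_trans[OF le abs_ge_self] by simp
        qed
      qed
      also have "\<dots> = C * P g x"
        unfolding P_def by (rule integral_mult_right_zero)
      finally show ?thesis
        by (simp add: field_simps)
    qed
    have E: "norm (?E k x) \<le> 2 * real j * P f x" if "k \<in> ?K" for k
    proof -
      have "1 \<le> \<bar>real j - real k\<bar>" "\<bar>real j - real k\<bar> \<le> real j"
        using that by (auto simp: abs_if)
      then have "norm (?E k x) \<le> 2 * \<bar>real j - real k\<bar> * P f x"
        unfolding P_def by (intro norm_kernel_average_le_convolution[OF f cont bdd])
      also have "\<dots> \<le> 2 * real j * P f x"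
        using \<open>\<bar>real j - real k\<bar> \<le> real j\<close> by (intro mult_right_mono P0) simp
      finally show ?thesis .
    qed
    \<comment> \<open>The central binomial coefficient is only bounded below by 1; its value would
      merely improve the constants \<open>A1\<close> and \<open>A2\<close>.\<close>
    have "1 \<le> real ((2 * j) choose j)"
      using zero_less_binomial[of j "2 * j"] by linarith
    then have "norm (f x) / \<alpha> \<le> norm (?c j * (f x / of_real \<alpha>))"
      using alpha_gt mult_right_mono[of 1 "real ((2 * j) choose j)" "norm (f x) / \<alpha>"]
      by (simp add: norm_mult norm_divide norm_power)
    also have "\<dots> \<le> norm (complex_of_real (riesz_const \<alpha> j) * truncated_riesz \<alpha> j 1 f x) + norm (\<Sum>k\<in>?K. ?c k * ?E k x)"
      unfolding eq by (rule norm_triangle_ineq4)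
    also have "\<dots> \<le> \<bar>riesz_const \<alpha> j\<bar> * (C / (2 * pi) * P g x) + (\<Sum>k\<in>?K. norm (?c k) * (2 * real j * P f x))"
    proof (rule add_mono)
      show "norm (complex_of_real (riesz_const \<alpha> j) * truncated_riesz \<alpha> j 1 f x) \<le> \<bar>riesz_const \<alpha> j\<bar> * (C / (2 * pi) * P g x)"
        unfolding norm_mult norm_of_real by (intro mult_left_mono T) simp
      show "norm (\<Sum>k\<in>?K. ?c k * ?E k x) \<le> (\<Sum>k\<in>?K. norm (?c k) * (2 * real j * P f x))"
        unfolding norm_mult[of "?c _"]
      proof (rule sum_norm_le)
        fix k assume "k \<in> ?K"
        from E[OF this] show "norm (?c k * ?E k x) \<le> norm (?c k) * (2 * real j * P f x)"
          unfolding norm_mult[of "?c k"] by (rule mult_left_mono) simp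
      qed
    qed
    finally have "norm (f x) \<le> \<alpha> * (\<bar>riesz_const \<alpha> j\<bar> * (C / (2 * pi) * P g x) + (\<Sum>k\<in>?K. norm (?c k) * (2 * real j * P f x)))"
      using alpha_gt by (simp add: pos_divide_le_eq mult.commute)
    also have "\<dots> = A1 * P f x + A2 * P g x"
      unfolding A1_def A2_def by (simp add: distrib_left sum_distrib_left sum_distrib_right mult_ac add_ac)
    finally show ?thesis .
  qed
  show ?thesis
  proof (intro exI[of _ "\<lambda>y. A1 * norm (f y) + A2 * norm (g y)"] conjI allI)
    show "integrable lborel (\<lambda>y. A1 * norm (f y) + A2 * norm (g y))"
      using f g by auto
    show "0 \<le> A1 * norm (f y) + A2 * norm (g y)" for y
      using A by auto
    fix x
    have "(LINT y|lborel. (A1 * norm (f y) + A2 * norm (g y)) / (1 + (x - y)\<^sup>2))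
       = (LINT y|lborel. A1 * (norm (f y) / (1 + (x - y)\<^sup>2)) + A2 * (norm (g y) / (1 + (x - y)\<^sup>2)))"
      by (simp add: add_divide_distrib)
    also have "\<dots> = A1 * P f x + A2 * P g x"
      unfolding P_def
      by (subst Bochner_Integration.integral_add)
         (simp_all only: integral_mult_right_zero, intro integrable_mult_right Pi f, measurable, intro integrable_mult_right Pi g, measurable)
    finally show "norm (f x) \<le> (LINT y|lborel. (A1 * norm (f y) + A2 * norm (g y)) / (1 + (x - y)\<^sup>2))"
      using main[of x] by simp
  qed
qed

end

subsection \<open>The quadrature remainder\<close>

lemma integral_lebesgue_shift_cis:
  fixes G :: "real \<Rightarrow> complex"
  shows "(LINT x|lebesgue. G (x + c) * cis (- (x * v))) = cis (c * v) * (LINT x|lebesgue. G x * cis (- (x * v)))"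
proof -
  have "(LINT x|lebesgue. G x * cis (- (x * v))) = \<bar>1\<bar> *\<^sub>R (LINT x|lebesgue. G (c + 1 * x) * cis (- ((c + 1 * x) * v)))"
    by (rule lebesgue_integral_real_affine) simp
  also have "\<dots> = (LINT x|lebesgue. cis (- (c * v)) * (G (x + c) * cis (- (x * v))))"
    by (simp add: add.commute distrib_right mult.left_commute cis_mult)
  also have "\<dots> = cis (- (c * v)) * (LINT x|lebesgue. G (x + c) * cis (- (x * v)))"
    by (rule integral_mult_right_zero)
  finally show ?thesis
    by (simp add: mult.assoc[symmetric] cis_mult)
qed

lemma integrable_lebesgue_shift:
  fixes G :: "real \<Rightarrow> complex"
  assumes "integrable lebesgue G"
  shows "integrable lebesgue (\<lambda>x. G (x + c))"
  using lebesgue_integrable_real_affine_iff[of 1 G c] assms by (simp add: add.commute)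

text \<open>The symbol is the binomial expansion of (cis(u v) - 1)^r. The norm bound is uniform in
  \<open>u\<close>, which makes the set under the supremum in \<open>smoothness_modulus\<close>
  bounded above; otherwise membership in that set would not bound a value by the supremum.\<close>

lemma
  fixes G :: "real \<Rightarrow> complex"
  assumes G: "integrable lebesgue G"
  shows integrable_forward_diff: "integrable lebesgue (forward_diff r u G)"
    and L1_norm_forward_diff_le: "L1_norm (forward_diff r u G) \<le> 2 ^ r * L1_norm G"
    and transform_forward_diff: "(LINT x|lebesgue. forward_diff r u G x * cis (- (x * v)))
          = (cis (u * v) - 1) ^ r * (LINT x|lebesgue. G x * cis (- (x * v)))"
proof -
  let ?c = "\<lambda>j. (-1) ^ (r - j) * of_nat (r choose j) :: complex"
  note Gs = integrable_lebesgue_shift[OF G]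
  show i: "integrable lebesgue (forward_diff r u G)"
    unfolding forward_diff_def[abs_def]
    by (intro Bochner_Integration.integrable_sum integrable_mult_right Gs)
  have "L1_norm (forward_diff r u G) \<le> (LINT x|lebesgue. (\<Sum>j\<le>r. real (r choose j) * norm (G (x + real j * u))))"
    unfolding L1_norm_def
  proof (rule integral_mono)
    show "norm (forward_diff r u G x) \<le> (\<Sum>j\<le>r. real (r choose j) * norm (G (x + real j * u)))" for x
      unfolding forward_diff_def by (intro sum_norm_le) (simp add: norm_mult norm_power)
  qed (use i Gs in auto)
  also have "\<dots> = (\<Sum>j\<le>r. real (r choose j) * (LINT x|lebesgue. norm (G (x + real j * u))))"
    using Gs by (subst Bochner_Integration.integral_sum) auto
  also have "\<dots> = (\<Sum>j\<le>r. real (r choose j) * L1_norm G)"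
  proof (intro sum.cong refl)
    fix j
    show "real (r choose j) * (LINT x|lebesgue. norm (G (x + real j * u))) = real (r choose j) * L1_norm G"
      using lebesgue_integral_real_affine[of 1 "\<lambda>x. norm (G x)" "real j * u"] by (simp add: L1_norm_def add.commute)
  qed
  also have "\<dots> = real (\<Sum>j\<le>r. r choose j) * L1_norm G"
    by (simp add: sum_distrib_right)
  also have "\<dots> = 2 ^ r * L1_norm G"
    by (simp add: choose_row_sum)
  finally show "L1_norm (forward_diff r u G) \<le> 2 ^ r * L1_norm G" .
  have "(LINT x|lebesgue. forward_diff r u G x * cis (- (x * v)))
     = (LINT x|lebesgue. (\<Sum>j\<le>r. ?c j * (G (x + real j * u) * cis (- (x * v)))))"
    by (simp add: forward_diff_def sum_distrib_right mult.assoc)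
  also have "\<dots> = (\<Sum>j\<le>r. ?c j * (LINT x|lebesgue. G (x + real j * u) * cis (- (x * v))))"
    using integrable_lebesgue_cis[OF Gs] by (subst Bochner_Integration.integral_sum) auto
  also have "\<dots> = (\<Sum>j\<le>r. of_nat (r choose j) * cis (u * v) ^ j * (-1) ^ (r - j)) * (LINT x|lebesgue. G x * cis (- (x * v)))"
    unfolding integral_lebesgue_shift_cis sum_distrib_right
    by (intro sum.cong refl) (simp add: Complex.DeMoivre mult_ac)
  also have "(\<Sum>j\<le>r. of_nat (r choose j) * cis (u * v) ^ j * (-1) ^ (r - j)) = (cis (u * v) + (-1)) ^ r"
    by (rule binomial_ring[symmetric])
  finally show "(LINT x|lebesgue. forward_diff r u G x * cis (- (x * v)))
          = (cis (u * v) - 1) ^ r * (LINT x|lebesgue. G x * cis (- (x * v)))"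
    by simp
qed

text \<open>For the step \<open>u = pi / v\<close> the symbol \<open>cis (u v) - 1\<close> of the difference operator equals \<open>-2\<close>.\<close>

lemma transform_le_smoothness_modulus:
  fixes G :: "real \<Rightarrow> complex"
  assumes G: "integrable lebesgue G" and v: "v \<noteq> 0" "pi / \<bar>v\<bar> \<le> \<delta>"
  shows "2 ^ r * norm (LINT x|lebesgue. G x * cis (- (x * v))) \<le> smoothness_modulus r G \<delta>"
proof -
  let ?u = "pi / v"
  have "2 ^ r * norm (LINT x|lebesgue. G x * cis (- (x * v)))
      = norm (LINT x|lebesgue. forward_diff r ?u G x * cis (- (x * v)))"
    unfolding transform_forward_diff[OF G] using v by (simp add: norm_mult norm_power)
  also have "\<dots> \<le> L1_norm (forward_diff r ?u G)"
    by (rule norm_integral_cis_le[OF integrable_forward_diff[OF G]])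
  also have "\<dots> \<le> smoothness_modulus r G \<delta>"
    unfolding smoothness_modulus_def
  proof (rule cSUP_upper)
    show "?u \<in> {u. \<bar>u\<bar> \<le> \<delta>}"
      using v by simp
    show "bdd_above ((\<lambda>u. L1_norm (forward_diff r u G)) ` {u. \<bar>u\<bar> \<le> \<delta>})"
      by (rule bdd_aboveI2[of _ _ "2 ^ r * L1_norm G"]) (rule L1_norm_forward_diff_le[OF G])
  qed
  finally show ?thesis .
qed

text \<open>The function supplied by \<open>W_space\<close> is only Lebesgue measurable, while the
  product-measure arguments run over \<open>lborel\<close>. A Borel representative has the same
  transform.\<close>

lemma lebesgue_ex_borel:
  fixes g :: "real \<Rightarrow> complex"
  assumes g: "integrable lebesgue g"
  obtains g' where "integrable lborel g'" "AE x in lebesgue. g x = g' x"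
proof -
  have [measurable]: "g \<in> borel_measurable lebesgue"
    using g by auto
  have gm: "(\<lambda>x. Re (g x)) \<in> borel_measurable lebesgue" "(\<lambda>x. Im (g x)) \<in> borel_measurable lebesgue"
    by measurable
  obtain r where r: "r \<in> borel_measurable lborel" "AE x in lborel. Re (g x) = r x"
    using completion_ex_borel_measurable_real[OF gm(1)] by blast
  obtain s where s: "s \<in> borel_measurable lborel" "AE x in lborel. Im (g x) = s x"
    using completion_ex_borel_measurable_real[OF gm(2)] by blast
  let ?g = "\<lambda>x. Complex (r x) (s x)"
  have [measurable]: "?g \<in> borel_measurable borel"
    using r(1) s(1) by (simp add: borel_measurable_complex_iff)
  have "AE x in lborel. g x = ?g x"
    using r(2) s(2) by eventually_elim (simp add: complex_eq_iff)
  then have AE: "AE x in lebesgue. g x = ?g x"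
    by (rule AE_completion)
  have "integrable lebesgue ?g"
    by (rule integrable_cong_AE_imp[OF g _ AE]) (rule measurable_completion, measurable)
  then have "integrable lborel ?g"
    by (subst (asm) integrable_completion) auto
  with AE show ?thesis
    by (rule that[rotated])
qed

lemma integrable_powr_decay:
  fixes F :: "real \<Rightarrow> complex"
  assumes cont: "continuous_on UNIV F" and b: "\<And>v. norm (F v) \<le> K" and \<alpha>: "\<alpha> > 1"
    and decay: "\<And>v. v \<noteq> 0 \<Longrightarrow> norm (F v) \<le> L * \<bar>v\<bar> powr (- \<alpha>)"
  shows "integrable lborel F"
proof (rule Bochner_Integration.integrable_bound)
  show "integrable lborel (\<lambda>v. K * indicat_real {-1..1} v + L * (indicat_real {w. 1 < \<bar>w\<bar>} v * \<bar>v\<bar> powr (- \<alpha>)))"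
    using \<alpha> by (intro Bochner_Integration.integrable_add integrable_mult_right integrable_powr_reflect integrable_real_indicator) auto
  show "F \<in> borel_measurable lborel"
    using cont by (simp add: borel_measurable_continuous_onI)
  show "AE v in lborel. norm (F v) \<le> norm (K * indicat_real {-1..1} v + L * (indicat_real {w. 1 < \<bar>w\<bar>} v * \<bar>v\<bar> powr (- \<alpha>)))"
  proof (rule AE_I2)
    fix v
    have "norm (F v) \<le> K * indicat_real {-1..1} v + L * (indicat_real {w. 1 < \<bar>w\<bar>} v * \<bar>v\<bar> powr (- \<alpha>))"
    proof (cases "\<bar>v\<bar> \<le> 1")
      case True
      then show ?thesis using b[of v] by (auto simp: indicator_def abs_le_iff)
    next
      case False
      then show ?thesis using decay[of v] by (auto simp: indicator_def)
    qed
    then show "norm (F v) \<le> norm (K * indicat_real {-1..1} v + L * (indicat_real {w. 1 < \<bar>w\<bar>} v * \<bar>v\<bar> powr (- \<alpha>)))"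
      by simp
  qed
qed

text \<open>The k = 0 term of the Poisson sum is the integral of \<open>f\<close>, so the remainder
  is minus the rest of the sum. \<open>D\<close> bounds |v|^\<alpha> |ft f(v)| at the remaining
  frequencies, and the constant is 2 zeta(\<alpha>) (2 pi / h)^(-\<alpha>).\<close>

lemma quadrature_remainder_le:
  fixes f :: "real \<Rightarrow> complex"
  assumes h: "h > 0" and \<alpha>: "\<alpha> > 1" and fm: "f \<in> borel_measurable borel"
    and summ: "(\<lambda>k :: int. norm (ft f (2 * pi / h * of_int k))) summable_on UNIV"
    and poisson: "of_real h * (\<Sum>\<^sub>\<infinity>k :: int. f (h * of_int k)) = (\<Sum>\<^sub>\<infinity>k :: int. ft f (2 * pi / h * of_int k))"
    and D: "\<And>k :: int. k \<noteq> 0 \<Longrightarrow> norm (ft f (2 * pi / h * of_int k)) \<le> D * \<bar>2 * pi / h * of_int k\<bar> powr (- \<alpha>)"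
  shows "norm (quadrature_remainder (2 * pi / h) f) \<le> h powr \<alpha> * (zeta_real \<alpha> / (pi powr \<alpha> * 2 powr (\<alpha> - 1))) * D"
proof -
  let ?a = "\<lambda>k :: int. ft f (2 * pi / h * of_int k)"
  let ?s = "2 * pi / h"
  have s: "0 < ?s" using h by simp
  have abs: "(\<lambda>k. norm (?a k)) summable_on (- {0})"
    by (rule summable_on_subset[OF summ]) simp
  have f0: "(LINT t|lebesgue. f t) = ft f 0"
    unfolding ft_def using fm by (simp add: integral_completion)
  have "(\<Sum>\<^sub>\<infinity>k. ?a k) = ?a 0 + (\<Sum>\<^sub>\<infinity>k\<in>- {0}. ?a k)"
    using infsum_insert[OF abs_summable_summable[OF abs], of 0]
    by (simp add: insert_UNIV insert_Diff_single Compl_eq_Diff_UNIV)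
  then have "quadrature_remainder ?s f = - (\<Sum>\<^sub>\<infinity>k\<in>- {0}. ?a k)"
    using h poisson by (simp add: quadrature_remainder_def Let_def f0)
  then have "norm (quadrature_remainder ?s f) \<le> (\<Sum>\<^sub>\<infinity>k\<in>- {0}. norm (?a k))"
    using norm_infsum_bound[OF abs] by simp
  also have "\<dots> \<le> (\<Sum>\<^sub>\<infinity>k\<in>- {0}. D * ?s powr (- \<alpha>) * real_of_int \<bar>k\<bar> powr (- \<alpha>))"
  proof (rule infsum_mono[OF abs])
    show "(\<lambda>k :: int. D * ?s powr (- \<alpha>) * real_of_int \<bar>k\<bar> powr (- \<alpha>)) summable_on (- {0})"
      using has_sum_int_powr[OF \<alpha>] by (intro summable_on_cmult_right) (auto simp: summable_on_def)
    fix k :: int assume "k \<in> - {0}"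
    then have "norm (?a k) \<le> D * \<bar>?s * of_int k\<bar> powr (- \<alpha>)"
      by (intro D) simp
    also have "\<bar>?s * of_int k\<bar> = ?s * real_of_int \<bar>k\<bar>"
      using h by (simp add: abs_mult)
    also have "D * (?s * real_of_int \<bar>k\<bar>) powr (- \<alpha>) = D * ?s powr (- \<alpha>) * real_of_int \<bar>k\<bar> powr (- \<alpha>)"
      by (simp only: powr_mult mult.assoc)
    finally show "norm (?a k) \<le> D * ?s powr (- \<alpha>) * real_of_int \<bar>k\<bar> powr (- \<alpha>)" .
  qed
  also have "\<dots> = D * ?s powr (- \<alpha>) * (2 * zeta_real \<alpha>)"
    by (rule infsumI[OF has_sum_cmult_right[OF has_sum_int_powr[OF \<alpha>]]])
  \<comment> \<open>The factor 2 counting k and -k lowers the power of two in the denominator from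
    \<alpha> to \<alpha> - 1.\<close>
  also have "?s powr (- \<alpha>) = h powr \<alpha> / (pi powr \<alpha> * 2 powr \<alpha>)"
    using h by (simp add: powr_minus powr_divide powr_mult field_simps)
  also have "D * (h powr \<alpha> / (pi powr \<alpha> * 2 powr \<alpha>)) * (2 * zeta_real \<alpha>)
      = h powr \<alpha> * (zeta_real \<alpha> / (pi powr \<alpha> * 2 powr (\<alpha> - 1))) * D"
    by (simp add: powr_diff field_simps)
  finally show ?thesis .
qed

text \<open>Common core of both inequalities: \<open>D\<close> is later the modulus of smoothness
  divided by 2^r, or the L1 norm. A bound for |v| \<ge> 2 pi / h is enough because every nonzero
  multiple of 2 pi / h lies there.\<close>

lemma
  fixes f :: "real \<Rightarrow> complex"
  assumes \<alpha>: "\<alpha> > 1" and f: "f \<in> W_space \<alpha> \<inter> C_b"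
  shows integrable_strong_riesz_deriv: "integrable lebesgue (strong_riesz_deriv \<alpha> f)"
    and W_space_quadrature_remainder_le: "h > 0 \<Longrightarrow>
      (\<And>v. 2 * pi / h \<le> \<bar>v\<bar> \<Longrightarrow> norm (LINT x|lebesgue. strong_riesz_deriv \<alpha> f x * cis (- (x * v))) \<le> D) \<Longrightarrow>
      norm (quadrature_remainder (2 * pi / h) f) \<le> h powr \<alpha> * (zeta_real \<alpha> / (pi powr \<alpha> * 2 powr (\<alpha> - 1))) * D"
proof -
  obtain g0 where g0: "integrable lebesgue g0"
    and fg0: "\<And>v. of_real (\<bar>v\<bar> powr \<alpha>) * fourier f v = fourier g0 v"
    and fL: "integrable lebesgue f" and cont: "continuous_on UNIV f" and bd: "bounded (range f)"
    using f by (auto simp: W_space_def C_b_def L1_def)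
  obtain B where bdd: "\<And>x. norm (f x) \<le> B"
    using bd by (auto simp: bounded_iff)
  have [measurable]: "f \<in> borel_measurable borel"
    using cont by (rule borel_measurable_continuous_onI)
  have f1: "integrable lborel f"
    using fL by (subst (asm) integrable_completion) auto
  obtain g where g: "integrable lborel g" and g0g: "AE x in lebesgue. g0 x = g x"
    using lebesgue_ex_borel[OF g0] .
  have [measurable]: "g \<in> borel_measurable borel"
    using g by (auto dest: borel_measurable_integrable)
  have gf: "ft g v = of_real (\<bar>v\<bar> powr \<alpha>) * ft f v" for v
  proof -
    have "(LINT u|lebesgue. g0 u * cis (- (u * v))) = (LINT u|lebesgue. g u * cis (- (u * v)))"
      using integrable_lebesgue_cis[OF g0] integrable_lebesgue_cis[OF integrable_lebesgue[OF g]] g0g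
      by (intro integral_cong_AE) auto
    then have "fourier g0 v = fourier g v"
      by (simp add: fourier_eq)
    with fg0[of v] show ?thesis
      by (simp add: fourier_eq_ft)
  qed
  \<comment> \<open>This large order serves the existence of a derivative and the majorant of
    \<open>f\<close>; it may differ from the order hidden in the chosen
    \<open>strong_riesz_deriv\<close>, whose transform is computed independently of it.\<close>
  obtain n :: nat where n: "\<alpha> + 2 \<le> real n"
    using real_arch_simple by blast
  interpret riesz_kernel \<alpha> n
    using \<alpha> n by unfold_locales auto
  have n2: "\<alpha> + 2 \<le> 2 * real n"
    using n by simp
  have "has_strong_riesz_deriv \<alpha> f g"
    by (rule has_strong_riesz_deriv[OF n2 f1 cont bdd g gf])
  then have G: "has_strong_riesz_deriv \<alpha> f (strong_riesz_deriv \<alpha> f)"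
    unfolding strong_riesz_deriv_def by (rule someI[where P = "has_strong_riesz_deriv \<alpha> f"])
  then show "integrable lebesgue (strong_riesz_deriv \<alpha> f)"
    by (simp add: has_strong_riesz_deriv_def L1_def)
  have ftG: "(LINT x|lebesgue. strong_riesz_deriv \<alpha> f x * cis (- (x * v))) = of_real (\<bar>v\<bar> powr \<alpha>) * ft f v" for v
    using fourier_strong_riesz_deriv[OF \<alpha> f1 cont bdd G, of v]
    unfolding fourier_eq[of "strong_riesz_deriv \<alpha> f"] by (simp add: fourier_eq_ft)
  have decay: "norm (ft f v) \<le> M * \<bar>v\<bar> powr (- \<alpha>)" if "v \<noteq> 0" "norm (of_real (\<bar>v\<bar> powr \<alpha>) * ft f v) \<le> M" for v M
  proof -
    have "\<bar>v\<bar> powr \<alpha> * norm (ft f v) \<le> M"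
      using that(2) by (simp add: norm_mult)
    then show ?thesis
      using that(1) by (simp add: powr_minus field_simps)
  qed
  have decay_g: "norm (ft f v) \<le> (LINT x|lborel. norm (g x)) * \<bar>v\<bar> powr (- \<alpha>)" if "v \<noteq> 0" for v
    using norm_ft_le[of g v] unfolding gf by (rule decay[OF that])
  have ff: "integrable lborel (ft f)"
    by (rule integrable_powr_decay[OF continuous_on_ft[OF f1] norm_ft_le \<alpha> decay_g])
  obtain \<psi> where \<psi>: "integrable lborel \<psi>" "\<And>y. 0 \<le> \<psi> y" "\<And>x. norm (f x) \<le> (LINT y|lborel. \<psi> y / (1 + (x - y)\<^sup>2))"
    using norm_le_convolution[OF n2 f1 cont bdd g gf] by blast
  assume h: "h > 0" and D: "\<And>v. 2 * pi / h \<le> \<bar>v\<bar> \<Longrightarrow>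
    norm (LINT x|lebesgue. strong_riesz_deriv \<alpha> f x * cis (- (x * v))) \<le> D"
  note summ = summable_lattice_samples[OF h \<psi>]
  note poisson = poisson_summation[OF h \<alpha> f1 cont bdd ff decay_g summ]
  show "norm (quadrature_remainder (2 * pi / h) f) \<le> h powr \<alpha> * (zeta_real \<alpha> / (pi powr \<alpha> * 2 powr (\<alpha> - 1))) * D"
  proof (rule quadrature_remainder_le[OF h \<alpha> _ poisson])
    fix k :: int assume k: "k \<noteq> 0"
    show "norm (ft f (2 * pi / h * of_int k)) \<le> D * \<bar>2 * pi / h * of_int k\<bar> powr (- \<alpha>)"
    proof (rule decay)
      show "2 * pi / h * of_int k \<noteq> 0"
        using k h by simp
      have "1 \<le> \<bar>real_of_int k\<bar>"
        using k by linarith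
      then have "2 * pi / h * 1 \<le> 2 * pi / h * \<bar>real_of_int k\<bar>"
        using h by (intro mult_left_mono) auto
      also have "\<dots> = \<bar>2 * pi / h * of_int k\<bar>"
        using h by (simp add: abs_mult)
      finally show "norm (of_real (\<bar>2 * pi / h * of_int k\<bar> powr \<alpha>) * ft f (2 * pi / h * of_int k)) \<le> D"
        unfolding ftG[symmetric] by (intro D) simp
    qed
  qed measurable
qed

theorem theorem4p2:
  fixes \<alpha> :: real and f :: "real \<Rightarrow> complex"
  assumes "\<alpha> > 1"
    and "f \<in> W_space \<alpha> \<inter> C_b"
  shows "(\<forall>r::nat. r \<ge> 1 \<longrightarrow> (\<forall>h::real. h > 0 \<longrightarrow>
            norm (quadrature_remainder (2 * pi / h) f)
              \<le> h powr \<alpha> * (zeta_real \<alpha> / (pi powr \<alpha> * 2 powr (real r + \<alpha> - 1)))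
                 * smoothness_modulus r (strong_riesz_deriv \<alpha> f) (h / 2)))
       \<and> (\<forall>h::real. h > 0 \<longrightarrow>
            norm (quadrature_remainder (2 * pi / h) f)
              \<le> h powr \<alpha> * (zeta_real \<alpha> / (pi powr \<alpha> * 2 powr (\<alpha> - 1)))
                 * L1_norm (strong_riesz_deriv \<alpha> f))"
proof -
  let ?G = "strong_riesz_deriv \<alpha> f"
  note R = W_space_quadrature_remainder_le[OF assms]
  note G = integrable_strong_riesz_deriv[OF assms]
  show ?thesis
  proof (intro conjI allI impI)
    fix r :: nat and h :: real
    assume h: "h > 0"
    have "norm (quadrature_remainder (2 * pi / h) f)
        \<le> h powr \<alpha> * (zeta_real \<alpha> / (pi powr \<alpha> * 2 powr (\<alpha> - 1))) * (smoothness_modulus r ?G (h / 2) / 2 ^ r)"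
    proof (rule R[OF h])
      fix v :: real assume v: "2 * pi / h \<le> \<bar>v\<bar>"
      moreover have "0 < 2 * pi / h"
        using h by simp
      ultimately have v0: "v \<noteq> 0" by auto
      \<comment> \<open>The lowest frequency 2 pi / h needs the largest step, h / 2; this fixes the
        argument of the modulus.\<close>
      have "pi / \<bar>v\<bar> \<le> h / 2"
        using v v0 h by (simp add: field_simps)
      from transform_le_smoothness_modulus[OF G v0 this, of r]
      show "norm (LINT x|lebesgue. ?G x * cis (- (x * v))) \<le> smoothness_modulus r ?G (h / 2) / 2 ^ r"
        by (simp add: field_simps)
    qed
    also have "\<dots> = h powr \<alpha> * (zeta_real \<alpha> / (pi powr \<alpha> * 2 powr (real r + \<alpha> - 1))) * smoothness_modulus r ?G (h / 2)"
    proof -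
      have "(2::real) powr (real r + \<alpha> - 1) = 2 powr (\<alpha> - 1) * 2 ^ r"
        by (simp add: powr_realpow[symmetric] powr_add[symmetric] algebra_simps)
      then show ?thesis by simp
    qed
    finally show "norm (quadrature_remainder (2 * pi / h) f)
        \<le> h powr \<alpha> * (zeta_real \<alpha> / (pi powr \<alpha> * 2 powr (real r + \<alpha> - 1))) * smoothness_modulus r ?G (h / 2)" .
  next
    fix h :: real
    assume h: "h > 0"
    show "norm (quadrature_remainder (2 * pi / h) f)
        \<le> h powr \<alpha> * (zeta_real \<alpha> / (pi powr \<alpha> * 2 powr (\<alpha> - 1))) * L1_norm ?G"
      by (rule R[OF h norm_integral_cis_le[OF G]])
  qed
qed

end
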